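(* Let $\chi$ be a primitive Dirichlet character, let $S$ be a nonempty finite set of primes, and let $f:\mathbb{N}\to\mathbb{C}$ be a completely multiplicative function such that $f(p)=\chi(p)$ for every prime $p\notin S$, while for every $p\in S$ we have $f(p)\neq\chi(p)$ and $|f(p)|=1$. Let $$T:=|\{p\in S: f(p)=1\}|-|\{p\in S:\chi(p)=1\}|,$$ and let $N:=\max\{0,T\}$ if $\chi(-1)=-1$, and $N:=\max\{0,T-1\}$ if $\chi(-1)=1$. Then, with $D=\max\{1,N,(|S|-3)/2\}$, $$\sum_{n\leq x}f(n)=\Omega\big((\log x)^D\big),$$ that is, $\limsup_{x\to\infty}\Big|\sum_{n\le x}f(n)\Big|\big/(\log x)^{D}>0$.
   Context: $|S|$ denotes the cardinality of $S$. For $N(x)>0$, $M(x)=\Omega(N(x))$ means $\limsup_{x\to\infty}|M(x)|/N(x)>0$. *)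

theory Defs
  imports "HOL-Analysis.Analysis" "HOL-Library.Extended_Real"
begin

definition dirichlet_character :: "nat \<Rightarrow> (int \<Rightarrow> complex) \<Rightarrow> bool" where
  "dirichlet_character q chi \<longleftrightarrow> q > 0
     \<and> (\<forall>n. chi (n + int q) = chi n)
     \<and> (\<forall>m n. chi (m * n) = chi m * chi n)
     \<and> (\<forall>n. chi n = 0 \<longleftrightarrow> \<not> coprime n (int q))"

definition primitive_character :: "nat \<Rightarrow> (int \<Rightarrow> complex) \<Rightarrow> bool" where
  "primitive_character q chi \<longleftrightarrow> dirichlet_character q chi
     \<and> \<not> (\<exists>d. d dvd q \<and> d < q \<and>
            (\<forall>a. coprime a (int q) \<and> a mod int d = 1 mod int d \<longrightarrow> chi a = 1))"

definition is_primitive_dirichlet_character :: "(int \<Rightarrow> complex) \<Rightarrow> bool" where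
  "is_primitive_dirichlet_character chi \<longleftrightarrow> (\<exists>q. primitive_character q chi)"

definition completely_multiplicative :: "(nat \<Rightarrow> complex) \<Rightarrow> bool" where
  "completely_multiplicative f \<longleftrightarrow> f 1 = 1 \<and> (\<forall>m n. m > 0 \<longrightarrow> n > 0 \<longrightarrow> f (m * n) = f m * f n)"

end

theory Submission
  imports Defs "HOL-Real_Asymp.Real_Asymp" "HOL-Number_Theory.Cong"
begin

text \<open>
  Let \<open>M\<close> be the summatory function of \<open>f\<close>, and suppose \<open>M(x) = o((log x)\<^sup>D)\<close>. If \<open>\<chi>\<close> is trivial,
  the Dirichlet series of \<open>f\<close> would converge at 1, and with it the sum of \<open>1/n\<close> over \<open>n\<close> prime to \<open>S\<close>.
  Otherwise there are three cases.

  If \<open>D \<le> |S|/2\<close>: keep only the terms \<open>n\<close> with \<open>p\<^sup>B \<nmid> n\<close> for all \<open>p \<in> S\<close>. By inclusion-exclusion this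
  enlarges the maximal partial sum at most by the factor \<open>2\<^bsup>|S|\<^esup>\<close>, and the new coefficients are periodic
  with period \<open>Q = q \<Prod>p\<^sup>B\<close>. Their Fourier coefficient at the frequency \<open>1/(q \<Prod>p\<^bsup>v(p)\<^esup>)\<close> is a Gauss sum times a
  product of local factors, which are bounded below because \<open>f(p) \<noteq> \<chi>(p)\<close>. Bessel's inequality over the
  roughly \<open>B\<^bsup>|S|\<^esup>\<close> such frequencies makes some partial sum up to \<open>Q\<close> at least a constant times \<open>B\<^bsup>|S|/2\<^esup>\<close>.

  If \<open>S = {p}\<close> and \<open>D = 1\<close>: \<open>M(p\<^sup>a y) = f(p)\<^sup>a M(y)\<close> for \<open>q | y\<close>, and \<open>M(x + y) = M(x) + M(y)\<close> if \<open>x\<close> is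
  divisible by \<open>q\<close> and a power of \<open>p\<close> exceeding \<open>y\<close>. By the first case some \<open>M(y)\<close> with \<open>q | y\<close> is nonzero,
  and concatenating blocks \<open>p\<^sup>e y\<close> with \<open>f(p)\<^sup>e\<close> close to 1, in exponents with bounded gaps, gives linear
  growth in \<open>log x\<close>.

  If \<open>D = N\<close>: the Dirichlet series of \<open>f\<close> is \<open>o(s\<^bsup>-N\<^esup>)\<close> as \<open>s \<rightarrow> 0+\<close>, but it equals \<open>L(s,\<chi>)\<close> times a finite
  product of order \<open>s\<^bsup>-T\<^esup>\<close>. The order of \<open>L(s,\<chi>)\<close> at 0 is exactly 0 for odd and 1 for even \<open>\<chi>\<close>, since
  its leading coefficient is a nonzero multiple of the value at 1 for the conjugate character.
\<close>

section \<open>Summation by parts\<close>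

text \<open>The exponent |S|/2 comes from a cancellation: at the frequency m/Q the Fourier
  coefficient is at least a constant times m, and passing to partial sums divides it by |e(m/Q) - 1|
  <= 2 pi m/Q. So all the frequencies contribute equally to the mean square, while log Q is only
  linear in B. This settles D = (|S|-3)/2, and also D = 1 when |S| >= 2; a single prime would give
  only (log x)^(1/2), hence the additive construction for it.

  For D = N the obstacle is the order of L(s,chi) at 0, reached through real s > 0 alone, where the
  series may converge only conditionally. Summation by parts expresses the leading coefficient by
  -(1/q) sum chi(a) a for odd chi and by sum chi(a) log Gamma(a/q) for even chi, while Gauss sums
  express L(1, conj chi) by sum chi(a) log(1 - e(a/q)). The reflection a -> q - a matches the two,
  in place of the functional equation. Nonvanishing at 1 is proved by the 3-4-1 inequality if chi^2
  is nonprincipal, and by Lambert series if chi is real.\<close>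

lemma sum_by_parts:
  fixes a :: "nat \<Rightarrow> 'a::real_normed_vector" and w :: "nat \<Rightarrow> real"
  shows "(\<Sum>n<N. w n *\<^sub>R a n) =
    w N *\<^sub>R (\<Sum>k<N. a k) + (\<Sum>n<N. (w n - w (Suc n)) *\<^sub>R (\<Sum>k<Suc n. a k))"
  by (induction N) (simp_all add: algebra_simps)

text \<open>After summation by parts the multipliers \<open>w N\<close> and
  \<open>w n - w (Suc n)\<close> are nonnegative and telescope to \<open>w 0\<close>.\<close>

lemma sum_decreasing_weights_bound:
  fixes a :: "nat \<Rightarrow> 'a::real_normed_vector" and w :: "nat \<Rightarrow> real"
  assumes A: "\<And>n. norm (\<Sum>k<n. a k) \<le> C"
    and dec: "\<And>n. w (Suc n) \<le> w n" and nonneg: "\<And>n. 0 \<le> w n"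
  shows "norm (\<Sum>n<N. w n *\<^sub>R a n) \<le> C * w 0"
proof -
  have "norm (\<Sum>n<N. w n *\<^sub>R a n) \<le> norm (w N *\<^sub>R (\<Sum>k<N. a k)) + 
     (\<Sum>n<N. norm ((w n - w (Suc n)) *\<^sub>R (\<Sum>k<Suc n. a k)))"
    by (subst sum_by_parts) (rule order.trans[OF norm_triangle_ineq add_left_mono[OF norm_sum]])
  also have "\<dots> \<le> w N * C + (\<Sum>n<N. (w n - w (Suc n)) * C)"
    using A dec nonneg unfolding norm_scaleR
    by (intro add_mono sum_mono mult_mono) (auto simp del: sum.lessThan_Suc)
  also have "\<dots> = C * w 0"
    unfolding sum_distrib_right[symmetric] sum_lessThan_telescope' by (simp add: algebra_simps)
  finally show ?thesis .
qed

text \<open>A block of the sequence is a difference of two initial sums, hence the factor 2.\<close>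

lemma sum_decreasing_weights_tail_bound:
  fixes a :: "nat \<Rightarrow> 'a::real_normed_vector" and w :: "nat \<Rightarrow> real"
  assumes A: "\<And>n. norm (\<Sum>k<n. a k) \<le> C"
    and dec: "\<And>n. w (Suc n) \<le> w n" and nonneg: "\<And>n. 0 \<le> w n"
  shows "norm (\<Sum>n=m..<N. w n *\<^sub>R a n) \<le> 2 * C * w m"
proof (cases "m \<le> N")
  case True
  have shift: "(\<Sum>n=m..<m+j. g n) = (\<Sum>n<j. g (n + m))" for g :: "nat \<Rightarrow> 'a" and j
    using sum.shift_bounds_nat_ivl[of g 0 m j] by (simp add: atLeast0LessThan add.commute)
  have "norm (\<Sum>k<n. a (k + m)) \<le> 2 * C" for n
  proof -
    have "(\<Sum>k<n. a (k + m)) = (\<Sum>k<n+m. a k) - (\<Sum>k<m. a k)"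
      using shift[of a n] sum_diff_nat_ivl[of 0 m "n + m" a] by (simp add: atLeast0LessThan add.commute)
    thus ?thesis using norm_triangle_ineq4[of "\<Sum>k<n+m. a k" "\<Sum>k<m. a k"] A[of "n+m"] A[of m]
      by simp
  qed
  from sum_decreasing_weights_bound[of "\<lambda>k. a (k + m)" "2*C" "\<lambda>n. w (n + m)" "N - m", OF this]
  show ?thesis using shift[of "\<lambda>n. w n *\<^sub>R a n" "N - m"] True dec nonneg by simp
next
  case False
  thus ?thesis using order.trans[OF norm_ge_zero A[of 0]] nonneg[of m] by simp
qed

text \<open>Dirichlet's test. It makes the L-series of nonprincipal characters available for all
  real \<open>s > 0\<close>.\<close>

lemma summable_decreasing_weights:
  fixes a :: "nat \<Rightarrow> 'a::banach" and w :: "nat \<Rightarrow> real"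
  assumes A: "\<And>n. norm (\<Sum>k<n. a k) \<le> C"
    and dec: "\<And>n. w (Suc n) \<le> w n" and lim: "w \<longlonglongrightarrow> 0"
  shows "summable (\<lambda>n. w n *\<^sub>R a n)"
proof -
  have nonneg: "0 \<le> w n" for n
    using decseq_ge[OF decseq_SucI lim] dec by blast
  show ?thesis unfolding summable_Cauchy
  proof (intro allI impI)
    fix e :: real assume e: "e > 0"
    have "(\<lambda>n. 2 * C * w n) \<longlonglongrightarrow> 2 * C * 0" by (intro tendsto_intros lim)
    hence "\<forall>\<^sub>F n in sequentially. 2 * C * w n < e" using e by (intro order_tendstoD) auto
    then obtain M where M: "\<And>n. n \<ge> M \<Longrightarrow> 2 * C * w n < e" by (auto simp: eventually_sequentially)
    show "\<exists>N. \<forall>m\<ge>N. \<forall>n. norm (\<Sum>n=m..<n. w n *\<^sub>R a n) < e"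
      using sum_decreasing_weights_tail_bound[of a C w, OF A dec nonneg] M
      by (meson order.strict_trans1)
  qed
qed

lemma suminf_decreasing_weights_bound:
  fixes a :: "nat \<Rightarrow> 'a::banach" and w :: "nat \<Rightarrow> real"
  assumes A: "\<And>n. norm (\<Sum>k<n. a k) \<le> C"
    and dec: "\<And>n. w (Suc n) \<le> w n" and lim: "w \<longlonglongrightarrow> 0"
  shows "norm (\<Sum>n. w n *\<^sub>R a n) \<le> C * w 0"
proof -
  have nonneg: "0 \<le> w n" for n
    using decseq_ge[OF decseq_SucI lim] dec by blast
  have "(\<lambda>N. norm (\<Sum>n<N. w n *\<^sub>R a n)) \<longlonglongrightarrow> norm (\<Sum>n. w n *\<^sub>R a n)"
    by (intro tendsto_norm summable_LIMSEQ summable_decreasing_weights[of a C w, OF A dec lim])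
  thus ?thesis
    by (rule LIMSEQ_le_const2)
       (use sum_decreasing_weights_bound[of a C w, OF A dec nonneg] in auto)
qed

text \<open>The tail bound depends on the weights only through their value at the cut-off
  \<open>m\<close>, and \<open>w t m\<close> tends to \<open>w0 m\<close>; so the tails are
  uniformly small near the limit and only finitely many terms remain. This serves both Abel's limit
  \<open>r -> 1\<close> and the limit \<open>s -> 0\<close>.\<close>

lemma tendsto_suminf_decreasing_weights:
  fixes a :: "nat \<Rightarrow> 'a::banach" and w :: "'b \<Rightarrow> nat \<Rightarrow> real"
  assumes A: "\<And>n. norm (\<Sum>k<n. a k) \<le> C"
    and dec: "\<forall>\<^sub>F t in F. (\<forall>n. w t (Suc n) \<le> w t n) \<and> w t \<longlonglongrightarrow> 0"
    and dec0: "\<And>n. w0 (Suc n) \<le> w0 n" "w0 \<longlonglongrightarrow> 0"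
    and lim: "\<And>n. ((\<lambda>t. w t n) \<longlongrightarrow> w0 n) F"
  shows "((\<lambda>t. \<Sum>n. w t n *\<^sub>R a n) \<longlongrightarrow> (\<Sum>n. w0 n *\<^sub>R a n)) F"
proof (rule tendstoI)
  fix e :: real assume e: "e > 0"
  have tail: "norm ((\<Sum>n. v n *\<^sub>R a n) - (\<Sum>n<m. v n *\<^sub>R a n)) \<le> 2 * C * v m"
    if v: "\<And>n. v (Suc n) \<le> v n" "v \<longlonglongrightarrow> 0" for v m
  proof -
    have nonneg: "0 \<le> v n" for n
      using decseq_ge[OF decseq_SucI v(2)] v(1) by blast
    have "(\<lambda>N. norm ((\<Sum>n<N. v n *\<^sub>R a n) - (\<Sum>n<m. v n *\<^sub>R a n))) \<longlonglongrightarrow>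
            norm ((\<Sum>n. v n *\<^sub>R a n) - (\<Sum>n<m. v n *\<^sub>R a n))"
      by (intro tendsto_intros summable_LIMSEQ summable_decreasing_weights[of a C v, OF A v])
    thus ?thesis
    proof (rule LIMSEQ_le_const2, intro exI[of _ m] allI impI)
      fix N assume "m \<le> N"
      thus "norm ((\<Sum>n<N. v n *\<^sub>R a n) - (\<Sum>n<m. v n *\<^sub>R a n)) \<le> 2 * C * v m"
        using sum_decreasing_weights_tail_bound[of a C v m N, OF A v(1) nonneg]
        by (simp add: sum_diff_nat_ivl atLeast0LessThan[symmetric])
    qed
  qed
  have "(\<lambda>n. 2 * C * w0 n) \<longlonglongrightarrow> 2 * C * 0" by (intro tendsto_intros dec0)
  hence "\<forall>\<^sub>F n in sequentially. 2 * C * w0 n < e / 3" using e by (intro order_tendstoD) auto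
  then obtain m where m: "2 * C * w0 m < e / 3" by (auto simp: eventually_sequentially)
  have "((\<lambda>t. 2 * C * w t m) \<longlongrightarrow> 2 * C * w0 m) F" by (intro tendsto_intros lim)
  hence ev1: "\<forall>\<^sub>F t in F. 2 * C * w t m < e / 3" using m by (intro order_tendstoD) auto
  have "((\<lambda>t. \<Sum>n<m. w t n *\<^sub>R a n) \<longlongrightarrow> (\<Sum>n<m. w0 n *\<^sub>R a n)) F" by (intro tendsto_intros lim)
  hence ev2: "\<forall>\<^sub>F t in F. dist (\<Sum>n<m. w t n *\<^sub>R a n) (\<Sum>n<m. w0 n *\<^sub>R a n) < e / 3"
    using e by (intro tendstoD) auto
  show "\<forall>\<^sub>F t in F. dist (\<Sum>n. w t n *\<^sub>R a n) (\<Sum>n. w0 n *\<^sub>R a n) < e"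
    using ev1 ev2 dec
  proof eventually_elim
    case (elim t)
    have "norm ((\<Sum>n. w t n *\<^sub>R a n) - (\<Sum>n<m. w t n *\<^sub>R a n)) \<le> 2 * C * w t m"
      by (rule tail) (use elim in auto)
    moreover have "norm ((\<Sum>n. w0 n *\<^sub>R a n) - (\<Sum>n<m. w0 n *\<^sub>R a n)) \<le> 2 * C * w0 m"
      by (rule tail) (use dec0 in auto)
    ultimately show ?case using elim(1,2) m unfolding dist_norm by norm
  qed
qed

lemma suminf_by_parts:
  fixes a :: "nat \<Rightarrow> 'a::banach" and w :: "nat \<Rightarrow> real"
  assumes A: "(\<lambda>N. w N *\<^sub>R (\<Sum>k<N. a k)) \<longlonglongrightarrow> 0" and sm: "summable (\<lambda>n. w n *\<^sub>R a n)"
  shows "(\<lambda>n. (w n - w (Suc n)) *\<^sub>R (\<Sum>k<Suc n. a k)) sums (\<Sum>n. w n *\<^sub>R a n)"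
proof -
  have "(\<lambda>N. (\<Sum>n<N. w n *\<^sub>R a n) - w N *\<^sub>R (\<Sum>k<N. a k)) \<longlonglongrightarrow> (\<Sum>n. w n *\<^sub>R a n) - 0"
    by (intro tendsto_diff A summable_LIMSEQ sm)
  thus ?thesis unfolding sums_def by (subst (asm) sum_by_parts) simp
qed

section \<open>Dirichlet characters and Gauss sums\<close>

definition uroot :: "nat \<Rightarrow> int \<Rightarrow> complex" where
  "uroot k n = cis (2 * pi * real_of_int n / real k)"

lemma norm_uroot [simp]: "norm (uroot k n) = 1"
  by (simp add: uroot_def)

lemma uroot_add: "uroot k (m + n) = uroot k m * uroot k n"
  by (simp add: uroot_def cis_mult add_divide_distrib ring_distribs)

lemma uroot_minus: "uroot k (- n) = cnj (uroot k n)"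
  by (simp add: uroot_def cis_cnj)

lemma uroot_mult_cnj [simp]: "uroot k n * cnj (uroot k n) = 1" "cnj (uroot k n) * uroot k n = 1"
  by (simp_all add: uroot_def cis_cnj cis_mult)

lemma uroot_power: "uroot k n ^ j = uroot k (n * int j)"
  unfolding uroot_def Complex.DeMoivre by (rule arg_cong[of _ _ cis]) simp

lemma uroot_cancel: "c > 0 \<Longrightarrow> uroot (k * c) (n * int c) = uroot k n"
  by (simp add: uroot_def mult.assoc[symmetric])

lemma uroot_eq_1_iff:
  assumes "k > 0"
  shows "uroot k n = 1 \<longleftrightarrow> int k dvd n"
proof -
  have "uroot k n = 1 \<longleftrightarrow> (\<exists>m::int. 2 * pi * real_of_int n / real k = of_int (2 * m) * pi)"
    unfolding uroot_def cis_conv_exp exp_eq_1 by simp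
  also have "\<dots> \<longleftrightarrow> (\<exists>m::int. real_of_int n = real_of_int (int k * m))"
    using assms by (simp add: field_simps)
  also have "\<dots> \<longleftrightarrow> int k dvd n"
    unfolding of_int_eq_iff dvd_def by simp
  finally show ?thesis .
qed

lemma uroot_periodic: "uroot k (n + int k * j) = uroot k n"
  \<comment> \<open>Division by zero makes \<open>uroot 0\<close> constantly 1.\<close>
  by (cases "k = 0") (use uroot_eq_1_iff[of k "int k * j"] in \<open>auto simp: uroot_add\<close>)

lemma sum_uroot:
  assumes "k > 0"
  shows "(\<Sum>j<k. uroot k (n * int j)) = (if int k dvd n then of_nat k else 0)"
proof (cases "int k dvd n")
  case True
  hence "uroot k (n * int j) = 1" for j using assms by (subst uroot_eq_1_iff) auto
  thus ?thesis using True by simp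
next
  case False
  hence "uroot k n \<noteq> 1" using assms by (simp add: uroot_eq_1_iff)
  moreover have "uroot k n ^ k = 1" using assms by (simp add: uroot_power uroot_eq_1_iff)
  ultimately show ?thesis using False by (simp add: uroot_power[symmetric] geometric_sum)
qed

lemma norm_uroot_minus_1_le: "norm (uroot k n - 1) \<le> 2 * pi * \<bar>real_of_int n\<bar> / real k"
proof -
  have "norm (cis t - 1) \<le> \<bar>t\<bar>" for t
  proof -
    have "norm (cis t - 1) = 2 * \<bar>sin (t / 2)\<bar>"
      using dist_exp_i_1[of t] by (simp add: cis_conv_exp)
    thus ?thesis using abs_sin_x_le_abs_x[of "t / 2"] by simp
  qed
  from this[of "2 * pi * real_of_int n / real k"] show ?thesis by (simp add: uroot_def abs_mult)
qed

lemma sum_lessThan_add: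
  fixes g :: "nat \<Rightarrow> 'a::comm_monoid_add"
  shows "(\<Sum>n<a + b. g n) = (\<Sum>n<a. g n) + (\<Sum>n<b. g (a + n))"
  by (induction b) (simp_all add: add_ac)

lemma sum_periodic_blocks:
  fixes g :: "nat \<Rightarrow> 'a::comm_semiring_1"
  assumes "\<And>n. g (n + q) = g n"
  shows "(\<Sum>n<m*q. g n) = of_nat m * (\<Sum>n<q. g n)"
proof (induction m)
  case (Suc m)
  have per: "g (n + k * q) = g n" for n k
    by (induction k) (simp_all add: assms add.assoc[symmetric] add.commute[of q] add.left_commute)
  have "(\<Sum>n<Suc m*q. g n) = (\<Sum>n<m*q. g n) + (\<Sum>n<q. g (n + m*q))"
    using sum_lessThan_add[of g "m*q" q] by (simp add: add.commute)
  thus ?case by (simp add: per Suc algebra_simps)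
qed auto

text \<open>Multiplication by a unit permutes the residues modulo \<open>q\<close>.\<close>

lemma sum_periodic_mult:
  fixes g :: "int \<Rightarrow> 'a::comm_monoid_add"
  assumes q: "q > 0" and per: "\<And>n. g (n mod int q) = g n" and a: "coprime a (int q)"
  shows "(\<Sum>n<q. g (a * int n)) = (\<Sum>n<q. g (int n))"
proof -
  have inj: "inj_on (\<lambda>n. nat ((a * int n) mod int q)) {..<q}"
  proof (rule inj_onI)
    fix x y assume xy: "x \<in> {..<q}" "y \<in> {..<q}" 
      and "nat ((a * int x) mod int q) = nat ((a * int y) mod int q)"
    hence "[a * int x = a * int y] (mod int q)" using q unfolding cong_def
      by (metis nat_eq_iff2 of_nat_0_less_iff pos_mod_sign)
    hence "[int x = int y] (mod int q)" using a by (simp add: cong_mult_lcancel)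
    thus "x = y" using xy by (simp add: cong_def)
  qed
  have "(\<lambda>n. nat ((a * int n) mod int q)) ` {..<q} = {..<q}"
    by (rule endo_inj_surj) (use inj q in \<open>auto simp: nat_less_iff\<close>)
  hence "(\<Sum>n<q. g (int n)) = (\<Sum>n\<in>(\<lambda>n. nat ((a * int n) mod int q)) ` {..<q}. g (int n))" by simp
  also have "\<dots> = (\<Sum>n<q. g (int (nat ((a * int n) mod int q))))"
    by (subst sum.reindex[OF inj]) simp
  also have "\<dots> = (\<Sum>n<q. g (a * int n))"
    using q by (intro sum.cong) (simp_all add: per)
  finally show ?thesis ..
qed

section \<open>Dirichlet characters\<close>

locale dchar =
  fixes q :: nat and chi :: "int \<Rightarrow> complex"
  assumes dchar: "dirichlet_character q chi"
begin

lemma q_pos: "q > 0"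
  using dchar by (simp add: dirichlet_character_def)

lemma chi_mult: "chi (m * n) = chi m * chi n"
  using dchar by (simp add: dirichlet_character_def)

lemma chi_eq_0_iff: "chi n = 0 \<longleftrightarrow> \<not> coprime n (int q)"
  using dchar by (simp add: dirichlet_character_def)

lemma chi_add_q: "chi (n + int q) = chi n"
  using dchar by (simp add: dirichlet_character_def)

lemma chi_1 [simp]: "chi 1 = 1"
  using chi_mult[of 1 1] chi_eq_0_iff[of 1] by simp

lemma completely_multiplicative_chi: "completely_multiplicative (\<lambda>n. chi (int n))"
  by (simp add: completely_multiplicative_def chi_mult)

lemma chi_power: "chi (n ^ k) = chi n ^ k"
  by (induction k) (simp_all add: chi_mult)

lemma chi_add_mult_nat: "chi (n + int k * int q) = chi n"
proof (induction k)
  case (Suc k)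
  have "n + int (Suc k) * int q = (n + int k * int q) + int q" by (simp add: algebra_simps)
  thus ?case using chi_add_q[of "n + int k * int q"] Suc by metis
qed auto

lemma chi_mod: "chi (n mod int q) = chi n"
proof -
  have "chi (n + k * int q) = chi n" for n k
  proof (cases "k \<ge> 0")
    case True
    thus ?thesis using chi_add_mult_nat[of n "nat k"] by simp
  next
    case False
    thus ?thesis using chi_add_mult_nat[of "n + k * int q" "nat (- k)"] by simp
  qed
  from this[of "n mod int q" "n div int q"] show ?thesis by (simp add: mod_mult_div_eq mult.commute)
qed

lemma chi_cong: "[m = n] (mod int q) \<Longrightarrow> chi m = chi n"
  by (metis chi_mod cong_def)

text \<open>A value of norm above 1 would have unbounded powers, which are again values of a
  periodic and hence bounded function. So no value exceeds 1 in norm, and comparison with an inverse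
  modulo \<open>q\<close> gives equality.\<close>

lemma norm_chi:
  assumes "coprime n (int q)"
  shows "norm (chi n) = 1"
proof -
  have le1: "norm (chi m) \<le> 1" for m
  proof (rule ccontr)
    assume "\<not> norm (chi m) \<le> 1"
    hence gt: "norm (chi m) > 1" by simp
    define C where "C = (\<Sum>k<q. norm (chi (int k)))"
    have bd: "norm (chi k) \<le> C" for k
    proof -
      have "norm (chi (int (nat (k mod int q)))) \<le> C"
        unfolding C_def using q_pos
        by (intro member_le_sum) (auto simp: nat_less_iff)
      thus ?thesis using q_pos by (simp add: chi_mod)
    qed
    obtain j where "norm (chi m) ^ j > C" using gt real_arch_pow by blast
    with bd[of "m ^ j"] show False by (simp add: chi_power norm_power)
  qed
  obtain m where "[n * m = 1] (mod int q)" using cong_solve_coprime_int[OF assms] by blast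
  hence "chi n * chi m = 1" using chi_cong[of "n * m" 1] by (simp add: chi_mult)
  hence "norm (chi n) * norm (chi m) = 1" by (metis norm_mult norm_one)
  thus ?thesis using le1[of n] le1[of m] mult_left_le[of "norm (chi m)" "norm (chi n)"] by simp
qed

lemma norm_chi_le: "norm (chi n) \<le> 1"
  by (cases "coprime n (int q)") (auto simp: norm_chi dest: chi_eq_0_iff[THEN iffD2])

lemma chi_cnj: "coprime n (int q) \<Longrightarrow> chi n * cnj (chi n) = 1"
  using norm_chi[of n] by (simp add: complex_norm_square[symmetric])

lemma chi_minus: "chi (- n) = chi (- 1) * chi n"
  using chi_mult[of "-1" n] by simp

lemma chi_minus_1_cases: "chi (- 1) = 1 \<or> chi (- 1) = - 1"
proof -
  have "chi (- 1) * chi (- 1) = 1" using chi_mult[of "-1" "-1"] by simp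
  thus ?thesis by (simp add: square_eq_1_iff)
qed

lemma sum_chi_eq_0:
  assumes "\<exists>a. coprime a (int q) \<and> chi a \<noteq> 1"
  shows "(\<Sum>n<q. chi (int n)) = 0"
proof -
  obtain a where a: "coprime a (int q)" "chi a \<noteq> 1" using assms by blast
  have "(\<Sum>n<q. chi (int n)) = (\<Sum>n<q. chi (a * int n))"
    by (rule sum_periodic_mult[symmetric]) (use a q_pos chi_mod in auto)
  also have "\<dots> = chi a * (\<Sum>n<q. chi (int n))"
    by (simp add: chi_mult sum_distrib_left)
  finally show ?thesis using a by simp
qed

end

text \<open>Whole periods cancel, and fewer than \<open>q\<close> terms remain.\<close>

lemma sum_periodic_bound:
  fixes g :: "nat \<Rightarrow> 'a::{real_normed_vector,comm_semiring_1}"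
  assumes q: "q > 0" and per: "\<And>n. g (n + q) = g n" and zero: "(\<Sum>n<q. g n) = 0" 
    and bd: "\<And>n. norm (g n) \<le> K"
  shows "norm (\<Sum>n<N. g n) \<le> real q * K"
proof -
  have "(\<Sum>n<N. g n) = (\<Sum>n<(N div q) * q. g n) + (\<Sum>n<N mod q. g ((N div q) * q + n))"
    using sum_lessThan_add[of g "(N div q) * q" "N mod q"] by simp
  also have "(\<Sum>n<(N div q) * q. g n) = 0" using sum_periodic_blocks[of g q "N div q", OF per] zero by simp
  finally have "norm (\<Sum>n<N. g n) \<le> (\<Sum>n<N mod q. norm (g ((N div q) * q + n)))"
    by (simp add: norm_sum)
  also have "\<dots> \<le> real (N mod q) * K" using sum_bounded_above[of "{..<N mod q}" _ K] bd by simp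
  also have "\<dots> \<le> real q * K"
    using q order.trans[OF norm_ge_zero bd] by (intro mult_right_mono) (simp_all add: less_imp_le)
  finally show ?thesis .
qed

section \<open>Primitive characters and their Gauss sums\<close>

locale primitive_dchar = dchar +
  assumes primitive: "\<not> (\<exists>d. d dvd q \<and> d < q \<and>
            (\<forall>a. coprime a (int q) \<and> a mod int d = 1 mod int d \<longrightarrow> chi a = 1))"
begin

text \<open>Otherwise \<open>d = 1\<close> would contradict primitivity.\<close>

lemma nonprincipal: "q > 1 \<Longrightarrow> \<exists>a. coprime a (int q) \<and> chi a \<noteq> 1"
  using primitive by (metis int_ops(2) mod_by_1 one_dvd)

definition gauss :: "int \<Rightarrow> complex" where
  "gauss m = (\<Sum>n<q. chi (int n) * uroot q (m * int n))"

lemma uroot_mod: "uroot q (m * (n mod int q)) = uroot q (m * n)"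
proof -
  have "m * n = m * (n mod int q) + int q * (m * (n div int q))"
    by (metis distrib_left mod_mult_div_eq mult.left_commute)
  thus ?thesis using uroot_periodic by metis
qed

lemma gauss_coprime:
  assumes "coprime m (int q)"
  shows "gauss m = cnj (chi m) * gauss 1"
proof -
  have "chi m * gauss m = (\<Sum>n<q. chi (m * int n) * uroot q (1 * (m * int n)))"
    by (simp add: gauss_def sum_distrib_left chi_mult mult_ac)
  also have "\<dots> = gauss 1" unfolding gauss_def
    by (rule sum_periodic_mult[of q "\<lambda>n. chi n * uroot q (1 * n)"])
       (use assms q_pos in \<open>simp_all only: chi_mod uroot_mod\<close>)
  finally have "cnj (chi m) * (chi m * gauss m) = cnj (chi m) * gauss 1" by simp
  thus ?thesis using chi_cnj[OF assms] by (simp add: mult.assoc[symmetric] mult.commute)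
qed

text \<open>Put \<open>d = q / gcd(m, q) < q\<close>. Primitivity provides a unit \<open>a\<close>,
  congruent to 1 modulo \<open>d\<close>, with \<open>chi a\<close> different from 1. Replacing
  \<open>n\<close> by \<open>a * n\<close> leaves the roots of unity unchanged but multiplies the
  sum by \<open>chi a\<close>.\<close>

lemma gauss_not_coprime:
  assumes "\<not> coprime m (int q)"
  shows "gauss m = 0"
proof -
  define g where "g = gcd m (int q)"
  have "g > 0" unfolding g_def using q_pos by simp
  moreover have "g \<noteq> 1" using assms unfolding g_def by (simp add: coprime_iff_gcd_eq_1)
  ultimately have g: "g > 1" by linarith
  have "g dvd int q" "g dvd m" unfolding g_def by auto
  then obtain d' m' where d': "int q = g * d'" and m': "m = g * m'" by (auto elim!: dvdE)
  have "d' > 0" using d' q_pos g by (metis of_nat_0_less_iff zero_less_mult_pos less_trans zero_less_one)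
  then obtain d where d: "d' = int d" "d > 0" by (metis zero_less_imp_eq_int)
  have qd: "q = nat g * d" using d' d g by (metis int_nat_eq nat_int of_nat_mult order.strict_implies_order less_trans zero_less_one)
  have "d dvd q" "d < q" using qd d g by auto
  then obtain a where a: "coprime a (int q)" "a mod int d = 1 mod int d" "chi a \<noteq> 1"
    using primitive by blast
  have "int d dvd a - 1" using a(2) by (simp add: mod_eq_dvd_iff)
  then obtain t where t: "a = 1 + int d * t" by (metis add.commute diff_add_cancel dvdE)
  have rot: "uroot q (m * (a * n)) = uroot q (m * n)" for n
  proof -
    have "m * (a * n) = m * n + int q * (m' * t * n)"
      unfolding t d' d m' by (simp add: algebra_simps)
    thus ?thesis using uroot_periodic by metis
  qed
  have "gauss m = (\<Sum>n<q. chi (a * int n) * uroot q (m * (a * int n)))" unfolding gauss_def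
    by (rule sum_periodic_mult[of q "\<lambda>n. chi n * uroot q (m * n)", symmetric])
       (use a q_pos in \<open>simp_all only: chi_mod uroot_mod\<close>)
  also have "\<dots> = chi a * gauss m"
    by (simp only: rot gauss_def chi_mult sum_distrib_left mult.assoc)
  finally show ?thesis using a by simp
qed

lemma gauss_eq: "gauss m = cnj (chi m) * gauss 1"
proof (cases "coprime m (int q)")
  case True
  thus ?thesis by (rule gauss_coprime)
next
  case False
  hence "gauss m = 0" "chi m = 0" using gauss_not_coprime chi_eq_0_iff by blast+
  thus ?thesis by simp
qed

text \<open>If it vanished, so would every \<open>gauss m\<close>, and Fourier inversion at 1 would
  give \<open>chi 1 = 0\<close>.\<close>

lemma gauss_1_nz: "gauss 1 \<noteq> 0"
proof
  assume "gauss 1 = 0"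
  hence "(\<Sum>m<q. gauss (int m) * uroot q (- int m)) = 0" by (subst gauss_eq) simp
  also have "(\<Sum>m<q. gauss (int m) * uroot q (- int m)) = 
      (\<Sum>n<q. chi (int n) * (\<Sum>m<q. uroot q ((int n - 1) * int m)))"
    unfolding gauss_def sum_distrib_left sum_distrib_right
    by (subst sum.swap) (simp add: uroot_add[symmetric] algebra_simps)
  \<comment> \<open>The representative is written \<open>1 mod q\<close> because
    \<open>q = 1\<close> is allowed here.\<close>
  also have "\<dots> = (\<Sum>n<q. if n = 1 mod q then chi (int n) * of_nat q else 0)"
  proof (intro sum.cong refl)
    fix n assume "n \<in> {..<q}"
    hence "int n = int n mod int q" by simp
    moreover have "1 mod int q = int (1 mod q)" by (metis of_nat_1 zmod_int)
    ultimately have "int q dvd int n - 1 \<longleftrightarrow> int n = int (1 mod q)"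
      using mod_eq_dvd_iff[of "int n" "int q" 1] by argo
    hence "int q dvd int n - 1 \<longleftrightarrow> n = 1 mod q" by (simp only: of_nat_eq_iff)
    thus "chi (int n) * (\<Sum>m<q. uroot q ((int n - 1) * int m)) = 
         (if n = 1 mod q then chi (int n) * of_nat q else 0)"
      by (simp add: sum_uroot q_pos)
  qed
  also have "\<dots> = chi (int (1 mod q)) * of_nat q" using q_pos by simp
  also have "chi (int (1 mod q)) = 1" using chi_mod[of 1] by (metis chi_1 of_nat_1 zmod_int)
  finally show False using q_pos by simp
qed

end

section \<open>Fourier coefficients of truncations\<close>

lemma sum_multiples:
  fixes F :: "nat \<Rightarrow> 'a::comm_monoid_add"
  assumes "c > 0"
  shows "(\<Sum>n<c*R. if c dvd n then F (n div c) else 0) = (\<Sum>m<R. F m)"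
proof -
  have "(\<Sum>n<c*R. if c dvd n then F (n div c) else 0) = (\<Sum>n\<in>{n. n < c*R \<and> c dvd n}. F (n div c))"
    by (simp add: sum.If_cases Int_def)
  also have "\<dots> = (\<Sum>m<R. F m)"
    by (rule sum.reindex_bij_witness[of _ "\<lambda>m. c * m" "\<lambda>n. n div c"])
       (use assms in \<open>auto elim!: dvdE simp: less_mult_imp_div_less mult.commute\<close>)
  finally show ?thesis .
qed

lemma sum_periodic_times_power:
  fixes g :: "nat \<Rightarrow> 'a::comm_ring_1"
  assumes per: "\<And>n. g (n + Q) = g n"
  shows "(\<Sum>m<R*Q. g m * z ^ m) = (\<Sum>j<R. (z ^ Q) ^ j) * (\<Sum>m<Q. g m * z ^ m)"
proof (induction R)
  case (Suc R)
  have per': "g (n + k * Q) = g n" for n k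
    by (induction k) (simp_all add: per add.assoc[symmetric] add.commute[of Q] add.left_commute)
  have "(\<Sum>n<Suc R*Q. g n * z ^ n) = (\<Sum>n<R*Q. g n * z ^ n) + (\<Sum>n<Q. g (n + R*Q) * z ^ (n + R * Q))"
    using sum_lessThan_add[of "\<lambda>n. g n * z ^ n" "R*Q" Q] by (simp add: add.commute)
  also have "(\<Sum>n<Q. g (n + R*Q) * z ^ (n + R * Q)) = (z ^ Q) ^ R * (\<Sum>n<Q. g n * z ^ n)"
    unfolding sum_distrib_left by (intro sum.cong refl) (simp only: per' power_add power_mult, simp add: mult_ac flip: power_mult)
  finally show ?case using Suc by (simp add: algebra_simps)
qed auto

context primitive_dchar
begin

text \<open>The coefficient of \<open>x ^ k\<close> in \<open>(1 - \<chi>(p) x) * (\<Sum>j<B. (f(p) x) ^ j)\<close>.\<close>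
definition hcoeff :: "(nat \<Rightarrow> complex) \<Rightarrow> nat \<Rightarrow> nat \<Rightarrow> nat \<Rightarrow> complex" where
  "hcoeff f B p k = (if k = 0 then 1 else if k < B then f p ^ (k - 1) * (f p - chi (int p))
                     else - chi (int p) * f p ^ (B - 1))"

text \<open>Its Dirichlet series is \<open>L(s, chi)\<close> times the polynomials with coefficients
  \<open>hcoeff\<close> in \<open>p^-s\<close>: at each \<open>p\<close> of \<open>ps\<close> the
  Euler factor of \<open>chi\<close> is exchanged for that of \<open>f\<close>, cut off before the
  \<open>B\<close>-th power. One prime per recursion step makes periodicity and Fourier coefficients
  accessible by induction; the identification with values of \<open>f\<close> is
  \<open>trunc_eq\<close>.\<close>

fun trunc :: "(nat \<Rightarrow> complex) \<Rightarrow> nat \<Rightarrow> nat list \<Rightarrow> nat \<Rightarrow> complex" where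
  "trunc f B [] n = chi (int n)"
| "trunc f B (p # ps) n =
     (\<Sum>k\<le>B. hcoeff f B p k * (if p ^ k dvd n then trunc f B ps (n div p ^ k) else 0))"

definition period :: "nat \<Rightarrow> nat list \<Rightarrow> nat" where
  "period B ps = q * (\<Prod>p\<leftarrow>ps. p ^ B)"

lemma period_Cons: "period B (p # ps) = p ^ B * period B ps"
  by (simp add: period_def mult_ac)

lemma period_pos: "\<forall>p\<in>set ps. prime p \<Longrightarrow> period B ps > 0"
  unfolding period_def using q_pos by (induction ps) (auto simp: prime_gt_0_nat)

text \<open>As \<open>k <= B\<close>, a shift by a multiple of the period for \<open>p # ps\<close>
  preserves divisibility by \<open>p^k\<close> and moves the quotient by a multiple of the period
  for \<open>ps\<close>.\<close>

lemma trunc_periodic: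
  assumes "\<forall>p\<in>set ps. prime p"
  shows "trunc f B ps (n + j * period B ps) = trunc f B ps n"
  using assms
proof (induction ps arbitrary: n j)
  case Nil
  show ?case using chi_add_mult_nat[of "int n" j] by (simp add: period_def)
next
  case (Cons p ps)
  have "p > 0" using Cons.prems by (simp add: prime_gt_0_nat)
  have "(if p ^ k dvd n + j * period B (p # ps) then trunc f B ps ((n + j * period B (p # ps)) div p ^ k) else 0)
      = (if p ^ k dvd n then trunc f B ps (n div p ^ k) else 0)" if "k \<le> B" for k
  proof -
    have e: "j * period B (p # ps) = p ^ k * (j * p ^ (B - k) * period B ps)"
      using that by (simp add: period_Cons mult_ac flip: power_add)
    show ?thesis unfolding e using \<open>p > 0\<close> Cons.IH[of "n div p ^ k" "j * p ^ (B - k)"] Cons.prems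
      by (simp add: dvd_add_left_iff)
  qed
  thus ?case by (simp cong: if_cong)
qed

lemma trunc_mult:
  assumes "prime p" "p \<notin> set ps" "\<forall>p\<in>set ps. prime p"
  shows "trunc f B ps (p * n) = chi (int p) * trunc f B ps n"
  using assms(2,3)
proof (induction ps arbitrary: n)
  case Nil
  show ?case by (simp add: chi_mult)
next
  case (Cons r ps)
  have "coprime p r" using Cons.prems assms(1) by (auto simp: primes_coprime)
  hence cop: "coprime (r ^ k) p" for k by (simp add: coprime_commute)
  have "(if r ^ k dvd p * n then trunc f B ps ((p * n) div r ^ k) else 0)
      = chi (int p) * (if r ^ k dvd n then trunc f B ps (n div r ^ k) else 0)" for k
  proof (cases "r ^ k dvd n")
    case True
    thus ?thesis using Cons by (simp add: div_mult_swap[symmetric])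
  next
    case False
    thus ?thesis using coprime_dvd_mult_right_iff[OF cop] by simp
  qed
  thus ?case by (simp add: sum_distrib_left mult_ac cong: if_cong)
qed

lemma trunc_mult_power:
  assumes "prime p" "p \<notin> set ps" "\<forall>p\<in>set ps. prime p"
  shows "trunc f B ps (p ^ k * n) = chi (int p) ^ k * trunc f B ps n"
  by (induction k) (simp_all add: trunc_mult[OF assms] mult.assoc)

lemma sum_trunc_Cons:
  assumes "p > 0"
  shows "(\<Sum>n<period B (p # ps). trunc f B (p # ps) n * F n) =
    (\<Sum>k\<le>B. hcoeff f B p k * (\<Sum>m<p ^ (B - k) * period B ps. trunc f B ps m * F (p ^ k * m)))"
proof -
  have "(\<Sum>n<period B (p # ps). trunc f B (p # ps) n * F n) =
    (\<Sum>k\<le>B. hcoeff f B p k * (\<Sum>n<period B (p # ps). if p ^ k dvd n then trunc f B ps (n div p ^ k) * F n else 0))"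
    by (simp add: sum_distrib_right sum_distrib_left mult.assoc if_distrib[of "\<lambda>x. x * _"] cong: if_cong)
       (rule sum.swap)
  also have "\<dots> = (\<Sum>k\<le>B. hcoeff f B p k * (\<Sum>m<p ^ (B - k) * period B ps. trunc f B ps m * F (p ^ k * m)))"
  proof (rule sum.cong[OF refl])
    fix k assume "k \<in> {..B}"
    hence e: "period B (p # ps) = p ^ k * (p ^ (B - k) * period B ps)"
      by (simp add: period_Cons mult_ac flip: power_add)
    have "(\<Sum>n<period B (p # ps). if p ^ k dvd n then trunc f B ps (n div p ^ k) * F n else 0) =
          (\<Sum>n<p ^ k * (p ^ (B - k) * period B ps). if p ^ k dvd n then 
              (\<lambda>m. trunc f B ps m * F (p ^ k * m)) (n div p ^ k) else 0)"
      unfolding e by (intro sum.cong refl) auto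
    also have "\<dots> = (\<Sum>m<p ^ (B - k) * period B ps. trunc f B ps m * F (p ^ k * m))"
      by (rule sum_multiples) (use assms in auto)
    finally show "hcoeff f B p k * (\<Sum>n<period B (p # ps). if p ^ k dvd n then trunc f B ps (n div p ^ k) * F n else 0) =
          hcoeff f B p k * (\<Sum>m<p ^ (B - k) * period B ps. trunc f B ps m * F (p ^ k * m))" by simp
  qed
  finally show ?thesis .
qed

lemma sum_trunc_eq_0:
  assumes "q > 1" "\<forall>p\<in>set ps. prime p"
  shows "(\<Sum>n<period B ps. trunc f B ps n) = 0"
  using assms(2)
proof (induction ps)
  case Nil
  show ?case using sum_chi_eq_0[OF nonprincipal[OF assms(1)]] by (simp add: period_def)
next
  case (Cons p ps)
  have "(\<Sum>m<R * period B ps. trunc f B ps m) = 0" for R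
    using sum_periodic_blocks[of "trunc f B ps" "period B ps" R] trunc_periodic[of ps f B _ 1] Cons by simp
  thus ?case using sum_trunc_Cons[of p f B ps "\<lambda>_. 1"] Cons.prems by (simp add: prime_gt_0_nat)
qed

lemma trunc_0: "q > 1 \<Longrightarrow> trunc f B ps 0 = 0"
  by (induction ps) (simp_all add: chi_eq_0_iff)

text \<open>The contribution of \<open>p\<close> to the Fourier coefficient at a fraction whose
  denominator has the extra power \<open>p^v\<close>: terms with \<open>k < v\<close> vanish, the
  others bring \<open>cnj (chi p)^(k-v)\<close> from the Gauss sum at a multiple of
  \<open>p^(k-v)\<close>, repeated over \<open>p^(B-k)\<close> periods.\<close>

definition local_factor :: "(nat \<Rightarrow> complex) \<Rightarrow> nat \<Rightarrow> nat \<Rightarrow> nat \<Rightarrow> complex" where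
  "local_factor f B p v = (\<Sum>k=v..B. hcoeff f B p k * of_nat p ^ (B - k) * cnj (chi (int p)) ^ (k - v))"

text \<open>Writing \<open>n = p^k * m\<close> turns the fraction \<open>a / (q * D * p^v)\<close>
  into \<open>a * p^(k-v) / (q * D)\<close> if \<open>k >= v\<close>, and the induction hypothesis
  applies to the new numerator; this is why \<open>a\<close> is general. If \<open>k < v\<close>,
  the sum over \<open>m\<close> contains a vanishing geometric sum over the periods.\<close>

lemma fourier_trunc:
  assumes "distinct ps" "\<forall>p\<in>set ps. prime p \<and> 1 \<le> v p \<and> v p \<le> B \<and> \<not> int p dvd a"
  shows "(\<Sum>n<period B ps. trunc f B ps n * uroot (q * (\<Prod>p\<leftarrow>ps. p ^ v p)) (a * int n)) =
     cnj (chi a) * gauss 1 * (\<Prod>p\<leftarrow>ps. local_factor f B p (v p))"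
  using assms
proof (induction ps arbitrary: a)
  case Nil
  show ?case using gauss_eq[of a] by (simp add: gauss_def period_def)
next
  case (Cons p ps)
  define D where "D = (\<Prod>p\<leftarrow>ps. p ^ v p)"
  define D' where "D' = (\<Prod>p\<leftarrow>ps. p ^ (B - v p))"
  define Q where "Q = period B ps"
  have p: "prime p" "p > 0" "1 \<le> v p" "v p \<le> B" "\<not> int p dvd a" "p \<notin> set ps" 
    and ps: "distinct ps" "\<forall>p\<in>set ps. prime p \<and> 1 \<le> v p \<and> v p \<le> B \<and> \<not> int p dvd a"
    using Cons.prems by (auto simp: prime_gt_0_nat)
  have prs: "\<forall>p\<in>set ps. prime p" using ps by auto
  have Q: "Q = q * D * D'" using ps(2) unfolding Q_def period_def D_def D'_def
    by (induction ps) (auto simp: algebra_simps simp flip: power_add)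
  have Q0: "Q > 0" unfolding Q_def by (rule period_pos) fact
  have D0: "D > 0" "D' > 0" using Q0 by (auto simp: Q)
  have copD: "coprime p D'" unfolding D'_def using prs \<open>p \<notin> set ps\<close> p(1)
    by (induction ps) (auto simp: primes_coprime)
  have N: "q * (\<Prod>p\<leftarrow>p # ps. p ^ v p) = q * D * p ^ v p" by (simp add: D_def mult_ac)
  have perQ: "trunc f B ps (n + Q) = trunc f B ps n" for n
    using trunc_periodic[of ps f B n 1] prs by (simp add: Q_def)
  have inner: "(\<Sum>m<p ^ (B - k) * Q. trunc f B ps m * uroot (q * D * p ^ v p) (a * int (p ^ k * m))) =
     (if k < v p then 0 else of_nat p ^ (B - k) * cnj (chi (int p)) ^ (k - v p) * 
        (cnj (chi a) * gauss 1 * (\<Prod>p\<leftarrow>ps. local_factor f B p (v p))))" if k: "k \<le> B" for k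
  proof (cases "k < v p")
    case False
    define b where "b = a * int p ^ (k - v p)"
    have "uroot (q * D * p ^ v p) (a * int (p ^ k * m)) = uroot (q * D) (b * int m)" for m
    proof -
      have "a * int (p ^ k * m) = b * int m * int (p ^ v p)"
        using False by (simp add: b_def mult_ac flip: power_add)
      thus ?thesis using uroot_cancel[of "p ^ v p" "q * D" "b * int m"] \<open>p > 0\<close> by (simp only: zero_less_power)
    qed
    moreover have "uroot (q * D) (b * int (m + Q)) = uroot (q * D) (b * int m)" for m
      using uroot_periodic[of "q * D" "b * int m" "b * int D'"] by (simp add: Q algebra_simps)
    ultimately have "(\<Sum>m<p ^ (B - k) * Q. trunc f B ps m * uroot (q * D * p ^ v p) (a * int (p ^ k * m))) =
       of_nat (p ^ (B - k)) * (\<Sum>m<Q. trunc f B ps m * uroot (q * D) (b * int m))"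
      using sum_periodic_blocks[of "\<lambda>m. trunc f B ps m * uroot (q * D) (b * int m)" Q "p ^ (B - k)"] 
      by (simp add: perQ)
    also have "\<dots> = of_nat (p ^ (B - k)) * (cnj (chi b) * gauss 1 * (\<Prod>p\<leftarrow>ps. local_factor f B p (v p)))"
    proof -
      have "\<forall>r\<in>set ps. \<not> int r dvd b"
      proof
        fix r assume r: "r \<in> set ps"
        hence "prime (int r)" "\<not> int r dvd a" "r \<noteq> p" using ps p by auto
        moreover have "\<not> r dvd p ^ (k - v p)"
          using \<open>r \<noteq> p\<close> p(1) r prs by (meson prime_dvd_power primes_dvd_imp_eq)
        hence "\<not> int r dvd int p ^ (k - v p)" by (metis int_dvd_int_iff of_nat_power)
        ultimately show "\<not> int r dvd b" unfolding b_def by (simp add: prime_dvd_mult_iff)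
      qed
      hence "(\<Sum>m<Q. trunc f B ps m * uroot (q * D) (b * int m)) = 
          cnj (chi b) * gauss 1 * (\<Prod>p\<leftarrow>ps. local_factor f B p (v p))"
        unfolding Q_def D_def using ps by (intro Cons.IH) auto
      thus ?thesis by simp
    qed
    finally show ?thesis using False by (simp add: b_def chi_mult chi_power mult_ac)
  next
    case True
    define z where "z = uroot (q * D * p ^ v p) (a * int p ^ k)"
    have pw: "uroot (q * D * p ^ v p) (a * int (p ^ k * m)) = z ^ m" for m
      unfolding z_def uroot_power by (simp add: mult_ac)
    have N0: "q * D * p ^ v p > 0" using q_pos D0 p by simp
    \<comment> \<open>As \<open>Q = q * D * D'\<close>, this power is
      \<open>e(a * D' / p^(v-k))\<close>, and \<open>p\<close> divides neither \<open>a\<close> nor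
      \<open>D'\<close>.\<close>
    have "z ^ Q \<noteq> 1"
    proof
      assume "z ^ Q = 1"
      hence "int (q * D * p ^ v p) dvd a * int p ^ k * int Q"
        unfolding z_def uroot_power using uroot_eq_1_iff[OF N0] by simp
      hence "int (q * D * p ^ k) * int (p ^ (v p - k)) dvd int (q * D * p ^ k) * (a * int D')"
        using True by (simp add: Q mult_ac flip: power_add)
      hence "int (p ^ (v p - k)) dvd a * int D'" 
        using q_pos D0 p by (subst (asm) dvd_mult_cancel_left) auto
      moreover have "int p dvd int (p ^ (v p - k))" using True by simp
      ultimately have "int p dvd a * int D'" by (rule dvd_trans[rotated])
      moreover have "coprime (int p) (int D')" using copD by simp
      ultimately show False using p(5) coprime_dvd_mult_left_iff by blast
    qed
    moreover have "(z ^ Q) ^ (p ^ (B - k)) = 1"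
    proof -
      have "p ^ (B - k) * p ^ k = p ^ (B - v p) * p ^ v p" using k p by (simp flip: power_add)
      hence "int p ^ k * int p ^ (B - k) = int p ^ (B - v p) * int p ^ v p"
        by (metis mult.commute of_nat_mult of_nat_power)
      hence "a * int p ^ k * int (Q * p ^ (B - k)) = int (q * D * p ^ v p) * (a * int D' * int p ^ (B - v p))"
        by (simp add: Q mult_ac)
      hence "int (q * D * p ^ v p) dvd a * int p ^ k * int (Q * p ^ (B - k))" by (rule dvdI)
      thus ?thesis unfolding z_def uroot_power power_mult[symmetric] uroot_eq_1_iff[OF N0]
        by (simp only: of_nat_mult mult.assoc)
    qed
    ultimately have "(\<Sum>j<p ^ (B - k). (z ^ Q) ^ j) = 0" by (simp add: geometric_sum)
    thus ?thesis unfolding pw using True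
      by (simp add: sum_periodic_times_power[of "trunc f B ps" Q, OF perQ])
  qed
  have "(\<Sum>n<period B (p # ps). trunc f B (p # ps) n * uroot (q * (\<Prod>p\<leftarrow>p # ps. p ^ v p)) (a * int n)) =
     (\<Sum>k\<le>B. hcoeff f B p k * (if k < v p then 0 else of_nat p ^ (B - k) * cnj (chi (int p)) ^ (k - v p) * 
        (cnj (chi a) * gauss 1 * (\<Prod>p\<leftarrow>ps. local_factor f B p (v p)))))"
    unfolding sum_trunc_Cons[OF \<open>p > 0\<close>] N Q_def[symmetric] by (intro sum.cong refl) (simp add: inner del: of_nat_mult)
  also have "\<dots> = (\<Sum>k\<in>{v p..B}. hcoeff f B p k * (of_nat p ^ (B - k) * cnj (chi (int p)) ^ (k - v p) * 
        (cnj (chi a) * gauss 1 * (\<Prod>p\<leftarrow>ps. local_factor f B p (v p)))))"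
    by (rule sum.mono_neutral_cong_right) auto
  also have "\<dots> = local_factor f B p (v p) * (cnj (chi a) * gauss 1 * (\<Prod>p\<leftarrow>ps. local_factor f B p (v p)))"
    unfolding local_factor_def[of f B p] sum_distrib_right by (simp add: mult_ac)
  finally show ?case by (simp add: mult_ac)
qed

end

section \<open>Bessel's inequality and large truncated sums\<close>

text \<open>With \<open>S\<close> the sum of squares on the left, \<open>S\<close> is the pairing of
  \<open>U\<close> with the combination \<open>W\<close> of the orthogonal exponentials weighted by
  the conjugate coefficients. Since \<open>W\<close> has square norm \<open>Q * S\<close>,
  Cauchy-Schwarz gives the bound after division by \<open>S\<close>.\<close>

lemma bessel_uroot:
  fixes U :: "nat \<Rightarrow> complex" and k :: "'i \<Rightarrow> nat"
  assumes I: "finite I" "inj_on k I" "\<And>i. i \<in> I \<Longrightarrow> k i < Q"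
  shows "(\<Sum>i\<in>I. (norm (\<Sum>y<Q. U y * uroot Q (int (k i) * int y)))\<^sup>2) \<le> real Q * (\<Sum>y<Q. (norm (U y))\<^sup>2)"
proof (cases "I = {}")
  case False
  hence Q: "Q > 0" using I by (metis all_not_in_conv gr0I not_less_zero)
  define C where "C i = (\<Sum>y<Q. U y * uroot Q (int (k i) * int y))" for i
  define W where "W y = (\<Sum>i\<in>I. cnj (C i) * uroot Q (int (k i) * int y))" for y
  define S where "S = (\<Sum>i\<in>I. (norm (C i))\<^sup>2)"
  have S0: "S \<ge> 0" by (simp add: S_def sum_nonneg)
  have S1: "of_real S = (\<Sum>y<Q. U y * W y)"
  proof -
    have "of_real S = (\<Sum>i\<in>I. C i * cnj (C i))" unfolding S_def of_real_sum complex_norm_square ..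
    also have "\<dots> = (\<Sum>i\<in>I. \<Sum>y<Q. U y * (cnj (C i) * uroot Q (int (k i) * int y)))"
      by (subst C_def) (simp add: sum_distrib_right sum_distrib_left mult_ac)
    also have "\<dots> = (\<Sum>y<Q. U y * W y)" by (subst sum.swap) (simp add: W_def sum_distrib_left)
    finally show ?thesis .
  qed
  have orth: "(\<Sum>y<Q. uroot Q (int (k i) * int y) * cnj (uroot Q (int (k j) * int y))) = (if i = j then of_nat Q else 0)"
    if "i \<in> I" "j \<in> I" for i j
  proof -
    have "(\<Sum>y<Q. uroot Q (int (k i) * int y) * cnj (uroot Q (int (k j) * int y))) = 
      (\<Sum>y<Q. uroot Q ((int (k i) - int (k j)) * int y))"
      by (simp add: left_diff_distrib uroot_add uroot_minus[symmetric] flip: uroot_add)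
    also have "\<dots> = (if int Q dvd int (k i) - int (k j) then of_nat Q else 0)" by (rule sum_uroot[OF Q])
    also have "int Q dvd int (k i) - int (k j) \<longleftrightarrow> i = j"
    proof
      assume "int Q dvd int (k i) - int (k j)"
      hence "int (k i) mod int Q = int (k j) mod int Q" by (simp add: mod_eq_dvd_iff)
      hence "k i = k j" using I(3)[OF that(1)] I(3)[OF that(2)] by simp
      thus "i = j" using I(2) that by (auto dest: inj_onD)
    qed auto
    finally show ?thesis .
  qed
  have W2: "(\<Sum>y<Q. (norm (W y))\<^sup>2) = real Q * S"
  proof -
    have "complex_of_real (\<Sum>y<Q. (norm (W y))\<^sup>2) = (\<Sum>y<Q. W y * cnj (W y))"
      unfolding of_real_sum complex_norm_square ..
    also have "\<dots> = (\<Sum>y<Q. \<Sum>i\<in>I. \<Sum>j\<in>I. cnj (C i) * C j * 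
         (uroot Q (int (k i) * int y) * cnj (uroot Q (int (k j) * int y))))"
      unfolding W_def cnj_sum sum_product by (intro sum.cong refl) (simp add: mult_ac)
    also have "\<dots> = (\<Sum>i\<in>I. \<Sum>j\<in>I. cnj (C i) * C j * 
         (\<Sum>y<Q. uroot Q (int (k i) * int y) * cnj (uroot Q (int (k j) * int y))))"
      unfolding sum_distrib_left by (subst sum.swap, intro sum.cong refl, subst sum.swap) simp
    also have "\<dots> = (\<Sum>i\<in>I. \<Sum>j\<in>I. if i = j then cnj (C i) * C j * of_nat Q else 0)"
      by (intro sum.cong refl) (simp add: orth)
    also have "\<dots> = of_real (real Q * S)"
      using I(1) unfolding S_def of_real_mult of_real_sum complex_norm_square
      by (simp add: sum_distrib_left mult_ac)
    finally show ?thesis by (simp only: of_real_eq_iff)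
  qed
  have "S = norm (\<Sum>y<Q. U y * W y)" using S0 by (metis S1 abs_of_nonneg norm_of_real)
  also have "\<dots> \<le> (\<Sum>y<Q. \<bar>norm (U y)\<bar> * \<bar>norm (W y)\<bar>)"
    by (rule order.trans[OF norm_sum]) (simp add: norm_mult)
  also have "\<dots> \<le> L2_set (\<lambda>y. norm (U y)) {..<Q} * L2_set (\<lambda>y. norm (W y)) {..<Q}"
    by (rule L2_set_mult_ineq)
  finally have "S\<^sup>2 \<le> (L2_set (\<lambda>y. norm (U y)) {..<Q} * L2_set (\<lambda>y. norm (W y)) {..<Q})\<^sup>2"
    using S0 by (rule power_mono)
  also have "\<dots> = (\<Sum>y<Q. (norm (U y))\<^sup>2) * (real Q * S)"
    using S0 by (simp add: power_mult_distrib L2_set_def sum_nonneg W2)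
  finally have "S * S \<le> S * (real Q * (\<Sum>y<Q. (norm (U y))\<^sup>2))" by (simp add: power2_eq_square mult_ac)
  hence "S \<le> real Q * (\<Sum>y<Q. (norm (U y))\<^sup>2)"
    using S0 by (cases "S = 0") (auto simp: sum_nonneg)
  thus ?thesis by (simp add: S_def C_def)
qed (simp add: sum_nonneg)

context primitive_dchar
begin

text \<open>The terms with \<open>v <= k < B\<close> form a geometric progression of ratio
  \<open>f(p) * cnj chi(p) / p\<close>; the term \<open>k = B\<close> has its own
  coefficient.\<close>

lemma local_factor_eq:
  assumes "1 \<le> v" "v < B" "p > 0"
  shows "local_factor f B p v = of_nat p ^ (B - v) * f p ^ (v - 1) *
    ((f p - chi (int p)) * (\<Sum>i<B - v. (f p * cnj (chi (int p)) / of_nat p) ^ i)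
       - chi (int p) * (f p * cnj (chi (int p)) / of_nat p) ^ (B - v))"
proof -
  define w where "w = f p * cnj (chi (int p)) / of_nat p"
  have "local_factor f B p v = (\<Sum>k=v..<B. hcoeff f B p k * of_nat p ^ (B - k) * cnj (chi (int p)) ^ (k - v))
      + hcoeff f B p B * cnj (chi (int p)) ^ (B - v)"
    unfolding local_factor_def using assms by (simp add: atLeastLessThanSuc_atLeastAtMost[symmetric])
  also have "(\<Sum>k=v..<B. hcoeff f B p k * of_nat p ^ (B - k) * cnj (chi (int p)) ^ (k - v)) =
     (\<Sum>i<B - v. hcoeff f B p (i + v) * of_nat p ^ (B - (i + v)) * cnj (chi (int p)) ^ i)"
    using sum.shift_bounds_nat_ivl[of "\<lambda>k. hcoeff f B p k * of_nat p ^ (B - k) * cnj (chi (int p)) ^ (k - v)" 0 v "B - v"]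
      assms by (simp add: atLeast0LessThan)
  also have "\<dots> = (\<Sum>i<B - v. of_nat p ^ (B - v) * f p ^ (v - 1) * ((f p - chi (int p)) * w ^ i))"
  proof (intro sum.cong refl)
    fix i assume i: "i \<in> {..<B - v}"
    have "of_nat p ^ (B - v) = (of_nat p ^ (B - (i + v)) * of_nat p ^ i :: complex)"
      using i by (simp flip: power_add)
    moreover have "f p ^ (i + v - 1) = f p ^ (v - 1) * f p ^ i" using assms by (simp add: add.commute flip: power_add)
    ultimately show "hcoeff f B p (i + v) * of_nat p ^ (B - (i + v)) * cnj (chi (int p)) ^ i = 
        of_nat p ^ (B - v) * f p ^ (v - 1) * ((f p - chi (int p)) * w ^ i)"
      using i assms less_diff_conv[of i B v] by (simp add: hcoeff_def w_def power_mult_distrib power_divide)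
  qed
  also have "\<dots> = of_nat p ^ (B - v) * f p ^ (v - 1) * ((f p - chi (int p)) * (\<Sum>i<B - v. w ^ i))"
    by (simp add: sum_distrib_left)
  also have "hcoeff f B p B * cnj (chi (int p)) ^ (B - v) = 
      - (of_nat p ^ (B - v) * f p ^ (v - 1) * (chi (int p) * w ^ (B - v)))"
  proof -
    have "f p ^ (B - 1) = f p ^ (v - 1) * f p ^ (B - v)" using assms by (simp flip: power_add)
    thus ?thesis using assms by (simp add: hcoeff_def w_def power_mult_distrib power_divide)
  qed
  finally show ?thesis unfolding w_def by (simp add: algebra_simps)
qed

text \<open>As \<open>B - v\<close> grows, the bracket in \<open>local_factor_eq\<close> tends to
  \<open>(f(p) - chi(p)) / (1 - w)\<close> with \<open>|w| <= 1/2\<close>. This is where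
  \<open>f(p)\<close> different from \<open>chi(p)\<close> enters.\<close>

lemma local_factor_lower_bound:
  assumes p: "prime p" and f: "f p \<noteq> chi (int p)" "norm (f p) = 1"
  shows "\<exists>c>0. \<exists>H. \<forall>B v. 1 \<le> v \<longrightarrow> v + H \<le> B \<longrightarrow> c * real p ^ (B - v) \<le> norm (local_factor f B p v)"
proof -
  define w where "w = f p * cnj (chi (int p)) / of_nat p"
  have p2: "real p \<ge> 2" using p prime_ge_2_nat by auto
  have "norm w \<le> 1 / 2"
  proof -
    have "norm w = norm (chi (int p)) / real p" by (simp add: w_def norm_mult norm_divide f)
    also have "\<dots> \<le> 1 / 2" using p2 norm_chi_le[of "int p"] by (intro frac_le) auto
    finally show ?thesis .
  qed
  hence w1: "norm w < 1" by simp
  define l where "l = (f p - chi (int p)) * (1 / (1 - w))"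
  have l: "l \<noteq> 0" using f w1 by (auto simp: l_def)
  have "(\<lambda>n. (f p - chi (int p)) * (\<Sum>i<n. w ^ i) - chi (int p) * w ^ n) \<longlonglongrightarrow> l - chi (int p) * 0"
    unfolding l_def using geometric_sums[OF w1] w1
    by (intro tendsto_intros LIMSEQ_power_zero) (auto simp: sums_def)
  hence "(\<lambda>n. norm ((f p - chi (int p)) * (\<Sum>i<n. w ^ i) - chi (int p) * w ^ n)) \<longlonglongrightarrow> norm l"
    using tendsto_norm by fastforce
  moreover have "norm l / 2 < norm l" using l by simp
  ultimately have "\<forall>\<^sub>F n in sequentially. norm l / 2 < norm ((f p - chi (int p)) * (\<Sum>i<n. w ^ i) - chi (int p) * w ^ n)"
    by (rule order_tendstoD)
  then obtain H where H: "\<And>n. n \<ge> H \<Longrightarrow> norm l / 2 < norm ((f p - chi (int p)) * (\<Sum>i<n. w ^ i) - chi (int p) * w ^ n)"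
    by (auto simp: eventually_sequentially)
  \<comment> \<open>The successor guarantees \<open>v < B\<close>, as \<open>local_factor_eq\<close>
    demands.\<close>
  have "norm l / 2 * real p ^ (B - v) \<le> norm (local_factor f B p v)" if "1 \<le> v" "v + Suc H \<le> B" for B v
  proof -
    have "norm (local_factor f B p v) = real p ^ (B - v) * 
      norm ((f p - chi (int p)) * (\<Sum>i<B - v. w ^ i) - chi (int p) * w ^ (B - v))"
      using that p by (subst local_factor_eq) (auto simp: norm_mult norm_power f w_def prime_gt_0_nat)
    moreover have "norm l / 2 \<le> norm ((f p - chi (int p)) * (\<Sum>i<B - v. w ^ i) - chi (int p) * w ^ (B - v))"
      using H[of "B - v"] that by linarith
    ultimately show ?thesis by (metis mult.commute mult_left_mono of_nat_0_le_iff zero_le_power)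
  qed
  thus ?thesis using l by (intro exI[of _ "norm l / 2"] conjI exI[of _ "Suc H"]) auto
qed

text \<open>The partial sums vanish at both 0 and \<open>Q\<close>, so shifting the index by one
  creates no boundary term in their transform.\<close>

lemma sum_times_uroot_by_parts:
  fixes g :: "nat \<Rightarrow> complex"
  assumes "Q > 0" "(\<Sum>n<Q. g n) = 0"
  shows "norm (\<Sum>n<Q. g n * uroot Q (m * int n)) =
    norm (uroot Q m - 1) * norm (\<Sum>y<Q. (\<Sum>n<y. g n) * uroot Q (m * int y))"
proof -
  define U where "U y = (\<Sum>n<y. g n)" for y
  define C where "C = (\<Sum>y<Q. U y * uroot Q (m * int y))"
  have "C = (\<Sum>y<Suc Q. U y * uroot Q (m * int y))" using assms by (simp add: C_def U_def)
  also have "\<dots> = (\<Sum>y<Q. U (Suc y) * uroot Q (m * int (Suc y)))"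
    by (subst sum.lessThan_Suc_shift) (simp add: U_def)
  also have "\<dots> = uroot Q m * (\<Sum>y<Q. U (Suc y) * uroot Q (m * int y))"
    by (simp add: sum_distrib_left ring_distribs uroot_add mult_ac)
  also have "(\<Sum>y<Q. U (Suc y) * uroot Q (m * int y)) = C + (\<Sum>n<Q. g n * uroot Q (m * int n))"
    by (simp add: C_def U_def ring_distribs sum.distrib)
  finally have "uroot Q m * (\<Sum>n<Q. g n * uroot Q (m * int n)) = (1 - uroot Q m) * C"
    by (simp add: algebra_simps)
  hence "norm (uroot Q m * (\<Sum>n<Q. g n * uroot Q (m * int n))) = norm ((1 - uroot Q m) * C)" by simp
  thus ?thesis by (simp add: norm_mult C_def U_def norm_minus_commute)
qed

text \<open>Each of the \<open>H^|ps|\<close> exponent vectors \<open>v\<close> gives a frequency at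
  which the transform of the partial sums is at least \<open>c' * Q / (2 pi)\<close>. Bessel then
  yields \<open>H^|ps| * Q^2 * (c' / (2 pi))^2 <= Q^2 * K^2\<close>.\<close>

lemma trunc_partial_sums_large:
  assumes q: "q > 1" and ps: "distinct ps" "\<forall>p\<in>set ps. prime p \<and> f p \<noteq> chi (int p) \<and> norm (f p) = 1"
  shows "\<exists>c>0. \<exists>H0. \<forall>H\<ge>H0. \<forall>K. (\<forall>y<period (2 * H) ps. norm (\<Sum>n<y. trunc f (2 * H) ps n) \<le> K) \<longrightarrow>
           c * sqrt (real H ^ length ps) \<le> K"
proof -
  have "\<forall>p\<in>set ps. \<exists>c. c > 0 \<and> (\<exists>H. \<forall>B v. 1 \<le> v \<longrightarrow> v + H \<le> B \<longrightarrow> c * real p ^ (B - v) \<le> norm (local_factor f B p v))"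
    using local_factor_lower_bound ps(2) by simp
  from bchoice[OF this] obtain c where c: "\<forall>p\<in>set ps. c p > 0 \<and> 
     (\<exists>H. \<forall>B v. 1 \<le> v \<longrightarrow> v + H \<le> B \<longrightarrow> c p * real p ^ (B - v) \<le> norm (local_factor f B p v))" ..
  hence "\<forall>p\<in>set ps. \<exists>H. \<forall>B v. 1 \<le> v \<longrightarrow> v + H \<le> B \<longrightarrow> c p * real p ^ (B - v) \<le> norm (local_factor f B p v)"
    by blast
  from bchoice[OF this] obtain h where h: "\<forall>p\<in>set ps. \<forall>B v. 1 \<le> v \<longrightarrow> v + h p \<le> B \<longrightarrow> 
      c p * real p ^ (B - v) \<le> norm (local_factor f B p v)" ..
  define H0 where "H0 = (\<Sum>p\<in>set ps. h p)"
  define c' where "c' = norm (gauss 1) * (\<Prod>p\<leftarrow>ps. c p)"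
  have c': "c' > 0"
  proof -
    have "(\<Prod>p\<leftarrow>ps. c p) > 0" using c by (induction ps) auto
    thus ?thesis using gauss_1_nz by (simp add: c'_def)
  qed
  have prs: "\<forall>p\<in>set ps. prime p" using ps by auto
  have main: "c' / (2 * pi) * sqrt (real H ^ length ps) \<le> K" if H: "H \<ge> H0" 
    and K: "\<forall>y<period (2 * H) ps. norm (\<Sum>n<y. trunc f (2 * H) ps n) \<le> K" for H K
  proof -
    \<comment> \<open>With exponents at most \<open>H\<close> this leaves
      \<open>B - v p >= H >= H0\<close>, so all lower bounds for local factors apply.\<close>
    define B where "B = 2 * H"
    define Q where "Q = period B ps"
    define V where "V = PiE (set ps) (\<lambda>_. {1..H})"
    define d where "d v = (\<Prod>p\<leftarrow>ps. p ^ v p)" for v :: "nat \<Rightarrow> nat"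
    define m where "m v = (\<Prod>p\<leftarrow>ps. p ^ (B - v p))" for v :: "nat \<Rightarrow> nat"
    define U where "U y = (\<Sum>n<y. trunc f B ps n)" for y
    have Q0: "Q > 0" unfolding Q_def by (rule period_pos) fact
    have K0: "K \<ge> 0" using K Q0 norm_ge_zero order.trans unfolding Q_def B_def by blast
    have V: "p \<in> set ps \<Longrightarrow> 1 \<le> v p \<and> v p \<le> H" if "v \<in> V" for v p
      using that by (auto simp: V_def)
    have Qv: "Q = q * d v * m v" if v: "v \<in> V" for v
    proof -
      have "\<forall>p\<in>set ps. v p \<le> B" using V[OF v] by (force simp: B_def)
      thus ?thesis unfolding Q_def period_def d_def m_def
        by (induction ps) (auto simp: algebra_simps simp flip: power_add)
    qed
    \<comment> \<open>Unique factorization makes the frequencies distinct: the multiplicity of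
      \<open>p\<close> in \<open>m v\<close> is \<open>B - v p\<close>.\<close>
    have inj: "inj_on m V"
    proof (rule inj_onI)
      fix v v' assume v: "v \<in> V" "v' \<in> V" "m v = m v'"
      have "multiplicity p (m v) = B - v p" if p: "p \<in> set ps" for v p
        unfolding m_def prod.distinct_set_conv_list[OF ps(1), symmetric]
        using multiplicity_prod_prime_powers[of "set ps" p "\<lambda>p. B - v p"] p prs by simp
      hence "B - v p = B - v' p" if "p \<in> set ps" for p using v(3) that by metis
      hence "v p = v' p" if "p \<in> set ps" for p using V[OF v(1) that] V[OF v(2) that] that by (force simp: B_def)
      thus "v = v'" using v(1,2) unfolding V_def by (intro PiE_ext) auto
    qed
    have mQ: "0 < m v \<and> m v < Q" if v: "v \<in> V" for v
    proof -
      have "q * d v * m v > 0" using Qv[OF v] Q0 by simp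
      hence "d v > 0" "m v > 0" by auto
      moreover have "1 * m v < q * d v * m v"
        using q \<open>d v > 0\<close> \<open>m v > 0\<close> by (intro mult_strict_right_mono) (auto simp: one_less_mult Suc_lessI less_1_mult')
      ultimately show ?thesis using Qv[OF v] by simp
    qed
    have bnd: "c' * real Q / (2 * pi) \<le> norm (\<Sum>y<Q. U y * uroot Q (int (m v) * int y))" if v: "v \<in> V" for v
    proof -
      define C where "C = norm (\<Sum>y<Q. U y * uroot Q (int (m v) * int y))"
      have "(\<Sum>n<Q. trunc f B ps n * uroot Q (int (m v) * int n)) = 
            (\<Sum>n<period B ps. trunc f B ps n * uroot (q * (\<Prod>p\<leftarrow>ps. p ^ v p)) (1 * int n))"
        unfolding Q_def[symmetric]
      proof (intro sum.cong refl arg_cong2[of _ _ _ _ "(*)"])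
        fix n show "uroot Q (int (m v) * int n) = uroot (q * (\<Prod>p\<leftarrow>ps. p ^ v p)) (1 * int n)"
          using uroot_cancel[of "m v" "q * d v" "int n"] mQ[OF v]
          by (simp add: Qv[OF v] d_def mult.commute)
      qed
      also have "\<dots> = cnj (chi 1) * gauss 1 * (\<Prod>p\<leftarrow>ps. local_factor f B p (v p))"
        using V[OF v] prs ps(1) by (intro fourier_trunc) (fastforce simp: B_def dest: prime_gt_1_nat)+
      finally have "norm (\<Sum>n<Q. trunc f B ps n * uroot Q (int (m v) * int n)) = 
          norm (gauss 1) * norm (\<Prod>p\<leftarrow>ps. local_factor f B p (v p))" by (simp add: norm_mult)
      moreover have "(\<Prod>p\<leftarrow>ps. c p) * real (m v) \<le> norm (\<Prod>p\<leftarrow>ps. local_factor f B p (v p))"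
      proof -
        have "\<forall>p\<in>set ps. 0 < c p \<and> c p * real p ^ (B - v p) \<le> norm (local_factor f B p (v p))"
        proof
          fix p assume p: "p \<in> set ps"
          have "h p \<le> H0" unfolding H0_def using p by (intro member_le_sum) auto
          hence "v p + h p \<le> B" using V[OF v p] H by (simp add: B_def)
          thus "0 < c p \<and> c p * real p ^ (B - v p) \<le> norm (local_factor f B p (v p))"
            using c h V[OF v p] p by blast
        qed
        thus ?thesis unfolding m_def
        proof (induction ps)
          case (Cons r rs)
          have "c r * real r ^ (B - v r) * ((\<Prod>p\<leftarrow>rs. c p) * real (\<Prod>p\<leftarrow>rs. p ^ (B - v p)))
             \<le> norm (local_factor f B r (v r)) * norm (\<Prod>p\<leftarrow>rs. local_factor f B p (v p))"
          proof (rule mult_mono)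
            have "0 \<le> (\<Prod>p\<leftarrow>rs. c p)" using Cons.prems by (induction rs) (auto simp: less_imp_le)
            thus "0 \<le> (\<Prod>p\<leftarrow>rs. c p) * real (\<Prod>p\<leftarrow>rs. p ^ (B - v p))" by (intro mult_nonneg_nonneg) auto
          qed (use Cons in auto)
          thus ?case by (simp add: norm_mult mult_ac)
        qed auto
      qed
      ultimately have "c' * real (m v) \<le> norm (\<Sum>n<Q. trunc f B ps n * uroot Q (int (m v) * int n))"
        unfolding c'_def by (metis mult.assoc mult_left_mono norm_ge_zero)
      also have "\<dots> = norm (uroot Q (int (m v)) - 1) * C"
        unfolding C_def U_def
        by (rule sum_times_uroot_by_parts[OF Q0]) (use sum_trunc_eq_0[OF q prs] in \<open>simp add: Q_def\<close>)
      also have "\<dots> \<le> 2 * pi * real (m v) / real Q * C"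
        using norm_uroot_minus_1_le[of Q "int (m v)"] by (intro mult_right_mono) (auto simp: C_def)
      \<comment> \<open>The size \<open>m v\<close> of the frequency now stands on both sides and
        cancels.\<close>
      finally have "real (m v) * c' \<le> real (m v) * (2 * pi * C / real Q)" by (simp add: mult_ac)
      hence "c' \<le> 2 * pi * C / real Q" using mQ[OF v] by (subst (asm) mult_le_cancel_left_pos) auto
      thus ?thesis using Q0 unfolding C_def[symmetric] by (simp add: field_simps)
    qed
    have finV: "finite V" by (auto simp: V_def intro: finite_PiE)
    have cardV: "card V = H ^ length ps"
      using ps(1) by (simp add: V_def card_PiE distinct_card)
    have "real H ^ length ps * (c' * real Q / (2 * pi))\<^sup>2 = (\<Sum>v\<in>V. (c' * real Q / (2 * pi))\<^sup>2)"
      by (simp add: cardV)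
    also have "\<dots> \<le> (\<Sum>v\<in>V. (norm (\<Sum>y<Q. U y * uroot Q (int (m v) * int y)))\<^sup>2)"
      using bnd c' by (intro sum_mono power_mono) auto
    also have "\<dots> \<le> real Q * (\<Sum>y<Q. (norm (U y))\<^sup>2)"
      by (rule bessel_uroot[OF finV inj]) (use mQ in auto)
    also have "\<dots> \<le> real Q * (\<Sum>y<Q. K\<^sup>2)"
      using K by (intro mult_left_mono sum_mono power_mono) (auto simp: U_def Q_def B_def)
    also have "\<dots> = (real Q)\<^sup>2 * K\<^sup>2" by (simp add: power2_eq_square)
    finally have "(real Q)\<^sup>2 * (real H ^ length ps * (c' / (2 * pi))\<^sup>2) \<le> (real Q)\<^sup>2 * K\<^sup>2"
      by (simp add: power_mult_distrib power_divide mult_ac)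
    hence "real H ^ length ps * (c' / (2 * pi))\<^sup>2 \<le> K\<^sup>2" using Q0 by simp
    hence "sqrt (real H ^ length ps * (c' / (2 * pi))\<^sup>2) \<le> sqrt (K\<^sup>2)" by (rule real_sqrt_le_mono)
    thus ?thesis using K0 c' by (simp add: real_sqrt_mult mult.commute)
  qed
  have "c' / (2 * pi) > 0" using c' by simp
  with main show ?thesis by blast
qed

end

section \<open>Partial sums and truncations\<close>

lemma completely_multiplicative_power:
  "completely_multiplicative f \<Longrightarrow> p > 0 \<Longrightarrow> f (p ^ k) = f p ^ k"
  by (induction k) (auto simp: completely_multiplicative_def)

lemma completely_multiplicative_mult:
  "completely_multiplicative f \<Longrightarrow> m > 0 \<Longrightarrow> n > 0 \<Longrightarrow> f (m * n) = f m * f n"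
  by (simp add: completely_multiplicative_def)

lemma completely_multiplicative_eqI:
  fixes n :: nat
  assumes f: "completely_multiplicative f" and g: "completely_multiplicative g"
    and eq: "\<And>p. prime p \<Longrightarrow> p dvd n \<Longrightarrow> f p = g p" and n: "n > 0"
  shows "f n = g n"
  using n eq
proof (induction n rule: less_induct)
  case (less n)
  show ?case
  proof (cases "n = 1")
    case True
    thus ?thesis using f g by (simp add: completely_multiplicative_def)
  next
    case False
    then obtain p where p: "prime p" "p dvd n" using prime_factor_nat by blast
    then obtain m where m: "n = p * m" by (auto elim: dvdE)
    have "m > 0" "p > 0" "m < n" using m less.prems(1) prime_gt_1_nat[OF p(1)] by auto
    moreover have "f m = g m" using less.IH[of m] less.prems \<open>m < n\<close> \<open>m > 0\<close> by (simp add: m)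
    moreover have "f p = g p" using less.prems(2) p by simp
    ultimately show ?thesis using f g by (simp add: m completely_multiplicative_def)
  qed
qed

lemma completely_multiplicative_le_1:
  fixes n :: nat
  assumes f: "completely_multiplicative f" and le: "\<And>p. prime p \<Longrightarrow> norm (f p) \<le> 1" and n: "n > 0"
  shows "norm (f n) \<le> 1"
  using n
proof (induction n rule: less_induct)
  case (less n)
  show ?case
  proof (cases "n = 1")
    case True
    thus ?thesis using f by (simp add: completely_multiplicative_def)
  next
    case False
    then obtain p where p: "prime p" "p dvd n" using prime_factor_nat by blast
    then obtain m where m: "n = p * m" by (auto elim: dvdE)
    have "m > 0" "p > 0" "m < n" using m less.prems(1) prime_gt_1_nat[OF p(1)] by auto
    thus ?thesis using f le[OF p(1)] less.IH[of m]
      by (simp add: m completely_multiplicative_def norm_mult mult_le_one)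
  qed
qed

text \<open>One step of inclusion-exclusion: writing the removed terms as \<open>p^B * m\<close>
  leaves the conditions at the other primes unchanged. A large \<open>B\<close> serves the
  truncation, \<open>B = 1\<close> the removal of Euler factors.\<close>

lemma sum_not_dvd_prime_powers_insert:
  fixes f :: "nat \<Rightarrow> complex"
  assumes f: "completely_multiplicative f" and p: "prime p" "p \<notin> E" and E: "\<forall>p\<in>E. prime p"
  shows "(\<Sum>n=1..y. if \<exists>p\<in>insert p E. p ^ B dvd n then 0 else f n) = 
    (\<Sum>n=1..y. if \<exists>p\<in>E. p ^ B dvd n then 0 else f n)
     - f p ^ B * (\<Sum>n=1..y div p ^ B. if \<exists>p\<in>E. p ^ B dvd n then 0 else f n)"
proof -
  define g where "g n = (if \<exists>p\<in>E. p ^ B dvd n then 0 else f n)" for n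
  have p0: "p > 0" using p by (simp add: prime_gt_0_nat)
  have gmul: "g (p ^ B * m) = f p ^ B * g m" if "m > 0" for m
  proof -
    have "r ^ B dvd p ^ B * m \<longleftrightarrow> r ^ B dvd m" if "r \<in> E" for r
    proof -
      have "coprime r p" using p that E by (metis primes_coprime)
      hence "coprime (r ^ B) (p ^ B)" by simp
      thus ?thesis by (rule coprime_dvd_mult_right_iff)
    qed
    thus ?thesis using that p0 f by (simp add: g_def completely_multiplicative_mult completely_multiplicative_power)
  qed
  have "(\<Sum>n=1..y. if \<exists>p\<in>insert p E. p ^ B dvd n then 0 else f n) = (\<Sum>n=1..y. g n - (if p ^ B dvd n then g n else 0))"
    by (intro sum.cong) (auto simp: g_def)
  also have "\<dots> = (\<Sum>n=1..y. g n) - (\<Sum>n=1..y. if p ^ B dvd n then g n else 0)"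
    by (simp add: sum_subtractf)
  also have "(\<Sum>n=1..y. if p ^ B dvd n then g n else 0) = (\<Sum>n\<in>{n\<in>{1..y}. p ^ B dvd n}. g n)"
    by (simp add: sum.If_cases Int_def)
  also have "\<dots> = (\<Sum>m=1..y div p ^ B. g (p ^ B * m))"
    by (rule sum.reindex_bij_witness[of _ "\<lambda>m. p ^ B * m" "\<lambda>n. n div p ^ B"])
       (use p0 in \<open>auto elim!: dvdE simp: less_eq_div_iff_mult_less_eq mult.commute\<close>)
  also have "\<dots> = f p ^ B * (\<Sum>m=1..y div p ^ B. g m)"
    by (simp add: gmul sum_distrib_left)
  finally show ?thesis by (simp only: g_def)
qed

text \<open>Each prime at most doubles the bound. The second sum of a sieving step ends at
  \<open>y div p^B\<close>, hence the bound \<open>K\<close> for all lengths up to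
  \<open>x\<close>.\<close>

lemma sum_not_dvd_prime_powers_bound:
  fixes f :: "nat \<Rightarrow> complex"
  assumes f: "completely_multiplicative f" and E: "finite E" "\<forall>p\<in>E. prime p \<and> norm (f p) \<le> 1"
    and K: "\<And>y. y \<le> x \<Longrightarrow> norm (\<Sum>n=1..y. f n) \<le> K" and y: "y \<le> x"
  shows "norm (\<Sum>n=1..y. if \<exists>p\<in>E. p ^ B dvd n then 0 else f n) \<le> 2 ^ card E * K"
  using E y
proof (induction E arbitrary: y rule: finite_induct)
  case empty
  thus ?case using K by simp
next
  case (insert p E)
  define G where "G y = (\<Sum>n=1..y. if \<exists>p\<in>E. p ^ B dvd n then 0 else f n)" for y
  have E: "\<forall>p\<in>E. prime p \<and> norm (f p) \<le> 1" using insert.prems by auto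
  have "norm (\<Sum>n=1..y. if \<exists>p\<in>insert p E. p ^ B dvd n then 0 else f n) = norm (G y - f p ^ B * G (y div p ^ B))"
    unfolding G_def using insert.hyps insert.prems E 
    by (subst sum_not_dvd_prime_powers_insert[OF f]) auto
  also have "\<dots> \<le> norm (G y) + norm (f p ^ B * G (y div p ^ B))"
    by (rule norm_triangle_ineq4)
  also have "\<dots> \<le> norm (G y) + 1 * norm (G (y div p ^ B))"
    unfolding norm_mult norm_power using insert.prems by (intro add_left_mono mult_right_mono power_le_one) auto
  also have "\<dots> \<le> 2 ^ card E * K + 1 * (2 ^ card E * K)"
    unfolding G_def using insert.prems(2) order.trans[OF div_le_dividend]
    by (intro add_mono mult_left_mono insert.IH E) auto
  also have "\<dots> = 2 ^ card (insert p E) * K" using insert.hyps by simp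
  finally show ?case .
qed

context primitive_dchar
begin

text \<open>This compares coefficients of \<open>x^v\<close>: multiplying the polynomial of
  \<open>hcoeff\<close> by \<open>1 / (1 - chi(p) x)\<close> leaves the geometric sum of
  \<open>f(p) x\<close> below degree \<open>B\<close>.\<close>

lemma sum_hcoeff:
  assumes "B > 0"
  shows "(\<Sum>k\<le>B. hcoeff f B p k * (if k \<le> v then chi (int p) ^ (v - k) else 0)) = (if v < B then f p ^ v else 0)"
proof -
  have tele: "(\<Sum>k\<le>j. hcoeff f B p k * chi (int p) ^ (v - k)) = f p ^ j * chi (int p) ^ (v - j)"
    if "j < B" "j \<le> v" for j
    using that
  proof (induction j)
    case (Suc j)
    hence "v - j = Suc (v - Suc j)" by simp
    thus ?case using Suc by (simp add: hcoeff_def algebra_simps)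
  qed (auto simp: hcoeff_def)
  show ?thesis
  proof (cases "v < B")
    case True
    have "(\<Sum>k\<le>B. hcoeff f B p k * (if k \<le> v then chi (int p) ^ (v - k) else 0)) =
          (\<Sum>k\<le>v. hcoeff f B p k * chi (int p) ^ (v - k))"
      using True by (intro sum.mono_neutral_cong_right) auto
    thus ?thesis using tele[of v] True by simp
  next
    case False
    then obtain b where b: "B = Suc b" using assms by (cases B) auto
    \<comment> \<open>For \<open>v >= B\<close> the last coefficient cancels the sum collapsed at
      \<open>b = B - 1\<close>.\<close>
    have "v - b = Suc (v - B)" using False b by simp
    moreover have "(\<Sum>k\<le>B. hcoeff f B p k * (if k \<le> v then chi (int p) ^ (v - k) else 0)) =
          (\<Sum>k\<le>b. hcoeff f B p k * chi (int p) ^ (v - k)) + hcoeff f B p B * chi (int p) ^ (v - B)"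
      using False by (simp add: b)
    ultimately show ?thesis using tele[of b] False by (simp add: b hcoeff_def)
  qed
qed

text \<open>Splitting off the exact power \<open>p^v\<close> of \<open>n\<close> leaves the
  convolution of \<open>sum_hcoeff\<close> times the value at the cofactor. The agreement of
  \<open>f\<close> and \<open>chi\<close> is assumed only at divisors of \<open>n\<close>, so that
  it passes to the cofactor, where \<open>p\<close> no longer occurs.\<close>

lemma trunc_eq:
  assumes f: "completely_multiplicative f" and B: "B > 0"
    and ps: "distinct ps" "\<forall>p\<in>set ps. prime p"
    and eq: "\<And>p. prime p \<Longrightarrow> p dvd n \<Longrightarrow> p \<notin> set ps \<Longrightarrow> f p = chi (int p)" and n: "n > 0"
  shows "trunc f B ps n = (if \<exists>p\<in>set ps. p ^ B dvd n then 0 else f n)"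
  using ps eq n
proof (induction ps arbitrary: n)
  case Nil
  from completely_multiplicative_eqI[OF f completely_multiplicative_chi] have "f n = chi (int n)" using Nil by force
  thus ?case by simp
next
  case (Cons p ps)
  have p: "prime p" "p > 0" "p \<notin> set ps" using Cons.prems by (auto simp: prime_gt_0_nat)
  have prs: "\<forall>p\<in>set ps. prime p" using Cons.prems by auto
  define v where "v = multiplicity p n"
  have "n \<noteq> 0" "\<not> is_unit p" using Cons.prems p(1) by auto
  then obtain m where m: "n = p ^ v * m" "\<not> p dvd m" 
    unfolding v_def using multiplicity_decompose'[of n p] by metis
  have "m > 0" using m \<open>n \<noteq> 0\<close> by (cases m) auto
  have dvd: "p ^ k dvd n \<longleftrightarrow> k \<le> v" for k
    unfolding v_def using \<open>n \<noteq> 0\<close> \<open>\<not> is_unit p\<close> by (intro power_dvd_iff_le_multiplicity) auto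
  have "(if p ^ k dvd n then trunc f B ps (n div p ^ k) else 0) = 
     (if k \<le> v then chi (int p) ^ (v - k) else 0) * trunc f B ps m" for k
  proof (cases "k \<le> v")
    case True
    hence "n = p ^ k * (p ^ (v - k) * m)" using m by (simp add: mult.assoc[symmetric] flip: power_add)
    hence "n div p ^ k = p ^ (v - k) * m" using p by simp
    thus ?thesis using True dvd trunc_mult_power[OF p(1,3) prs] by simp
  qed (use dvd in auto)
  hence "trunc f B (p # ps) n = 
      (\<Sum>k\<le>B. hcoeff f B p k * (if k \<le> v then chi (int p) ^ (v - k) else 0)) * trunc f B ps m"
    by (simp add: sum_distrib_right mult.assoc)
  also have "\<dots> = (if v < B then f p ^ v else 0) * trunc f B ps m" by (simp only: sum_hcoeff[OF B])
  also have "trunc f B ps m = (if \<exists>r\<in>set ps. r ^ B dvd m then 0 else f m)"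
  proof (rule Cons.IH)
    fix r assume "prime r" "r dvd m" "r \<notin> set ps"
    thus "f r = chi (int r)" using Cons.prems(3)[of r] m by (cases "r = p") auto
  qed (use Cons.prems \<open>m > 0\<close> in auto)
  also have "(if v < B then f p ^ v else 0) * (if \<exists>r\<in>set ps. r ^ B dvd m then 0 else f m) =
     (if \<exists>r\<in>set (p # ps). r ^ B dvd n then 0 else f n)"
  proof -
    have "r ^ B dvd m \<longleftrightarrow> r ^ B dvd n" if "r \<in> set ps" for r
    proof -
      have "coprime r p" using prs p that by (metis primes_coprime)
      hence "coprime (r ^ B) (p ^ v)" by simp
      thus ?thesis unfolding m(1) by (rule coprime_dvd_mult_right_iff[symmetric])
    qed
    moreover have "f n = f p ^ v * f m" 
      unfolding m(1) using f p \<open>m > 0\<close> by (simp add: completely_multiplicative_mult completely_multiplicative_power)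
    ultimately show ?thesis using dvd[of B] by auto
  qed
  finally show ?case .
qed

lemma partial_sums_lower_bound:
  fixes f :: "nat \<Rightarrow> complex"
  assumes q: "q > 1" and S: "finite S" "\<forall>p\<in>S. prime p"
    and f: "completely_multiplicative f"
    and f_out: "\<forall>p. prime p \<and> p \<notin> S \<longrightarrow> f p = chi (int p)"
    and f_in: "\<forall>p\<in>S. f p \<noteq> chi (int p) \<and> norm (f p) = 1"
  obtains c A where "c > 0" "A > 0" "\<forall>\<^sub>F H in sequentially. \<exists>y\<ge>1. ln (real y) \<le> A * real H \<and> 
      c * real H powr (real (card S) / 2) \<le> norm (\<Sum>n=1..y. f n)"
proof -
  obtain ps where ps: "set ps = S" "distinct ps" using finite_distinct_list[OF S(1)] by blast
  have len: "length ps = card S" using ps distinct_card by fastforce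
  obtain c H0 where c: "c > 0" and H0: "\<And>H K. H \<ge> H0 \<Longrightarrow> 
     (\<forall>y<period (2 * H) ps. norm (\<Sum>n<y. trunc f (2 * H) ps n) \<le> K) \<Longrightarrow> c * sqrt (real H ^ length ps) \<le> K"
    using trunc_partial_sums_large[OF q ps(2), of f] S(2) f_in ps(1) by blast
  \<comment> \<open>The logarithm of \<open>period (2 * H) ps\<close> is
    \<open>ln q + 2 * H * (sum of ln p)\<close>, which is at most \<open>A * H\<close> for
    \<open>H >= 1\<close>.\<close>
  define A where "A = ln (real q) + 2 * (\<Sum>p\<in>S. ln (real p)) + 1"
  have lnp: "ln (real p) \<ge> 0" if "p \<in> S" for p using S(2) that prime_ge_1_nat by fastforce
  have "A > 0" unfolding A_def using q lnp by (intro add_nonneg_pos add_nonneg_nonneg mult_nonneg_nonneg sum_nonneg) auto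
  \<comment> \<open>The power of 2 pays for the sieve; the other factor 2 makes the final comparison
    contradictory.\<close>
  define c' where "c' = c / 2 / 2 ^ card S"
  have "\<exists>y\<ge>1. ln (real y) \<le> A * real H \<and> c' * real H powr (real (card S) / 2) \<le> norm (\<Sum>n=1..y. f n)"
    if H: "H \<ge> max 1 H0" for H
  proof (rule ccontr)
    assume neg: "\<not> ?thesis"
    define Q where "Q = period (2 * H) ps"
    have Q1: "Q > 0" unfolding Q_def by (rule period_pos) (use ps S in auto)
    have lnQ: "ln (real Q) \<le> A * real H"
    proof -
      have "real Q = real q * (\<Prod>p\<in>S. real p ^ (2 * H))"
        unfolding Q_def period_def ps(1)[symmetric] prod.distinct_set_conv_list[OF ps(2), symmetric] by simp
      hence "ln (real Q) = ln (real q) + (\<Sum>p\<in>S. 2 * real H * ln (real p))"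
        using q_pos S by (auto simp: ln_mult ln_prod ln_realpow prod_pos prime_gt_0_nat intro!: sum.cong)
      also have "\<dots> = ln (real q) * 1 + 2 * (\<Sum>p\<in>S. ln (real p)) * real H" by (simp add: sum_distrib_left mult_ac)
      also have "ln (real q) * 1 \<le> ln (real q) * real H"
        using H q by (intro mult_left_mono) auto
      also have "ln (real q) * real H + 2 * (\<Sum>p\<in>S. ln (real p)) * real H \<le> A * real H"
        by (simp add: A_def algebra_simps)
      finally show ?thesis by simp
    qed
    define K where "K = c' * real H powr (real (card S) / 2)"
    have K: "norm (\<Sum>n=1..y. f n) \<le> K" if "y \<le> Q" for y
    proof (cases "y = 0")
      case False
      hence "ln (real y) \<le> A * real H" using lnQ that by (smt (verit) ln_mono of_nat_0_less_iff of_nat_mono gr0I)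
      thus ?thesis using neg False unfolding K_def
        by (metis One_nat_def Suc_leI gr0I linorder_le_cases)
    qed (use c in \<open>auto simp: K_def c'_def\<close>)
    have "norm (\<Sum>n<y. trunc f (2 * H) ps n) \<le> 2 ^ card S * K" if y: "y < Q" for y
    proof (cases y)
      case (Suc z)
      \<comment> \<open>The term \<open>n = 0\<close> vanishes by \<open>trunc_0\<close>, as
        \<open>q > 1\<close>.\<close>
      have "(\<Sum>n<y. trunc f (2 * H) ps n) = (\<Sum>n=1..z. trunc f (2 * H) ps n)"
        unfolding Suc by (subst sum.lessThan_Suc_shift) (simp add: trunc_0[OF q] sum.atLeast1_atMost_eq)
      also have "\<dots> = (\<Sum>n=1..z. if \<exists>p\<in>S. p ^ (2 * H) dvd n then 0 else f n)"
        using H ps S f_out by (intro sum.cong refl) (subst trunc_eq[OF f], auto)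
      also have "norm \<dots> \<le> 2 ^ card S * K"
        by (rule sum_not_dvd_prime_powers_bound[OF f S(1), where x = Q]) (use S f_in K y Suc in auto)
      finally show ?thesis .
    qed (use c in \<open>auto simp: K_def c'_def\<close>)
    hence "c * sqrt (real H ^ length ps) \<le> 2 ^ card S * K" using H0[of H] H unfolding Q_def by simp
    also have "\<dots> = c / 2 * real H powr (real (card S) / 2)" by (simp add: K_def c'_def)
    also have "real H powr (real (card S) / 2) = sqrt (real H ^ length ps)"
      using H by (simp add: len powr_half_sqrt[symmetric] powr_realpow[symmetric] powr_powr)
    finally have "c * sqrt (real H ^ length ps) \<le> 0" by simp
    moreover have "real H ^ length ps > 0" using H by (intro zero_less_power) auto
    ultimately show False using c by (simp add: mult_le_0_iff)
  qed
  hence "\<forall>\<^sub>F H in sequentially. \<exists>y\<ge>1. ln (real y) \<le> A * real H \<and> 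
      c' * real H powr (real (card S) / 2) \<le> norm (\<Sum>n=1..y. f n)"
    unfolding eventually_sequentially by blast
  moreover have "c' > 0" using c by (simp add: c'_def)
  ultimately show ?thesis using that \<open>A > 0\<close> by blast
qed

end

section \<open>Sieving and Euler products\<close>

text \<open>Only convergence of the partial sums is used, so Euler factors can be removed from
  conditionally convergent series: \<open>x div p\<close> tends to infinity with
  \<open>x\<close>.\<close>

lemma tendsto_sum_not_dvd_primes:
  fixes a :: "nat \<Rightarrow> complex"
  assumes a: "completely_multiplicative a" and lim: "(\<lambda>x. \<Sum>n=1..x. a n) \<longlonglongrightarrow> A"
    and E: "finite E" "\<forall>p\<in>E. prime p"
  shows "(\<lambda>x. \<Sum>n=1..x. if \<exists>p\<in>E. p dvd n then 0 else a n) \<longlonglongrightarrow> (\<Prod>p\<in>E. 1 - a p) * A"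
  using E
proof (induction E rule: finite_induct)
  case empty
  thus ?case using lim by simp
next
  case (insert p E)
  define G where "G y = (\<Sum>n=1..y. if \<exists>p\<in>E. p dvd n then 0 else a n)" for y
  have p: "p > 0" using insert.prems by (auto simp: prime_gt_0_nat)
  have "filterlim (\<lambda>x. x div p) at_top sequentially"
    unfolding filterlim_at_top
  proof
    fix Z show "\<forall>\<^sub>F x in sequentially. Z \<le> x div p"
      using eventually_ge_at_top[of "Z * p"] by eventually_elim (use p in \<open>simp add: less_eq_div_iff_mult_less_eq\<close>)
  qed
  moreover have G: "G \<longlonglongrightarrow> (\<Prod>p\<in>E. 1 - a p) * A" unfolding G_def using insert by auto
  ultimately have "(\<lambda>x. G (x div p)) \<longlonglongrightarrow> (\<Prod>p\<in>E. 1 - a p) * A" using filterlim_compose by blast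
  hence "(\<lambda>x. G x - a p * G (x div p)) \<longlonglongrightarrow> (\<Prod>p\<in>E. 1 - a p) * A - a p * ((\<Prod>p\<in>E. 1 - a p) * A)"
    by (intro tendsto_intros G)
  also have "(\<Prod>p\<in>E. 1 - a p) * A - a p * ((\<Prod>p\<in>E. 1 - a p) * A) = (\<Prod>p\<in>insert p E. 1 - a p) * A"
    using insert.hyps by (simp add: algebra_simps)
  also have "(\<lambda>x. G x - a p * G (x div p)) = (\<lambda>x. \<Sum>n=1..x. if \<exists>p\<in>insert p E. p dvd n then 0 else a n)"
    unfolding G_def using insert.hyps insert.prems sum_not_dvd_prime_powers_insert[OF a, where B = 1 and p = p and E = E]
    by (simp only: power_one_right) auto
  finally show ?case .
qed

lemma sum_atLeast1_eq_lessThan: "(\<Sum>n=1..N. g n) = (\<Sum>n<N. g (Suc n))"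
  by (simp add: sum.atLeast1_atMost_eq)

text \<open>Sieving by the primes up to \<open>N\<close> leaves the term 1 and terms with
  \<open>n > N\<close>, which the absolutely convergent tail dominates. With the product on the side
  of the series, no factor has to be inverted.\<close>

lemma tendsto_euler_product:
  fixes a :: "nat \<Rightarrow> complex"
  assumes a: "completely_multiplicative a" and sm: "summable (\<lambda>n. norm (a (Suc n)))"
  shows "(\<lambda>N. (\<Prod>p | prime p \<and> p \<le> N. 1 - a p) * (\<Sum>n. a (Suc n))) \<longlonglongrightarrow> 1"
proof -
  define A where "A = (\<Sum>n. a (Suc n))"
  define P where "P N = (\<Prod>p | prime p \<and> p \<le> N. 1 - a p)" for N
  have sm': "summable (\<lambda>n. a (Suc n))" by (rule summable_norm_cancel) fact
  have limA: "(\<lambda>x. \<Sum>n=1..x. a n) \<longlonglongrightarrow> A"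
    unfolding A_def sum_atLeast1_eq_lessThan by (intro summable_LIMSEQ sm')
  define T where "T N = (\<Sum>n. norm (a (Suc (n + N))))" for N
  have bound: "norm (P N * A - 1) \<le> T N" if N: "N \<ge> 1" for N
  proof -
    define E where "E = {p. prime p \<and> p \<le> N}"
    have E: "finite E" "\<forall>p\<in>E. prime p" by (auto simp: E_def)
    define h where "h n = (if \<exists>p\<in>E. p dvd n then 0 else a n)" for n
    have h: "h n = 0" if "n \<in> {2..N}" for n
    proof -
      have "n \<noteq> 1" using that by simp
      then obtain p where "prime p" "p dvd n" using prime_factor_nat by blast
      moreover have "p \<le> n" using \<open>p dvd n\<close> that by (intro dvd_imp_le) auto
      ultimately have "p \<in> E" "p dvd n" using that by (auto simp: E_def)
      thus ?thesis unfolding h_def by auto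
    qed
    have h1: "h 1 = 1" using a E by (auto simp: h_def completely_multiplicative_def)
    have "(\<lambda>x. \<Sum>n=1..x. h n) \<longlonglongrightarrow> P N * A"
      unfolding h_def P_def E_def[symmetric] by (rule tendsto_sum_not_dvd_primes[OF a limA E])
    hence "(\<lambda>x. norm ((\<Sum>n=1..x. h n) - 1)) \<longlonglongrightarrow> norm (P N * A - 1)" by (intro tendsto_intros)
    moreover have "norm ((\<Sum>n=1..x. h n) - 1) \<le> T N" if x: "x \<ge> N" for x
    proof -
      have "(\<Sum>n=1..x. h n) = (\<Sum>n=1..N. h n) + (\<Sum>n=Suc N..x. h n)"
        using x sum.ub_add_nat[of 1 N h "x - N"] N by simp
      also have "(\<Sum>n=1..N. h n) = h 1 + (\<Sum>n=2..N. h n)"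
        using N by (simp add: sum.atLeast_Suc_atMost numeral_2_eq_2)
      also have "(\<Sum>n=2..N. h n) = 0" using h by (intro sum.neutral) auto
      finally have "norm ((\<Sum>n=1..x. h n) - 1) \<le> (\<Sum>n=Suc N..x. norm (h n))"
        by (simp add: h1[simplified] norm_sum)
      also have "\<dots> \<le> (\<Sum>n=Suc N..x. norm (a n))" by (intro sum_mono) (simp add: h_def)
      also have "\<dots> = (\<Sum>n<x - N. norm (a (Suc (n + N))))"
        using x by (intro sum.reindex_bij_witness[of _ "\<lambda>n. Suc (n + N)" "\<lambda>n. n - Suc N"]) auto
      also have "\<dots> \<le> T N" unfolding T_def
        using sm by (intro sum_le_suminf) (auto simp: summable_iff_shift[of "\<lambda>n. norm (a (Suc n))"] add.commute)
      finally show ?thesis .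
    qed
    ultimately show ?thesis by (intro LIMSEQ_le_const2) auto
  qed
  have "T \<longlonglongrightarrow> 0" unfolding T_def by (rule suminf_exist_split2[OF sm])
  hence "(\<lambda>N. P N * A - 1) \<longlonglongrightarrow> 0"
    by (rule Lim_null_comparison[rotated]) (use bound in \<open>auto simp: eventually_sequentially\<close>)
  thus ?thesis unfolding P_def A_def by (simp add: LIM_zero_iff)
qed

text \<open>In the logarithm, the terms of index \<open>n\<close> combine to
  \<open>- r^n / n * (3 + 4 Re u + Re u^2)\<close> with \<open>u = z^n\<close>, and for
  \<open>|u| = 1\<close> the bracket is \<open>2 * (1 + Re u)^2\<close>.\<close>

lemma norm_341_le_1:
  fixes r :: real and z :: complex
  assumes r: "0 \<le> r" "r < 1" and z: "norm z = 1 \<or> z = 0"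
  shows "norm ((1 - complex_of_real r) ^ 3 * (1 - r * z) ^ 4 * (1 - r * z\<^sup>2)) \<le> 1"
proof -
  have ln_series: "(\<lambda>n. - Re (w ^ n) / real n) sums ln (norm (1 - w))" if "norm w < 1" for w :: complex
  proof -
    have "(\<lambda>n. - ((- (-w)) ^ n) / of_nat n) sums Ln (1 + (- w))" by (rule Ln_series') (use that in simp)
    from sums_Re[OF this] have "(\<lambda>n. Re (- (w ^ n) / of_nat n)) sums Re (Ln (1 - w))" by simp
    moreover have "1 - w \<noteq> 0" using that by auto
    ultimately show ?thesis by (simp add: Re_divide_of_nat)
  qed
  have z1: "norm z \<le> 1" using z by auto
  have lt: "norm (complex_of_real r) < 1" "norm (r * z) < 1" "norm (r * z\<^sup>2) < 1"
    using r z by (auto simp: norm_mult norm_power)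
  have "(\<lambda>n. 3 * (- Re (of_real r ^ n) / real n) + 4 * (- Re ((r * z) ^ n) / real n) + (- Re ((r * z\<^sup>2) ^ n) / real n))
    sums (3 * ln (norm (1 - complex_of_real r)) + 4 * ln (norm (1 - r * z)) + ln (norm (1 - r * z\<^sup>2)))"
    by (intro sums_add sums_mult ln_series lt)
  moreover have "3 * (- Re (of_real r ^ n) / real n) + 4 * (- Re ((r * z) ^ n) / real n) + (- Re ((r * z\<^sup>2) ^ n) / real n) \<le> 0" for n
  proof -
    define u where "u = z ^ n"
    have "3 + 4 * Re u + Re (u\<^sup>2) \<ge> 0"
    \<comment> \<open>For \<open>z = 0\<close> and \<open>n > 0\<close> the bracket is 3; the index
      0 gives \<open>u = 1\<close> even then.\<close>
    proof (cases "z = 0 \<and> n > 0")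
      case False
      hence "norm u = 1" using z by (auto simp: u_def norm_power)
      hence "(Re u)\<^sup>2 + (Im u)\<^sup>2 = 1" by (simp add: cmod_power2[symmetric])
      hence "3 + 4 * Re u + Re (u\<^sup>2) = 2 * (1 + Re u)\<^sup>2" by (simp add: power2_eq_square algebra_simps)
      thus ?thesis by simp
    qed (simp add: u_def)
    moreover have "(r * z) ^ n = of_real (r ^ n) * u" "(r * z\<^sup>2) ^ n = of_real (r ^ n) * u\<^sup>2"
      by (simp_all add: u_def power_mult_distrib mult.commute flip: power_mult)
    hence Re: "Re ((r * z) ^ n) = r ^ n * Re u" "Re ((r * z\<^sup>2) ^ n) = r ^ n * Re (u\<^sup>2)" "Re (of_real r ^ n) = r ^ n"
      by (simp_all only: Re_complex_of_real times_complex.sel Im_complex_of_real flip: of_real_power)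
    ultimately have "- (r ^ n * (3 + 4 * Re u + Re (u\<^sup>2))) / real n \<le> 0" using r by simp
    also have "- (r ^ n * (3 + 4 * Re u + Re (u\<^sup>2))) / real n = 
       3 * (- Re (of_real r ^ n) / real n) + 4 * (- Re ((r * z) ^ n) / real n) + (- Re ((r * z\<^sup>2) ^ n) / real n)"
      unfolding Re by (simp add: diff_divide_distrib ring_distribs mult_ac)
    finally show ?thesis .
  qed
  ultimately have le: "3 * ln (norm (1 - complex_of_real r)) + 4 * ln (norm (1 - r * z)) + ln (norm (1 - r * z\<^sup>2)) \<le> 0"
    by (metis (no_types, lifting) sums_le sums_zero)
  have nz: "1 - complex_of_real r \<noteq> 0" "1 - r * z \<noteq> 0" "1 - r * z\<^sup>2 \<noteq> 0" using lt by auto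
  have "ln (norm ((1 - complex_of_real r) ^ 3 * (1 - r * z) ^ 4 * (1 - r * z\<^sup>2))) = 
     3 * ln (norm (1 - complex_of_real r)) + 4 * ln (norm (1 - r * z)) + ln (norm (1 - r * z\<^sup>2))"
    using nz by (simp add: norm_mult norm_power ln_mult ln_realpow)
  hence "ln (norm ((1 - complex_of_real r) ^ 3 * (1 - r * z) ^ 4 * (1 - r * z\<^sup>2))) \<le> 0" using le by simp
  thus ?thesis using nz by (subst (asm) ln_le_zero_iff) auto
qed

section \<open>Non-vanishing at 1 for complex characters\<close>

lemma powr_minus_diff_MVT:
  "\<exists>z>real (Suc n). z < real (Suc (Suc n)) \<and> real (Suc n) powr -s - real (Suc (Suc n)) powr -s = s * z powr (-s - 1)"
proof -
  have "\<exists>z>real (Suc n). z < real (Suc (Suc n)) \<and> real (Suc (Suc n)) powr -s - real (Suc n) powr -s =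
      (real (Suc (Suc n)) - real (Suc n)) * (- s * z powr (-s - 1))"
    by (rule MVT2) (auto intro!: derivative_eq_intros)
  thus ?thesis by (auto simp: algebra_simps)
qed

lemma powr_minus_diff_le:
  assumes "s > 0"
  shows "0 \<le> real (Suc n) powr -s - real (Suc (Suc n)) powr -s"
    "real (Suc n) powr -s - real (Suc (Suc n)) powr -s \<le> s * real (Suc n) powr (-s - 1)"
proof -
  show "0 \<le> real (Suc n) powr -s - real (Suc (Suc n)) powr -s"
    using assms by (simp add: powr_mono2')
  obtain z where z: "z > real (Suc n)" "real (Suc n) powr -s - real (Suc (Suc n)) powr -s = s * z powr (-s - 1)"
    using powr_minus_diff_MVT by blast
  have "z powr (-s - 1) \<le> real (Suc n) powr (-s - 1)" using z(1) assms by (intro powr_mono2') auto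
  thus "real (Suc n) powr -s - real (Suc (Suc n)) powr -s \<le> s * real (Suc n) powr (-s - 1)"
    using z(2) assms by (simp add: mult_left_mono)
qed

lemma tendsto_powr_minus_Suc: "s > 0 \<Longrightarrow> (\<lambda>n. real (Suc n) powr -s) \<longlonglongrightarrow> 0"
  using filterlim_compose[OF tendsto_neg_powr[OF _ filterlim_real_sequentially] filterlim_Suc] by fastforce

lemma sums_powr_minus_diff:
  assumes "s > 0"
  shows "(\<lambda>n. real (Suc n) powr -s - real (Suc (Suc n)) powr -s) sums 1"
  using telescope_sums'[OF tendsto_powr_minus_Suc[OF assms]] by simp

lemma summable_powr_Suc: "s > 1 \<Longrightarrow> summable (\<lambda>n. real (Suc n) powr -s)"
  using summable_real_powr_iff[of "-s"] summable_Suc_iff[of "\<lambda>n. real n powr -s"] by simp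

text \<open>The integral comparison in telescoping form: by the mean value theorem each term after
  the first is at most a difference of \<open>n^-(s-1) / (s-1)\<close>.\<close>

lemma zeta_le:
  assumes "s > 1"
  shows "(\<Sum>n. real (Suc n) powr -s) \<le> 1 + 1 / (s - 1)"
proof -
  have "(\<Sum>n. real (Suc n) powr -s) = 1 + (\<Sum>n. real (Suc (Suc n)) powr -s)"
    using suminf_split_head[OF summable_powr_Suc[OF assms]] by simp
  also have "(\<Sum>n. real (Suc (Suc n)) powr -s) \<le> (\<Sum>n. (real (Suc n) powr -(s - 1) - real (Suc (Suc n)) powr -(s - 1)) / (s - 1))"
  proof (rule suminf_le)
    show "summable (\<lambda>n. real (Suc (Suc n)) powr -s)"
      using summable_powr_Suc[OF assms] summable_Suc_iff[of "\<lambda>n. real (Suc n) powr -s"] by simp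
    show "summable (\<lambda>n. (real (Suc n) powr -(s - 1) - real (Suc (Suc n)) powr -(s - 1)) / (s - 1))"
      using sums_powr_minus_diff[of "s - 1"] assms by (intro summable_divide sums_summable) auto
    fix n
    obtain z where z: "z > real (Suc n)" "z < real (Suc (Suc n))"
      "real (Suc n) powr -(s - 1) - real (Suc (Suc n)) powr -(s - 1) = (s - 1) * z powr (- s)"
      using powr_minus_diff_MVT[of n "s - 1"] by auto
    have "real (Suc (Suc n)) powr -s \<le> z powr -s" using z assms by (intro powr_mono2') auto
    thus "real (Suc (Suc n)) powr -s \<le> (real (Suc n) powr -(s - 1) - real (Suc (Suc n)) powr -(s - 1)) / (s - 1)"
      using z(3) assms by simp
  qed
  also have "\<dots> = 1 / (s - 1)"
    using sums_divide[OF sums_powr_minus_diff[of "s - 1"], of "s - 1"] assms by (simp add: sums_iff)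
  finally show ?thesis by simp
qed

locale nonprincipal_dchar = dchar +
  assumes nontrivial: "\<exists>a. coprime a (int q) \<and> chi a \<noteq> 1"
begin

lemma nonprincipal_dchar_cnj: "nonprincipal_dchar q (\<lambda>n. cnj (chi n))"
  by unfold_locales (use q_pos chi_add_q chi_eq_0_iff chi_mult nontrivial in 
      \<open>auto simp: dirichlet_character_def complex_eq_iff\<close>)

lemma sum_chi_Suc_eq_0: "(\<Sum>n<q. chi (int (Suc n))) = 0"
proof -
  have "chi (int q) = chi 0" using chi_add_q[of 0] by simp
  moreover have "(\<Sum>n<q. chi (int (Suc n))) + chi 0 = (\<Sum>n<q. chi (int n)) + chi (int q)"
    using sum.lessThan_Suc_shift[of "\<lambda>n. chi (int n)" q] by simp
  ultimately show ?thesis using sum_chi_eq_0[OF nontrivial] by simp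
qed

lemma norm_sum_chi_le: "norm (\<Sum>k<n. chi (int (Suc k))) \<le> real q"
proof (rule sum_periodic_bound[OF q_pos, where K = 1, simplified])
  fix n show "chi (int (Suc (n + q))) = chi (int (Suc n))" using chi_add_q[of "int (Suc n)"] by (simp add: add_ac)
qed (use sum_chi_Suc_eq_0 norm_chi_le in simp_all)

definition L :: "real \<Rightarrow> complex" where
  "L s = (\<Sum>n. (real (Suc n) powr -s) *\<^sub>R chi (int (Suc n)))"

lemma L_weights:
  assumes "s > 0"
  shows "real (Suc (Suc n)) powr -s \<le> real (Suc n) powr -s" "(\<lambda>n. real (Suc n) powr -s) \<longlonglongrightarrow> 0"
  using powr_minus_diff_le(1)[OF assms, of n] tendsto_powr_minus_Suc[OF assms] by auto

lemma summable_L: "s > 0 \<Longrightarrow> summable (\<lambda>n. (real (Suc n) powr -s) *\<^sub>R chi (int (Suc n)))"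
  by (rule summable_decreasing_weights[of "\<lambda>n. chi (int (Suc n))", OF norm_sum_chi_le L_weights])

lemma norm_L_le: "s > 0 \<Longrightarrow> norm (L s) \<le> real q"
  unfolding L_def
  using suminf_decreasing_weights_bound[of "\<lambda>n. chi (int (Suc n))" "real q" "\<lambda>n. real (Suc n) powr -s", OF norm_sum_chi_le L_weights]
  by simp

text \<open>Sum the series at 1 by parts against \<open>n^-(s-1)\<close>. Its partial sums are
  \<open>O(1/n)\<close> and the weight differences are \<open>O((s-1)/n)\<close>, so the result
  converges absolutely and is \<open>O(s-1)\<close>.\<close>

lemma L_near_1:
  assumes L1: "L 1 = 0" and s: "s > 1"
  shows "norm (L s) \<le> 2 * real q * (s - 1)"
proof -
  define d where "d = s - 1"
  have d: "d > 0" using s by (simp add: d_def)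
  define a where "a n = inverse (real (Suc n)) *\<^sub>R chi (int (Suc n))" for n
  have a_eq: "a n = (real (Suc n) powr - 1) *\<^sub>R chi (int (Suc n))" for n by (simp add: a_def powr_minus)
  have sa: "a sums 0" using summable_L[of 1] L1 unfolding a_eq L_def sums_iff by simp
  \<comment> \<open>As \<open>a\<close> sums to 0, its partial sums are the negatives of its
    tails.\<close>
  have R: "norm (\<Sum>k<n. a k) \<le> 2 * real q * (real (Suc n) powr - 1)" for n
  proof -
    have "(\<lambda>N. norm (\<Sum>k=n..<N. a k)) \<longlonglongrightarrow> norm (0 - (\<Sum>k<n. a k))"
    proof (rule Lim_transform_eventually)
      show "(\<lambda>N. norm ((\<Sum>k<N. a k) - (\<Sum>k<n. a k))) \<longlonglongrightarrow> norm (0 - (\<Sum>k<n. a k))"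
        using sa unfolding sums_def by (intro tendsto_intros)
      show "\<forall>\<^sub>F N in sequentially. norm ((\<Sum>k<N. a k) - (\<Sum>k<n. a k)) = norm (\<Sum>k=n..<N. a k)"
        using eventually_ge_at_top[of n] 
        by eventually_elim (simp add: sum_diff_nat_ivl atLeast0LessThan[symmetric])
    qed
    moreover have "norm (\<Sum>k=n..<N. a k) \<le> 2 * real q * (real (Suc n) powr - 1)" for N
      unfolding a_eq
      by (rule sum_decreasing_weights_tail_bound[of "\<lambda>n. chi (int (Suc n))" "real q" "\<lambda>n. real (Suc n) powr - 1", OF norm_sum_chi_le L_weights(1)]) auto
    ultimately have "norm (0 - (\<Sum>k<n. a k)) \<le> 2 * real q * (real (Suc n) powr - 1)"
      by (intro LIMSEQ_le_const2) auto
    thus ?thesis by simp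
  qed
  define v where "v n = real (Suc n) powr -d" for n
  have v0: "v \<longlonglongrightarrow> 0" unfolding v_def by (rule tendsto_powr_minus_Suc[OF d])
  have Lv: "(\<lambda>n. v n *\<^sub>R a n) = (\<lambda>n. (real (Suc n) powr -s) *\<^sub>R chi (int (Suc n)))"
  proof
    fix n
    have "real (Suc n) powr -d * real (Suc n) powr - 1 = real (Suc n) powr -s"
      unfolding powr_add[symmetric] by (simp add: d_def)
    thus "v n *\<^sub>R a n = (real (Suc n) powr -s) *\<^sub>R chi (int (Suc n))"
      by (simp only: v_def a_eq scaleR_scaleR)
  qed
  have "(\<lambda>n. (v n - v (Suc n)) *\<^sub>R (\<Sum>k<Suc n. a k)) sums (\<Sum>n. v n *\<^sub>R a n)"
  proof (rule suminf_by_parts)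
    show "(\<lambda>N. v N *\<^sub>R (\<Sum>k<N. a k)) \<longlonglongrightarrow> 0"
      using tendsto_scaleR[OF v0 sa[unfolded sums_def]] by simp
    show "summable (\<lambda>n. v n *\<^sub>R a n)" unfolding Lv using summable_L[of s] s by simp
  qed
  hence sumsL: "(\<lambda>n. (v n - v (Suc n)) *\<^sub>R (\<Sum>k<Suc n. a k)) sums L s" unfolding Lv L_def .
  have T: "(\<lambda>n. 2 * real q * d * (real (Suc n) powr -1 - real (Suc (Suc n)) powr -1)) sums (2 * real q * d * 1)"
    by (intro sums_mult sums_powr_minus_diff) simp
  have le: "norm ((v n - v (Suc n)) *\<^sub>R (\<Sum>k<Suc n. a k)) \<le> 2 * real q * d * (real (Suc n) powr -1 - real (Suc (Suc n)) powr -1)" for n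
  proof -
    have "norm ((v n - v (Suc n)) *\<^sub>R (\<Sum>k<Suc n. a k)) = (v n - v (Suc n)) * norm (\<Sum>k<Suc n. a k)"
      unfolding v_def norm_scaleR using powr_minus_diff_le(1)[OF d, of n] by (simp del: sum.lessThan_Suc)
    also have "\<dots> \<le> (d * real (Suc n) powr -1) * (2 * real q * (real (Suc (Suc n)) powr - 1))"
    proof (rule mult_mono[OF _ R])
      have "v n - v (Suc n) \<le> d * real (Suc n) powr (-d - 1)" unfolding v_def by (rule powr_minus_diff_le(2)[OF d])
      also have "\<dots> \<le> d * real (Suc n) powr -1" using d by (intro mult_left_mono powr_mono) auto
      finally show "v n - v (Suc n) \<le> d * real (Suc n) powr -1" .
    qed (use d in auto)
    also have "\<dots> = 2 * real q * d * (real (Suc n) powr -1 * real (Suc (Suc n)) powr - 1)" by simp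
    \<comment> \<open>The majorant is \<open>1 / ((n+1) * (n+2))\<close>, which telescopes with
      total 1.\<close>
    also have "real (Suc n) powr -1 * real (Suc (Suc n)) powr - 1 = real (Suc n) powr -1 - real (Suc (Suc n)) powr -1"
      by (simp add: powr_minus field_simps)
    finally show ?thesis .
  qed
  have "norm (L s) \<le> 2 * real q * d * 1"
    using norm_suminf_le[of "\<lambda>n. (v n - v (Suc n)) *\<^sub>R (\<Sum>k<Suc n. a k)", OF le sums_summable[OF T]] sumsL T
    by (simp add: sums_iff)
  thus ?thesis by (simp add: d_def)
qed

text \<open>The finite products \<open>P\<close> have 3-4-1 norm at most 1, factor by factor, while
  each \<open>P * A\<close> tends to 1; so the 3-4-1 product of the series has norm at least
  1.\<close>

lemma product_341_ge_1:
  assumes s: "s > 1"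
  defines "L2 \<equiv> (\<Sum>n. (real (Suc n) powr -s) *\<^sub>R (chi (int (Suc n)))\<^sup>2)"
  shows "1 \<le> (\<Sum>n. real (Suc n) powr -s) ^ 3 * norm (L s) ^ 4 * norm L2"
proof -
  define a where "a \<psi> n = complex_of_real (real n powr -s) * \<psi> (int n)" for \<psi> :: "int \<Rightarrow> complex" and n
  define P where "P \<psi> N = (\<Prod>p | prime p \<and> p \<le> N. 1 - a \<psi> p)" for \<psi> and N :: nat
  define A where "A \<psi> = (\<Sum>n. a \<psi> (Suc n))" for \<psi>
  have lim: "(\<lambda>N. P \<psi> N * A \<psi>) \<longlonglongrightarrow> 1" if "\<psi> 1 = 1" "\<And>m n. \<psi> (m * n) = \<psi> m * \<psi> n" "\<And>n. norm (\<psi> n) \<le> 1" for \<psi>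
    unfolding P_def A_def
  proof (rule tendsto_euler_product)
    show "completely_multiplicative (a \<psi>)"
      using that(1,2) by (auto simp: completely_multiplicative_def a_def powr_mult)
    show "summable (\<lambda>n. norm (a \<psi> (Suc n)))"
    proof (rule summable_comparison_test')
      show "summable (\<lambda>n. real (Suc n) powr -s)" by (rule summable_powr_Suc[OF s])
      fix n :: nat assume "n \<ge> 0"
      show "norm (norm (a \<psi> (Suc n))) \<le> real (Suc n) powr -s"
        using that(3)[of "int (Suc n)"] by (simp add: a_def norm_mult mult_left_le)
    qed
  qed
  let ?o = "\<lambda>_. 1 :: complex" and ?c2 = "\<lambda>n. (chi n)\<^sup>2"
  have "(\<lambda>N. norm ((P ?o N * A ?o) ^ 3 * (P chi N * A chi) ^ 4 * (P ?c2 N * A ?c2))) \<longlonglongrightarrow> norm (1 ^ 3 * 1 ^ 4 * 1 :: complex)"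
    using norm_chi_le by (intro tendsto_intros lim) (auto simp: chi_mult power_mult_distrib norm_power power_le_one)
  moreover have "norm ((P ?o N * A ?o) ^ 3 * (P chi N * A chi) ^ 4 * (P ?c2 N * A ?c2)) \<le> 
      norm (A ?o) ^ 3 * norm (A chi) ^ 4 * norm (A ?c2)" for N
  proof -
    have "norm (P ?o N ^ 3 * P chi N ^ 4 * P ?c2 N) = 
      (\<Prod>p | prime p \<and> p \<le> N. norm ((1 - a ?o p) ^ 3 * (1 - a chi p) ^ 4 * (1 - a ?c2 p)))"
      by (simp add: P_def prod.distrib prod_power_distrib norm_mult norm_power prod_norm[symmetric])
    also have "\<dots> \<le> 1"
    proof (rule prod_le_1, intro conjI norm_ge_zero)
      fix p assume p: "p \<in> {p. prime p \<and> p \<le> N}"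
      hence "p > 1" by (auto dest: prime_gt_1_nat)
      hence "real p powr -s < 1" using s by (simp add: powr_less_one)
      moreover have "norm (chi (int p)) = 1 \<or> chi (int p) = 0" using norm_chi chi_eq_0_iff by blast
      ultimately show "norm ((1 - a ?o p) ^ 3 * (1 - a chi p) ^ 4 * (1 - a ?c2 p)) \<le> 1"
        using norm_341_le_1[of "real p powr -s" "chi (int p)"] by (simp add: a_def)
    qed
    finally have "norm (P ?o N ^ 3 * P chi N ^ 4 * P ?c2 N) * norm (A ?o ^ 3 * A chi ^ 4 * A ?c2) \<le> 
       1 * norm (A ?o ^ 3 * A chi ^ 4 * A ?c2)"
      by (rule mult_right_mono) simp
    thus ?thesis by (simp add: norm_mult norm_power power_mult_distrib mult_ac)
  qed
  ultimately have "norm (1 ^ 3 * 1 ^ 4 * 1 :: complex) \<le> norm (A ?o) ^ 3 * norm (A chi) ^ 4 * norm (A ?c2)"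
    by (intro LIMSEQ_le_const2) auto
  moreover have "A ?o = of_real (\<Sum>n. real (Suc n) powr -s)"
    using suminf_of_real[OF summable_powr_Suc[OF s], where 'a = complex] by (simp add: A_def a_def)
  moreover have "(\<Sum>n. real (Suc n) powr -s) \<ge> 0" by (intro suminf_nonneg summable_powr_Suc s) auto
  moreover have "A chi = L s" "A ?c2 = L2" by (simp_all add: A_def a_def L_def L2_def scaleR_conv_of_real)
  ultimately show ?thesis by simp
qed

text \<open>
  A zero at 1 would contribute a factor \<open>(s - 1)\<^sup>4\<close>, which beats the triple pole of \<open>\<zeta>\<^sup>3\<close>, while
  \<open>L(s,\<chi>\<^sup>2)\<close> stays bounded because \<open>\<chi>\<^sup>2\<close> is still nonprincipal.
\<close>
lemma L_1_nonzero_complex: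
  assumes "\<exists>a. coprime a (int q) \<and> (chi a)\<^sup>2 \<noteq> 1"
  shows "L 1 \<noteq> 0"
proof
  assume L1: "L 1 = 0"
  interpret c2: nonprincipal_dchar q "\<lambda>n. (chi n)\<^sup>2"
    by unfold_locales (use assms q_pos chi_add_q chi_eq_0_iff in \<open>auto simp: dirichlet_character_def chi_mult power_mult_distrib\<close>)
  define C where "C = (2 * real q) ^ 4 * real q"
  have "1 \<le> (1 + 1 / (s - 1)) ^ 3 * (2 * real q * (s - 1)) ^ 4 * real q" if s: "s > 1" for s
  proof -
    have "1 \<le> (\<Sum>n. real (Suc n) powr -s) ^ 3 * norm (L s) ^ 4 * norm (c2.L s)"
      using product_341_ge_1[OF s] by (simp add: c2.L_def)
    also have "(\<Sum>n. real (Suc n) powr -s) \<ge> 0" by (intro suminf_nonneg summable_powr_Suc s) auto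
    hence "(\<Sum>n. real (Suc n) powr -s) ^ 3 * norm (L s) ^ 4 * norm (c2.L s) 
        \<le> (1 + 1 / (s - 1)) ^ 3 * (2 * real q * (s - 1)) ^ 4 * real q"
      using s zeta_le[OF s] L_near_1[OF L1 s] c2.norm_L_le[of s]
      by (intro mult_mono power_mono) (simp_all del: of_nat_Suc)
    finally show ?thesis .
  qed
  moreover have "(1 + 1 / (s - 1)) ^ 3 * (2 * real q * (s - 1)) ^ 4 * real q = C * (s - 1) * s ^ 3" if "s > 1" for s
  proof -
    have "(1 + 1 / (s - 1)) ^ 3 * (2 * real q * (s - 1)) ^ 4 * real q = C * (s - 1) * ((1 + 1 / (s - 1)) * (s - 1)) ^ 3"
      by (simp add: C_def power_mult_distrib eval_nat_numeral)
    also have "(1 + 1 / (s - 1)) * (s - 1) = s" using that by (simp add: field_simps)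
    finally show ?thesis .
  qed
  ultimately have ge: "1 \<le> C * (s - 1) * s ^ 3" if "s > 1" for s using that by simp
  have "((\<lambda>s. C * (s - 1) * s ^ 3) \<longlongrightarrow> C * (1 - 1) * 1 ^ 3) (at_right 1)" by (intro tendsto_intros)
  hence "\<forall>\<^sub>F s in at_right 1. C * (s - 1) * s ^ 3 < 1" by (intro order_tendstoD) auto
  moreover have "\<forall>\<^sub>F s in at_right (1::real). s > 1" by (simp add: eventually_at_right_less)
  ultimately have "\<forall>\<^sub>F s in at_right (1::real). False" by eventually_elim (use ge in force)
  thus False by (simp add: trivial_limit_at_right_real)
qed

end

section \<open>Non-vanishing at 1 for real characters\<close>

lemma sum_divisors_prime_power_mult:
  fixes r :: "nat \<Rightarrow> 'a::comm_semiring_1"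
  assumes r: "r 1 = 1" "\<And>m n. r (m * n) = r m * r n" and p: "prime p" and m: "\<not> p dvd m" "m > 0"
  shows "(\<Sum>d | d dvd p ^ k * m. r d) = (\<Sum>i\<le>k. r p ^ i) * (\<Sum>d | d dvd m. r d)"
proof -
  have rp: "r (p ^ i) = r p ^ i" for i by (induction i) (use r in auto)
  have p0: "p > 0" using p by (simp add: prime_gt_0_nat)
  have "(\<Sum>i\<le>k. r p ^ i) * (\<Sum>d | d dvd m. r d) = (\<Sum>(i,d)\<in>{..k} \<times> {d. d dvd m}. r (p ^ i * d))"
    by (simp add: sum_product sum.cartesian_product r rp)
  also have "\<dots> = (\<Sum>d | d dvd p ^ k * m. r d)"
  proof (rule sum.reindex_bij_witness[of _ "\<lambda>d. (multiplicity p d, d div p ^ multiplicity p d)" "\<lambda>(i,d). p ^ i * d"])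
    fix x assume x: "x \<in> {..k} \<times> {d. d dvd m}"
    obtain i d where xid: "x = (i, d)" "i \<le> k" "d dvd m" using x by auto
    hence d: "\<not> p dvd d" "d > 0" using m by (auto intro: dvd_trans dvd_pos_nat)
    hence "multiplicity p (p ^ i * d) = i" using p by (intro multiplicity_eqI) (auto simp: mult.commute[of _ p] p0)
    thus "(multiplicity p (case x of (i, d) \<Rightarrow> p ^ i * d), (case x of (i, d) \<Rightarrow> p ^ i * d) div p ^ multiplicity p (case x of (i, d) \<Rightarrow> p ^ i * d)) = x"
      using p0 by (simp add: xid)
    show "(case x of (i, d) \<Rightarrow> p ^ i * d) \<in> {d. d dvd p ^ k * m}"
      using xid by (auto intro!: mult_dvd_mono le_imp_power_dvd)
  next
    fix d assume "d \<in> {d. d dvd p ^ k * m}"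
    hence d: "d dvd p ^ k * m" by simp
    hence "d \<noteq> 0" using m p0 dvd_0_left[of "p ^ k * m"] by (intro notI) simp
    define i where "i = multiplicity p d"
    obtain e where e: "d = p ^ i * e" "\<not> p dvd e"
      unfolding i_def using multiplicity_decompose'[of d p] \<open>d \<noteq> 0\<close> p by (metis not_prime_unit)
    have "coprime p e" using e p by (simp add: prime_imp_coprime)
    hence "coprime (p ^ k) e" by simp
    moreover have "e dvd p ^ k * m" using e(1) d by (meson dvd_mult_right)
    ultimately have "e dvd m" using coprime_dvd_mult_right_iff coprime_commute by blast
    moreover have "i \<le> k"
    proof -
      have "coprime (p ^ i) m" using p m by (simp add: prime_imp_coprime)
      moreover have "p ^ i dvd p ^ k * m" using e(1) d by (meson dvd_mult_left)
      ultimately have "p ^ i dvd p ^ k" using coprime_dvd_mult_left_iff by blast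
      thus ?thesis using p prime_gt_1_nat power_dvd_imp_le by blast
    qed
    moreover have "d div p ^ i = e" using e p0 by simp
    ultimately show "(multiplicity p d, d div p ^ multiplicity p d) \<in> {..k} \<times> {d. d dvd m}"
      by (simp add: i_def)
    show "(case (multiplicity p d, d div p ^ multiplicity p d) of (i, d) \<Rightarrow> p ^ i * d) = d"
      using e(1) p0 by (simp add: i_def multiplicity_dvd)
  qed auto
  finally show ?thesis by simp
qed

lemma sum_powers_sign:
  fixes x :: real
  assumes "x \<in> {-1, 0, 1}"
  shows "(\<Sum>i\<le>k. x ^ i) \<ge> (if even k then 1 else 0)"
  using assms
proof (elim insertE)
  assume "x = -1"
  have "(\<Sum>i\<le>k. (-1::real) ^ i) = (if even k then 1 else 0)" by (induction k) auto
  thus ?thesis using \<open>x = -1\<close> by simp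
next
  assume "x = 0"
  thus ?thesis by (simp add: power_0_left)
qed auto

lemma prime_power_decomp:
  fixes n :: nat
  assumes "n > 0" "n \<noteq> 1"
  obtains p k m where "prime p" "n = p ^ k * m" "\<not> p dvd m" "0 < m" "m < n"
proof -
  obtain p where p: "prime p" "p dvd n" using prime_factor_nat assms by blast
  obtain m where m: "n = p ^ multiplicity p n * m" "\<not> p dvd m"
    using multiplicity_decompose'[of n p] assms p by (metis not_gr0 not_prime_unit)
  have "multiplicity p n > 0" using p m by (metis mult_1 not_gr0 power_0)
  hence "1 < p ^ multiplicity p n" using prime_gt_1_nat[OF p(1)] by (intro one_less_power) auto
  moreover have "m > 0" using m assms by (metis gr0I mult_0_right)
  ultimately have "m < n" using m(1) by (metis mult_less_mono1 nat_mult_1)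
  thus ?thesis using that p m \<open>m > 0\<close> by blast
qed

lemma sum_divisors_sign:
  fixes r :: "nat \<Rightarrow> real"
  assumes r: "r 1 = 1" "\<And>m n. r (m * n) = r m * r n" "\<And>n. r n \<in> {-1, 0, 1}" and n: "n > 0"
  shows "(\<Sum>d | d dvd n. r d) \<ge> 0"
  using n
proof (induction n rule: less_induct)
  case (less n)
  show ?case
  proof (cases "n = 1")
    case False
    then obtain p k m where m: "prime p" "n = p ^ k * m" "\<not> p dvd m" "0 < m" "m < n"
      using less.prems prime_power_decomp by blast
    have "(\<Sum>i\<le>k. r p ^ i) \<ge> 0" using sum_powers_sign[OF r(3), of k p] by (auto split: if_splits)
    thus ?thesis unfolding m(2) sum_divisors_prime_power_mult[OF r(1,2) m(1,3,4)]
      using less.IH[OF m(5,4)] by simp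
  qed (use r in simp)
qed

text \<open>All exponents in a square are even, and then each local sum of powers of -1, 0 or 1 is
  at least 1.\<close>

lemma sum_divisors_square:
  fixes r :: "nat \<Rightarrow> real"
  assumes r: "r 1 = 1" "\<And>m n. r (m * n) = r m * r n" "\<And>n. r n \<in> {-1, 0, 1}" and n: "n > 0"
  shows "(\<Sum>d | d dvd n\<^sup>2. r d) \<ge> 1"
  using n
proof (induction n rule: less_induct)
  case (less n)
  show ?case
  proof (cases "n = 1")
    case False
    then obtain p k m where m: "prime p" "n = p ^ k * m" "\<not> p dvd m" "0 < m" "m < n"
      using less.prems prime_power_decomp by blast
    have sq: "n\<^sup>2 = p ^ (2 * k) * m\<^sup>2" by (simp add: m(2) power_mult_distrib power_mult mult.commute)
    have "\<not> p dvd m\<^sup>2" using m prime_dvd_power by blast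
    moreover have "(\<Sum>i\<le>2*k. r p ^ i) \<ge> 1" using sum_powers_sign[OF r(3), of "2*k" p] by simp
    moreover have "(\<Sum>d | d dvd m\<^sup>2. r d) \<ge> 1" using less.IH[OF m(5,4)] .
    ultimately show ?thesis unfolding sq using m
      by (subst sum_divisors_prime_power_mult[OF r(1,2)]) 
         (auto intro: order.trans[OF _ mult_mono[of 1 _ 1]])
  qed (use r in simp)
qed

section \<open>Lambert series\<close>

lemma lambert_partial_sum:
  fixes r :: "nat \<Rightarrow> real"
  shows "(\<Sum>m=1..M. (\<Sum>d | d dvd m. r d) * x ^ m) = (\<Sum>n=1..M. r n * (\<Sum>k=1..M div n. x ^ (n * k)))"
proof -
  have aux: "b \<le> M" if "0 < k" "b * k \<le> M" for b k :: nat
  proof -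
    have "b \<le> b * k" using that(1) by simp
    thus ?thesis using that(2) by (rule order.trans)
  qed
  have "(\<Sum>m=1..M. (\<Sum>d | d dvd m. r d) * x ^ m) = (\<Sum>(m,d)\<in>(SIGMA m:{1..M}. {d. d dvd m}). r d * x ^ m)"
    unfolding sum_distrib_right by (subst sum.Sigma) auto
  also have "\<dots> = (\<Sum>(n,k)\<in>(SIGMA n:{1..M}. {1..M div n}). r n * x ^ (n * k))"
    by (rule sum.reindex_bij_witness[of _ "\<lambda>(n,k). (n * k, n)" "\<lambda>(m,d). (d, m div d)"])
       (auto simp: less_eq_div_iff_mult_less_eq mult.commute Suc_le_eq elim!: dvdE intro: aux)
  also have "\<dots> = (\<Sum>n=1..M. r n * (\<Sum>k=1..M div n. x ^ (n * k)))"
    unfolding sum_distrib_left by (subst sum.Sigma) auto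
  finally show ?thesis .
qed

text \<open>Truncating the geometric expansion of \<open>x^n / (1 - x^n)\<close> at exponents up to
  \<open>M\<close> omits only larger exponents, which costs at most \<open>x^M / (1 - x)\<close> for
  each of the \<open>M\<close> values of \<open>n\<close>.\<close>

lemma tendsto_lambert:
  fixes r :: "nat \<Rightarrow> real"
  assumes r: "\<And>n. \<bar>r n\<bar> \<le> 1" and x: "0 < x" "x < 1"
  shows "(\<lambda>M. (\<Sum>n=1..M. r n * (x ^ n / (1 - x ^ n))) - (\<Sum>m=1..M. (\<Sum>d | d dvd m. r d) * x ^ m)) \<longlonglongrightarrow> 0"
proof (rule Lim_null_comparison)
  show "(\<lambda>M. real M * x ^ M / (1 - x)) \<longlonglongrightarrow> 0"
    using tendsto_divide[OF powser_times_n_limit_0[of x] tendsto_const[of "1 - x"]] x by simp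
  show "\<forall>\<^sub>F M in sequentially. norm ((\<Sum>n=1..M. r n * (x ^ n / (1 - x ^ n))) - (\<Sum>m=1..M. (\<Sum>d | d dvd m. r d) * x ^ m))
          \<le> real M * x ^ M / (1 - x)"
  proof (intro always_eventually allI)
    fix M :: nat
    have "\<bar>r n * (x ^ n / (1 - x ^ n)) - r n * (\<Sum>k=1..M div n. x ^ (n * k))\<bar> \<le> x ^ M / (1 - x)" if n: "n \<in> {1..M}" for n
    proof -
      define y where "y = x ^ n"
      have y: "0 < y" "y \<le> x" "y < 1" using x n power_decreasing[of 1 n x] by (auto simp: y_def)
      have "(\<Sum>k=1..M div n. x ^ (n * k)) = (\<Sum>k=1..M div n. y ^ k)" by (simp add: y_def power_mult)
      also have "\<dots> = y * (\<Sum>k<M div n. y ^ k)" by (simp add: sum_atLeast1_eq_lessThan[simplified] sum_distrib_left)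
      also have "\<dots> = y * ((1 - y ^ (M div n)) / (1 - y))" using y by (simp add: sum_gp_strict)
      finally have "x ^ n / (1 - x ^ n) - (\<Sum>k=1..M div n. x ^ (n * k)) = y ^ Suc (M div n) / (1 - y)"
        using y by (simp add: y_def[symmetric] field_simps)
      also have "\<dots> \<le> x ^ M / (1 - x)"
      proof (rule frac_le)
        have "M \<le> n * Suc (M div n)" using n dividend_less_times_div[of n M] by simp
        thus "y ^ Suc (M div n) \<le> x ^ M"
          unfolding y_def power_mult[symmetric] using x by (intro power_decreasing) auto
      qed (use x y in auto)
      finally have 1: "x ^ n / (1 - x ^ n) - (\<Sum>k=1..M div n. x ^ (n * k)) \<le> x ^ M / (1 - x)" .
      have 2: "0 \<le> x ^ n / (1 - x ^ n) - (\<Sum>k=1..M div n. x ^ (n * k))"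
        unfolding \<open>_ = y ^ Suc (M div n) / (1 - y)\<close> using y by simp
      have "\<bar>r n\<bar> * \<bar>x ^ n / (1 - x ^ n) - (\<Sum>k=1..M div n. x ^ (n * k))\<bar> \<le> 1 * (x ^ M / (1 - x))"
        using 1 2 by (intro mult_mono r) auto
      thus ?thesis by (simp add: abs_mult[symmetric] right_diff_distrib)
    qed
    hence "\<bar>\<Sum>n=1..M. r n * (x ^ n / (1 - x ^ n)) - r n * (\<Sum>k=1..M div n. x ^ (n * k))\<bar> \<le> (\<Sum>n=1..M. x ^ M / (1 - x))"
      by (rule order.trans[OF sum_abs sum_mono])
    thus "norm ((\<Sum>n=1..M. r n * (x ^ n / (1 - x ^ n))) - (\<Sum>m=1..M. (\<Sum>d | d dvd m. r d) * x ^ m))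
          \<le> real M * x ^ M / (1 - x)"
      unfolding lambert_partial_sum by (simp add: sum_subtractf)
  qed
qed

text \<open>Pair \<open>i\<close> with \<open>n - 1 - i\<close> and apply the inequality of
  arithmetic and geometric means.\<close>

lemma geometric_sum_ge:
  fixes t :: real
  assumes "0 \<le> t" 
  shows "real n * t ^ n \<le> t * (\<Sum>i<n. (t\<^sup>2) ^ i)"
proof -
  have "2 * (t * (\<Sum>i<n. (t\<^sup>2) ^ i)) = t * (\<Sum>i<n. (t\<^sup>2) ^ i) + t * (\<Sum>i<n. (t\<^sup>2) ^ (n - Suc i))"
    by (simp add: sum.nat_diff_reindex)
  also have "\<dots> = (\<Sum>i<n. t * ((t ^ i)\<^sup>2 + (t ^ (n - Suc i))\<^sup>2))"
    by (simp add: sum_distrib_left sum.distrib ring_distribs power_mult[symmetric] mult.commute)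
  also have "\<dots> \<ge> (\<Sum>i<n. 2 * t ^ n)"
  proof (rule sum_mono)
    fix i assume i: "i \<in> {..<n}"
    have "2 * (t ^ i * t ^ (n - Suc i)) \<le> (t ^ i)\<^sup>2 + (t ^ (n - Suc i))\<^sup>2"
      using sum_squares_bound[of "t ^ i" "t ^ (n - Suc i)"] by simp
    hence "t * (2 * (t ^ i * t ^ (n - Suc i))) \<le> t * ((t ^ i)\<^sup>2 + (t ^ (n - Suc i))\<^sup>2)"
      by (rule mult_left_mono) fact
    also have "t * (2 * (t ^ i * t ^ (n - Suc i))) = 2 * t ^ (Suc (i + (n - Suc i)))" by (simp add: power_add)
    finally show "2 * t ^ n \<le> t * ((t ^ i)\<^sup>2 + (t ^ (n - Suc i))\<^sup>2)" using i by (simp del: power_Suc)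
  qed
  finally show ?thesis by simp
qed

text \<open>With \<open>A\<close> and \<open>B\<close> the geometric sums of lengths
  \<open>m\<close> and \<open>m + 1\<close>, the claim reduces to
  \<open>m * (m + 1) * x^m <= A * B\<close>. For \<open>t = sqrt x\<close>, multiplying two
  instances of \<open>geometric_sum_ge\<close> gives
  \<open>m * (m + 1) * t^(2m+1) <= t^2 * A * B <= t * A * B\<close>.\<close>

lemma monsky_weights_decreasing:
  fixes x :: real
  assumes x: "0 < x" "x < 1"
  shows "1 / (real (Suc (Suc n)) * (1 - x)) - x ^ Suc (Suc n) / (1 - x ^ Suc (Suc n))
     \<le> 1 / (real (Suc n) * (1 - x)) - x ^ Suc n / (1 - x ^ Suc n)"
proof -
  define t where "t = sqrt x"
  have t: "0 < t" "t < 1" "x = t\<^sup>2" using x by (auto simp: t_def)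
  define m where "m = Suc n"
  define A where "A = (\<Sum>i<m. x ^ i)"
  define B where "B = (\<Sum>i<Suc m. x ^ i)"
  have gs: "(\<Sum>i<k. x ^ i) * (1 - x) = 1 - x ^ k" for k using x by (simp add: sum_gp_strict)
  have A: "1 - x ^ m = A * (1 - x)" and B: "1 - x ^ Suc m = B * (1 - x)" using gs by (simp_all only: A_def B_def)
  have "0 < A" "0 < B" using x unfolding A_def B_def m_def by (auto intro!: sum_pos simp: lessThan_empty_iff simp del: sum.lessThan_Suc)
  have "real m * t ^ m \<le> t * A" "real (Suc m) * t ^ Suc m \<le> t * B"
    unfolding A_def B_def t(3) by (rule geometric_sum_ge, use t in simp)+
  hence "(real m * t ^ m) * (real (Suc m) * t ^ Suc m) \<le> (t * A) * (t * B)"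
    by (rule mult_mono) (use t \<open>0 < A\<close> in \<open>simp_all del: of_nat_Suc power_Suc\<close>)
  have "real m * real (Suc m) * x ^ m \<le> A * B"
  proof -
    have "t * (real m * real (Suc m) * x ^ m) = (real m * t ^ m) * (real (Suc m) * t ^ Suc m)"
      by (simp add: t(3) power_mult[symmetric] mult_2 power_add)
    also have "\<dots> \<le> (t * A) * (t * B)" by fact
    also have "\<dots> \<le> t * (A * B)" using t \<open>0 < A\<close> \<open>0 < B\<close> by (simp add: mult_left_le)
    finally show ?thesis using t by simp
  qed
  moreover define N where "N = real m * real (Suc m)"
  moreover have "N > 0" by (simp add: N_def m_def)
  ultimately have le: "x ^ m / (A * B) \<le> 1 / (real m * real (Suc m))"
    unfolding N_def[symmetric] using \<open>0 < A\<close> \<open>0 < B\<close> by (simp add: divide_simps mult.commute)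
  have "x ^ m / (1 - x ^ m) - x ^ Suc m / (1 - x ^ Suc m) = x ^ m * ((1 - x ^ Suc m) - x * (1 - x ^ m)) / ((1 - x ^ m) * (1 - x ^ Suc m))"
    using A B \<open>0 < A\<close> \<open>0 < B\<close> x by (simp add: divide_simps) (simp add: algebra_simps)
  also have "(1 - x ^ Suc m) - x * (1 - x ^ m) = 1 - x" by (simp add: algebra_simps)
  also have "x ^ m * (1 - x) / ((1 - x ^ m) * (1 - x ^ Suc m)) = x ^ m / (A * B) / (1 - x)"
  proof -
    have "c * u / ((A * u) * (B * u)) = c / (A * B) / u" if "u \<noteq> 0" for c u :: real
      using that by (simp add: field_simps)
    thus ?thesis unfolding A B using x by simp
  qed
  also have "\<dots> \<le> 1 / (real m * real (Suc m)) / (1 - x)" using le x by (intro divide_right_mono) auto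
  also have "\<dots> = 1 / (real m * (1 - x)) - 1 / (real (Suc m) * (1 - x))"
  proof -
    have "1 / (a * (a + 1)) / u = 1 / (a * u) - 1 / ((a + 1) * u)" if "a > 0" "u \<noteq> 0" for a u :: real
      using that by (simp add: divide_simps)
    from this[of "real m" "1 - x"] show ?thesis using x by (simp add: m_def add.commute)
  qed
  finally show ?thesis by (simp add: m_def)
qed

context nonprincipal_dchar
begin

text \<open>
  Monsky's argument: if \<open>L(1,\<chi>) = 0\<close>, then \<open>\<Sum>\<chi>(n) x\<^sup>n/(1 - x\<^sup>n)\<close> stays bounded as \<open>x \<rightarrow> 1-\<close>, by partial
  summation against the decreasing weights \<open>1/(n(1 - x)) - x\<^sup>n/(1 - x\<^sup>n)\<close>. As a power series it has
  nonnegative coefficients that are at least 1 at the squares.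
\<close>
lemma L_1_nonzero_real:
  assumes real: "\<And>a. coprime a (int q) \<Longrightarrow> (chi a)\<^sup>2 = 1"
  shows "L 1 \<noteq> 0"
proof
  assume L1: "L 1 = 0"
  define r where "r n = Re (chi (int n))" for n
  have chi_cases: "chi n \<in> {-1, 0, 1}" for n
    using real[of n] chi_eq_0_iff[of n] by (auto simp: power2_eq_1_iff)
  have r1: "r 1 = 1" by (simp add: r_def)
  have r2: "r (m * n) = r m * r n" for m n
    using chi_cases[of "int m"] chi_cases[of "int n"] by (auto simp: r_def chi_mult)
  have r3: "r n \<in> {-1, 0, 1}" for n using chi_cases[of "int n"] by (auto simp: r_def)
  have r4: "\<bar>r n\<bar> \<le> 1" for n using r3[of n] by auto
  define c where "c m = (\<Sum>d | d dvd m. r d)" for m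
  have rsum: "norm (\<Sum>k<n. r (Suc k)) \<le> real q" for n
    using abs_Re_le_cmod[of "\<Sum>k<n. chi (int (Suc k))"] norm_sum_chi_le[of n] by (simp add: r_def)
  have rL: "(\<lambda>n. inverse (real (Suc n)) * r (Suc n)) sums 0"
    using sums_Re[OF summable_sums[OF summable_L[of 1]]] L1 by (simp add: L_def r_def powr_minus)
  have bound: "(\<Sum>m=1..M. c m * x ^ m) \<le> real q" if x: "0 < x" "x < 1" for x M
  proof -
    define w where "w n = 1 / (real (Suc n) * (1 - x)) - x ^ Suc n / (1 - x ^ Suc n)" for n
    have dec: "w (Suc n) \<le> w n" for n unfolding w_def by (rule monsky_weights_decreasing[OF x])
    have w_lim: "w \<longlonglongrightarrow> 0"
    proof -
      have "(\<lambda>n. 1 / (1 - x) * (1 / real (Suc n)) - x ^ Suc n / (1 - x ^ Suc n)) \<longlonglongrightarrow> 1 / (1 - x) * 0 - 0 / (1 - 0)"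
        using LIMSEQ_inverse_real_of_nat LIMSEQ_Suc[OF LIMSEQ_power_zero[of x]] x
        by (intro tendsto_intros) (auto simp: inverse_eq_divide)
      thus ?thesis by (simp add: w_def[abs_def] mult.commute)
    qed
    define Bx where "Bx = (\<Sum>n. w n * r (Suc n))"
    have "norm Bx \<le> real q * w 0"
      using suminf_decreasing_weights_bound[of "\<lambda>n. r (Suc n)" "real q" w, OF rsum dec w_lim] by (simp add: Bx_def)
    also have "w 0 = 1" using x by (simp add: w_def divide_simps)
    finally have Bx: "\<bar>Bx\<bar> \<le> real q" by simp
    have "summable (\<lambda>n. w n * r (Suc n))"
      using summable_decreasing_weights[of "\<lambda>n. r (Suc n)" "real q" w, OF rsum dec w_lim] by simp
    hence "(\<lambda>n. w n * r (Suc n)) sums Bx" unfolding Bx_def by (rule summable_sums)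
    \<comment> \<open>The part \<open>1 / (n * (1 - x))\<close> of the weights contributes
      \<open>L(1) / (1 - x) = 0\<close>, so only the Lambert series is left.\<close>
    hence "(\<lambda>n. inverse (real (Suc n)) * r (Suc n) * (1 / (1 - x)) - w n * r (Suc n)) sums (0 * (1 / (1 - x)) - Bx)"
      by (intro sums_diff sums_mult2 rL)
    also have "(\<lambda>n. inverse (real (Suc n)) * r (Suc n) * (1 / (1 - x)) - w n * r (Suc n)) =
       (\<lambda>n. r (Suc n) * (x ^ Suc n / (1 - x ^ Suc n)))"
      using x by (auto simp: w_def field_simps)
    finally have "(\<lambda>M. \<Sum>n=1..M. r n * (x ^ n / (1 - x ^ n))) \<longlonglongrightarrow> - Bx"
      unfolding sums_def sum_atLeast1_eq_lessThan by simp
    from tendsto_diff[OF this tendsto_lambert[of r, OF r4 x]]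
    have "(\<lambda>M. \<Sum>m=1..M. c m * x ^ m) \<longlonglongrightarrow> - Bx" by (simp add: c_def)
    moreover have "incseq (\<lambda>M. \<Sum>m=1..M. c m * x ^ m)"
      unfolding c_def using sum_divisors_sign[of r, OF r1 r2 r3] x by (intro incseq_SucI) simp
    ultimately have "(\<Sum>m=1..M. c m * x ^ m) \<le> - Bx" by (rule incseq_le[rotated])
    thus ?thesis using Bx by simp
  qed
  have "(\<Sum>m=1..M. c m) \<le> real q" for M
  proof (rule tendsto_upperbound)
    have "((\<lambda>x. \<Sum>m=1..M. c m * x ^ m) \<longlongrightarrow> (\<Sum>m=1..M. c m * 1 ^ m)) (at_left 1)" by (intro tendsto_intros)
    thus "((\<lambda>x. \<Sum>m=1..M. c m * x ^ m) \<longlongrightarrow> (\<Sum>m=1..M. c m)) (at_left 1)" by simp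
    have "\<forall>\<^sub>F x in at_left (1::real). x \<in> {0<..<1}" by (rule eventually_at_leftI[of 0]) auto
    thus "\<forall>\<^sub>F x in at_left 1. (\<Sum>m=1..M. c m * x ^ m) \<le> real q"
      by eventually_elim (use bound in auto)
  qed auto
  from this[of "(Suc q)\<^sup>2"] have "(\<Sum>m=1..(Suc q)\<^sup>2. c m) \<le> real q" .
  \<comment> \<open>There are \<open>q + 1\<close> positive squares up to \<open>(q + 1)^2\<close>,
    one more than the bound \<open>q\<close> allows.\<close>
  moreover have "real (Suc q) \<le> (\<Sum>m=1..(Suc q)\<^sup>2. c m)"
  proof -
    have inj: "inj_on (\<lambda>n::nat. n\<^sup>2) {1..Suc q}" by (intro inj_onI) (simp add: power2_eq_iff_nonneg)
    have "real (Suc q) = (\<Sum>n=1..Suc q. 1)" by simp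
    also have "\<dots> \<le> (\<Sum>n=1..Suc q. c (n\<^sup>2))"
      unfolding c_def by (intro sum_mono sum_divisors_square[of r, OF r1 r2 r3]) auto
    also have "\<dots> = (\<Sum>m\<in>(\<lambda>n. n\<^sup>2) ` {1..Suc q}. c m)" by (subst sum.reindex[OF inj]) simp
    also have "\<dots> \<le> (\<Sum>m=1..(Suc q)\<^sup>2. c m)"
    proof (rule sum_mono2)
      show "(\<lambda>n. n\<^sup>2) ` {1..Suc q} \<subseteq> {1..(Suc q)\<^sup>2}" by (auto intro: power_mono simp del: power_Suc simp: Suc_le_eq)
      show "0 \<le> c b" if "b \<in> {1..(Suc q)\<^sup>2} - (\<lambda>n. n\<^sup>2) ` {1..Suc q}" for b
        using that sum_divisors_sign[of r, OF r1 r2 r3] by (simp add: c_def)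
    qed auto
    finally show ?thesis .
  qed
  ultimately show False by simp
qed

lemma L_1_nonzero: "L 1 \<noteq> 0"
  using L_1_nonzero_real L_1_nonzero_complex by blast

end

section \<open>Relation between the values at 1 and at 0\<close>

locale primitive_nonprincipal_dchar = primitive_dchar + nonprincipal_dchar
begin

lemma q_gt_1: "q > 1"
proof (rule ccontr)
  assume "\<not> q > 1"
  hence "q = 1" using q_pos by simp
  hence "chi a = 1" for a using chi_cong[of a 1] by (simp add: cong_def)
  thus False using nontrivial by blast
qed

lemma chi_0 [simp]: "chi 0 = 0"
  using q_gt_1 by (simp add: chi_eq_0_iff)

lemma sum_chi_reflect: "(\<Sum>a<q. chi (int a) * F a) = chi (- 1) * (\<Sum>a<q. chi (int a) * (if a = 0 then 0 else F (q - a)))"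
proof -
  have "(\<Sum>a<q. chi (int a) * F a) = (\<Sum>a\<in>{1..<q}. chi (int a) * F a)"
    using q_pos by (simp add: lessThan_atLeast0 sum.atLeast_Suc_lessThan)
  also have "\<dots> = (\<Sum>a\<in>{1..<q}. chi (int (q - a)) * F (q - a))"
    by (rule sum.reindex_bij_witness[of _ "\<lambda>a. q - a" "\<lambda>a. q - a"]) auto
  also have "\<dots> = (\<Sum>a\<in>{1..<q}. chi (- 1) * (chi (int a) * (if a = 0 then 0 else F (q - a))))"
  proof (intro sum.cong refl)
    fix a assume a: "a \<in> {1..<q}"
    hence "int (q - a) = - int a + int q" by simp
    hence "chi (int (q - a)) = chi (- int a)" using chi_add_q[of "- int a"] by metis
    also have "\<dots> = chi (- 1) * chi (int a)" by (rule chi_minus)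
    finally show "chi (int (q - a)) * F (q - a) = chi (- 1) * (chi (int a) * (if a = 0 then 0 else F (q - a)))"
      using a by simp
  qed
  also have "\<dots> = chi (- 1) * (\<Sum>a<q. chi (int a) * (if a = 0 then 0 else F (q - a)))"
    using q_pos by (simp add: lessThan_atLeast0 sum.atLeast_Suc_lessThan sum_distrib_left)
  finally show ?thesis .
qed

lemma uroot_neq_1: "0 < a \<Longrightarrow> a < q \<Longrightarrow> uroot q (int a) \<noteq> 1"
  using q_pos by (subst uroot_eq_1_iff) (auto dest: zdvd_imp_le)

text \<open>Expanding the logarithms for radius \<open>r < 1\<close> produces the sums
  \<open>gauss (Suc n)\<close>, which \<open>gauss_eq\<close> turns into conjugate character values.
  Both sides then pass to \<open>r -> 1\<close>, the series by Abel's limit theorem.\<close>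

lemma gauss_L_1:
  "gauss 1 * (\<Sum>n. (real (Suc n) powr -1) *\<^sub>R cnj (chi (int (Suc n)))) = - (\<Sum>a<q. chi (int a) * Ln (1 - uroot q (int a)))"
proof -
  interpret cc: nonprincipal_dchar q "\<lambda>n. cnj (chi n)" by (rule nonprincipal_dchar_cnj)
  define w where "w r n = r ^ Suc n / real (Suc n)" for r :: real and n
  have Ln: "(\<lambda>n. w r n *\<^sub>R u ^ Suc n) sums (- Ln (1 - r * u))" if "0 < r" "r < 1" "norm u = 1" for r and u :: complex
  proof -
    have "(\<lambda>n. - ((- (- (r * u))) ^ n) / of_nat n) sums Ln (1 + (- (r * u)))"
      by (rule Ln_series') (use that in \<open>simp add: norm_mult\<close>)
    from sums_minus[OF this] have "(\<lambda>n. (r * u) ^ n / of_nat n) sums (- Ln (1 - r * u))" by simp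
    hence "(\<lambda>n. (r * u) ^ Suc n / of_nat (Suc n)) sums (- Ln (1 - r * u))"
      using sums_Suc_iff[of "\<lambda>n. (r * u) ^ n / of_nat n"] by simp
    also have "(\<lambda>n. (r * u) ^ Suc n / of_nat (Suc n)) = (\<lambda>n. w r n *\<^sub>R u ^ Suc n)"
      by (rule ext) (simp add: w_def scaleR_conv_of_real power_mult_distrib)
    finally show ?thesis .
  qed
  have eq: "gauss 1 * (\<Sum>n. w r n *\<^sub>R cnj (chi (int (Suc n)))) = - (\<Sum>a<q. chi (int a) * Ln (1 - r * uroot q (int a)))"
    if r: "0 < r" "r < 1" for r
  proof -
    have "(\<lambda>n. \<Sum>a<q. chi (int a) * (w r n *\<^sub>R uroot q (int a) ^ Suc n)) sums (\<Sum>a<q. chi (int a) * (- Ln (1 - r * uroot q (int a))))"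
      by (intro sums_sum sums_mult Ln r) simp
    also have "(\<lambda>n. \<Sum>a<q. chi (int a) * (w r n *\<^sub>R uroot q (int a) ^ Suc n)) = (\<lambda>n. gauss 1 * (w r n *\<^sub>R cnj (chi (int (Suc n)))))"
    proof
      fix n
      have "(\<Sum>a<q. chi (int a) * (w r n *\<^sub>R uroot q (int a) ^ Suc n)) = w r n *\<^sub>R gauss (int (Suc n))"
        unfolding gauss_def uroot_power by (simp add: scaleR_sum_right mult.commute)
      thus "(\<Sum>a<q. chi (int a) * (w r n *\<^sub>R uroot q (int a) ^ Suc n)) = gauss 1 * (w r n *\<^sub>R cnj (chi (int (Suc n))))"
        by (subst (asm) gauss_eq) (simp add: mult.commute)
    qed
    finally have "(\<lambda>n. gauss 1 * (w r n *\<^sub>R cnj (chi (int (Suc n))))) sums (- (\<Sum>a<q. chi (int a) * Ln (1 - r * uroot q (int a))))"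
      by (simp add: sum_negf)
    from sums_mult[OF this, of "inverse (gauss 1)"] gauss_1_nz
    have "(\<lambda>n. w r n *\<^sub>R cnj (chi (int (Suc n)))) sums (inverse (gauss 1) * (- (\<Sum>a<q. chi (int a) * Ln (1 - r * uroot q (int a)))))"
      by (simp add: mult.assoc[symmetric])
    thus ?thesis using gauss_1_nz by (simp add: sums_iff)
  qed
  have ev: "\<forall>\<^sub>F r in at_left (1::real). 0 < r \<and> r < 1"
    by (rule eventually_at_leftI[of 0]) auto
  have "((\<lambda>r. \<Sum>n. w r n *\<^sub>R cnj (chi (int (Suc n)))) \<longlongrightarrow> (\<Sum>n. (real (Suc n) powr -1) *\<^sub>R cnj (chi (int (Suc n))))) (at_left 1)"
  proof (rule tendsto_suminf_decreasing_weights[of _ "real q"])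
    show "norm (\<Sum>k<n. cnj (chi (int (Suc k)))) \<le> real q" for n by (rule cc.norm_sum_chi_le)
    show "\<forall>\<^sub>F r in at_left 1. (\<forall>n. w r (Suc n) \<le> w r n) \<and> w r \<longlonglongrightarrow> 0"
      using ev
    proof eventually_elim
      case (elim r)
      have "w r (Suc n) \<le> w r n" for n unfolding w_def
        using elim power_decreasing[of "Suc n" "Suc (Suc n)" r] by (intro frac_le) auto
      moreover have "(\<lambda>n. r ^ Suc n * (1 / real (Suc n))) \<longlonglongrightarrow> 0 * 0"
        using elim by (intro tendsto_mult LIMSEQ_Suc[OF LIMSEQ_power_zero] LIMSEQ_Suc[OF lim_1_over_n]) auto
      hence "w r \<longlonglongrightarrow> 0" by (simp add: w_def[abs_def])
      ultimately show ?case by blast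
    qed
    show "((\<lambda>r. w r n) \<longlongrightarrow> real (Suc n) powr -1) (at_left 1)" for n
    proof -
      have "((\<lambda>r. w r n) \<longlongrightarrow> 1 ^ Suc n / real (Suc n)) (at_left 1)"
        unfolding w_def by (intro tendsto_intros) auto
      thus ?thesis by (simp add: powr_minus divide_inverse)
    qed
  qed (use L_weights[of 1] in auto)
  hence lim1: "((\<lambda>r. gauss 1 * (\<Sum>n. w r n *\<^sub>R cnj (chi (int (Suc n))))) \<longlongrightarrow> 
     gauss 1 * (\<Sum>n. (real (Suc n) powr -1) *\<^sub>R cnj (chi (int (Suc n))))) (at_left 1)"
    by (intro tendsto_intros)
  have lim2: "((\<lambda>r. - (\<Sum>a<q. chi (int a) * Ln (1 - complex_of_real r * uroot q (int a)))) \<longlongrightarrow> 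
      - (\<Sum>a<q. chi (int a) * Ln (1 - uroot q (int a)))) (at_left 1)"
  proof (intro tendsto_minus tendsto_sum)
    fix a assume a: "a \<in> {..<q}"
    show "((\<lambda>r. chi (int a) * Ln (1 - complex_of_real r * uroot q (int a))) \<longlongrightarrow> chi (int a) * Ln (1 - uroot q (int a))) (at_left 1)"
    \<comment> \<open>At \<open>a = 0\<close> the logarithm is singular in the limit, but
      \<open>chi 0 = 0\<close>.\<close>
    proof (cases "a = 0")
      case False
      define u where "u = uroot q (int a)"
      \<comment> \<open>This keeps \<open>1 - u\<close> off the branch cut of
        \<open>Ln\<close>.\<close>
      have "Re u < 1"
      proof (rule ccontr)
        assume "\<not> Re u < 1"
        moreover have "(Re u)\<^sup>2 + (Im u)\<^sup>2 = 1" using norm_uroot[of q "int a"] by (simp add: u_def cmod_power2[symmetric])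
        moreover have "1 \<le> (Re u)\<^sup>2" using calculation(1) by (intro one_le_power) auto
        ultimately have "(Im u)\<^sup>2 \<le> 0" by linarith
        hence "Im u = 0" by simp
        hence "(Re u)\<^sup>2 = 1" using \<open>(Re u)\<^sup>2 + (Im u)\<^sup>2 = 1\<close> by simp
        hence "Re u = 1" using \<open>\<not> Re u < 1\<close> by (auto simp: power2_eq_1_iff)
        hence "u = 1" using \<open>Im u = 0\<close> by (simp add: complex_eq_iff)
        thus False using uroot_neq_1[of a] a False by (simp add: u_def)
      qed
      hence "1 - u \<notin> \<real>\<^sub>\<le>\<^sub>0" by (auto simp: complex_nonpos_Reals_iff)
      moreover have "((\<lambda>r. 1 - complex_of_real r * u) \<longlongrightarrow> 1 - of_real 1 * u) (at_left 1)" by (intro tendsto_intros)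
      ultimately have "((\<lambda>r. Ln (1 - complex_of_real r * u)) \<longlongrightarrow> Ln (1 - u)) (at_left 1)"
        by (intro tendsto_Ln) auto
      thus ?thesis unfolding u_def by (rule tendsto_mult[OF tendsto_const])
    qed simp
  qed
  have "\<forall>\<^sub>F r in at_left 1. gauss 1 * (\<Sum>n. w r n *\<^sub>R cnj (chi (int (Suc n)))) = - (\<Sum>a<q. chi (int a) * Ln (1 - complex_of_real r * uroot q (int a)))"
    using ev by eventually_elim (rule eq, auto)
  from Lim_transform_eventually[OF lim1 this] lim2 show ?thesis
    by (intro tendsto_unique[OF trivial_limit_at_left_real])
qed

lemma sum_chi_Ln_nonzero: "(\<Sum>a<q. chi (int a) * Ln (1 - uroot q (int a))) \<noteq> 0"
proof -
  interpret cc: nonprincipal_dchar q "\<lambda>n. cnj (chi n)" by (rule nonprincipal_dchar_cnj)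
  show ?thesis using cc.L_1_nonzero gauss_L_1 gauss_1_nz unfolding cc.L_def by auto
qed

text \<open>With \<open>t = pi * a / q\<close>,
  \<open>1 - e^(2it) = 2 sin t * e^(i(t - pi/2))\<close>, and the argument lies within the principal
  range.\<close>

lemma Ln_1_minus_uroot:
  assumes "0 < a" "a < q"
  shows "Ln (1 - uroot q (int a)) = of_real (ln (2 * sin (pi * a / q))) + \<i> * of_real (pi * (a / q - 1 / 2))"
proof -
  define t where "t = pi * a / q"
  have t: "0 < t" "t < pi" using assms by (auto simp: t_def field_simps)
  hence s: "sin t > 0" by (rule sin_gt_zero)
  have "uroot q (int a) = cis (2 * t)" by (simp add: uroot_def t_def mult.assoc)
  hence "1 - uroot q (int a) = of_real (2 * sin t) * cis (t - pi / 2)"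
    by (simp add: complex_eq_iff cos_double_sin sin_double power2_eq_square cos_diff sin_diff)
  also have "\<dots> = exp (of_real (ln (2 * sin t)) + \<i> * of_real (t - pi / 2))"
    using s by (simp add: exp_add cis_conv_exp exp_of_real)
  also have "Ln \<dots> = of_real (ln (2 * sin t)) + \<i> * of_real (t - pi / 2)"
    using t by (intro Ln_exp) auto
  finally show ?thesis by (simp add: t_def algebra_simps)
qed

lemma sum_chi_real: "(\<Sum>a<q. chi (int a)) = 0"
  by (rule sum_chi_eq_0[OF nontrivial])

text \<open>The real part \<open>ln (2 sin (pi a / q))\<close> of the logarithm is symmetric under
  \<open>a -> q - a\<close> and cancels against an odd character. What is left of the nonzero sum of
  logarithms is a multiple of the sum in question.\<close>

lemma odd_sum_nonzero:
  assumes odd: "chi (- 1) = - 1"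
  shows "(\<Sum>a<q. chi (int a) * of_nat a) \<noteq> 0"
proof
  assume 0: "(\<Sum>a<q. chi (int a) * of_nat a) = 0"
  define s where "s a = complex_of_real (ln (2 * sin (pi * a / q)))" for a :: nat
  have "(\<Sum>a<q. chi (int a) * s a) = - (\<Sum>a<q. chi (int a) * (if a = 0 then 0 else s (q - a)))"
    using sum_chi_reflect[of s] by (simp add: odd)
  also have "(\<Sum>a<q. chi (int a) * (if a = 0 then 0 else s (q - a))) = (\<Sum>a<q. chi (int a) * s a)"
  proof (intro sum.cong refl)
    fix a assume a: "a \<in> {..<q}"
    have "pi * real (q - a) / real q = pi - pi * real a / real q" using a by (simp add: field_simps of_nat_diff)
    thus "chi (int a) * (if a = 0 then 0 else s (q - a)) = chi (int a) * s a" by (simp add: s_def)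
  qed
  finally have s0: "(\<Sum>a<q. chi (int a) * s a) = 0" by simp
  have "(\<Sum>a<q. chi (int a) * Ln (1 - uroot q (int a))) = 
     (\<Sum>a<q. chi (int a) * s a + \<i> * pi / q * (chi (int a) * of_nat a) - \<i> * pi / 2 * chi (int a))"
  proof (intro sum.cong refl)
    fix a assume a: "a \<in> {..<q}"
    show "chi (int a) * Ln (1 - uroot q (int a)) = chi (int a) * s a + \<i> * pi / q * (chi (int a) * of_nat a) - \<i> * pi / 2 * chi (int a)"
    proof (cases "a = 0")
      case False
      hence E: "Ln (1 - uroot q (int a)) = s a + \<i> * of_real (pi * (a / q - 1 / 2))"
        using a by (simp only: Ln_1_minus_uroot s_def lessThan_iff neq0_conv)
      show ?thesis unfolding E by (simp add: algebra_simps)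
    qed simp
  qed
  also have "\<dots> = (\<Sum>a<q. chi (int a) * s a) + \<i> * pi / q * (\<Sum>a<q. chi (int a) * of_nat a) - \<i> * pi / 2 * (\<Sum>a<q. chi (int a))"
    by (simp only: sum.distrib sum_subtractf sum_distrib_left)
  also have "\<dots> = 0" by (simp add: s0 0 sum_chi_real)
  finally show False using sum_chi_Ln_nonzero by simp
qed

lemma even_sum_eq_0:
  assumes even: "chi (- 1) = 1"
  shows "(\<Sum>a<q. chi (int a) * of_nat a) = 0"
proof -
  have "(\<Sum>a<q. chi (int a) * of_nat a) = (\<Sum>a<q. chi (int a) * (if a = 0 then 0 else of_nat (q - a)))"
    using sum_chi_reflect[of of_nat] by (simp add: even)
  also have "\<dots> = (\<Sum>a<q. of_nat q * chi (int a) - chi (int a) * of_nat a)"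
    by (intro sum.cong refl) (auto simp: of_nat_diff algebra_simps)
  also have "\<dots> = - (\<Sum>a<q. chi (int a) * of_nat a)"
    by (simp add: sum_subtractf sum_chi_real flip: sum_distrib_left)
  finally show ?thesis by simp
qed

text \<open>Symmetrizing in \<open>a -> q - a\<close>, the reflection formula gives \<open>ln_Gamma
  x + ln_Gamma (1 - x) = ln (2 pi) - ln (2 sin (pi x))\<close>. So twice the sum is the negative of
  the nonzero sum of logarithms.\<close>

lemma even_sum_nonzero:
  assumes even: "chi (- 1) = 1"
  shows "(\<Sum>a<q. chi (int a) * of_real (ln_Gamma (a / q))) \<noteq> 0"
proof -
  define g where "g a = complex_of_real (ln_Gamma (a / q))" for a :: nat
  have "2 * (\<Sum>a<q. chi (int a) * g a) = (\<Sum>a<q. chi (int a) * g a) + (\<Sum>a<q. chi (int a) * (if a = 0 then 0 else g (q - a)))"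
    using sum_chi_reflect[of g] by (simp add: even)
  \<comment> \<open>The imaginary terms complete the real logarithm to
    \<open>Ln (1 - uroot q a)\<close>; against an even nonprincipal character they sum to 0.\<close>
  also have "\<dots> = (\<Sum>a<q. of_real (ln (2 * pi)) * chi (int a) + \<i> * pi / q * (chi (int a) * of_nat a) 
        - \<i> * pi / 2 * chi (int a) - chi (int a) * Ln (1 - uroot q (int a)))"
    unfolding sum.distrib[symmetric]
  proof (intro sum.cong refl)
    fix a assume a: "a \<in> {..<q}"
    show "chi (int a) * g a + chi (int a) * (if a = 0 then 0 else g (q - a)) = 
       of_real (ln (2 * pi)) * chi (int a) + \<i> * pi / q * (chi (int a) * of_nat a) 
        - \<i> * pi / 2 * chi (int a) - chi (int a) * Ln (1 - uroot q (int a))"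
    proof (cases "a = 0")
      case False
      define x where "x = real a / real q"
      have x: "0 < x" "x < 1" using False a by (auto simp: x_def)
      have qa: "real (q - a) / real q = 1 - x" using a q_pos by (simp add: x_def field_simps of_nat_diff)
      have s: "sin (pi * x) > 0" using x by (intro sin_gt_zero) auto
      have "complex_of_real (Gamma x * Gamma (1 - x)) = of_real (pi / sin (pi * x))"
      proof -
        have "complex_of_real (Gamma x * Gamma (1 - x)) = Gamma (of_real x) * Gamma (1 - of_real x)"
          by (simp only: of_real_mult Gamma_complex_of_real[symmetric] of_real_diff of_real_1)
        also have "\<dots> = of_real pi / sin (of_real pi * of_real x)"
          by (rule Gamma_reflection_complex)
        also have "\<dots> = of_real (pi / sin (pi * x))"
          by (simp only: of_real_mult[symmetric] sin_of_real of_real_divide)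
        finally show ?thesis .
      qed
      hence "Gamma x * Gamma (1 - x) = pi / sin (pi * x)" by (simp only: of_real_eq_iff)
      moreover have lnG: "ln (Gamma x * Gamma (1 - x)) = ln (Gamma x) + ln (Gamma (1 - x))"
        by (rule ln_mult_pos) (use x in auto)
      ultimately have "ln (Gamma x * Gamma (1 - x)) = ln (pi / sin (pi * x))" by simp
      hence "ln_Gamma x + ln_Gamma (1 - x) = ln pi - ln (sin (pi * x))"
        unfolding lnG using x s by (simp add: ln_div ln_Gamma_real_pos)
      also have "\<dots> = ln (2 * pi) - ln (2 * sin (pi * x))" using s by (simp add: ln_mult)
      finally have "g a + g (q - a) = of_real (ln (2 * pi)) - of_real (ln (2 * sin (pi * x)))"
        unfolding g_def qa x_def[symmetric] of_real_add[symmetric] of_real_diff[symmetric] by (simp only:)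
      hence "chi (int a) * g a + chi (int a) * g (q - a) = chi (int a) * (of_real (ln (2 * pi)) - of_real (ln (2 * sin (pi * x))))"
        by (metis distrib_left)
      moreover have E: "Ln (1 - uroot q (int a)) = of_real (ln (2 * sin (pi * x))) + \<i> * of_real (pi * (a / q - 1 / 2))"
        using a False Ln_1_minus_uroot[of a] by (simp add: x_def)
      ultimately show ?thesis unfolding E using False by (simp add: algebra_simps)
    qed simp
  qed
  also have "\<dots> = of_real (ln (2 * pi)) * (\<Sum>a<q. chi (int a)) + \<i> * pi / q * (\<Sum>a<q. chi (int a) * of_nat a) 
        - \<i> * pi / 2 * (\<Sum>a<q. chi (int a)) - (\<Sum>a<q. chi (int a) * Ln (1 - uroot q (int a)))"
    by (simp only: sum.distrib sum_subtractf sum_distrib_left)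
  also have "\<dots> = - (\<Sum>a<q. chi (int a) * Ln (1 - uroot q (int a)))"
    by (simp add: sum_chi_real even_sum_eq_0[OF even])
  finally show ?thesis using sum_chi_Ln_nonzero by (auto simp: g_def)
qed

end

section \<open>Behaviour at 0\<close>

lemma powr_minus_diff_decreasing:
  assumes s: "s > 0"
  shows "real (Suc (Suc n)) powr -s - real (Suc (Suc (Suc n))) powr -s \<le> real (Suc n) powr -s - real (Suc (Suc n)) powr -s"
proof -
  obtain y where y: "y > real (Suc n)" "y < real (Suc (Suc n))" 
    "real (Suc n) powr -s - real (Suc (Suc n)) powr -s = s * y powr (-s - 1)" using powr_minus_diff_MVT by blast
  obtain z where z: "z > real (Suc (Suc n))" 
    "real (Suc (Suc n)) powr -s - real (Suc (Suc (Suc n))) powr -s = s * z powr (-s - 1)" using powr_minus_diff_MVT[of "Suc n"] by blast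
  have "z powr (-s - 1) \<le> y powr (-s - 1)" using y z s by (intro powr_mono2') auto
  thus ?thesis unfolding y(3) z(2) using s by (intro mult_left_mono) auto
qed

lemma tendsto_powr_minus_diff:
  assumes "s > 0"
  shows "(\<lambda>n. real (Suc n) powr -s - real (Suc (Suc n)) powr -s) \<longlonglongrightarrow> 0"
  using tendsto_diff[OF tendsto_powr_minus_Suc[OF assms] LIMSEQ_Suc[OF tendsto_powr_minus_Suc[OF assms]]] by simp

lemma tendsto_powr_minus_0: "x > 0 \<Longrightarrow> ((\<lambda>s. x powr -s) \<longlongrightarrow> 1) (at_right (0::real))"
  using tendsto_powr[OF tendsto_const[of x] tendsto_minus[OF tendsto_ident_at[of 0 "{0<..}"]]] by simp

lemma tendsto_powr_minus_1_over:
  assumes "x > 0"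
  shows "((\<lambda>s. (1 - x powr -s) / s) \<longlongrightarrow> ln x) (at_right (0::real))"
proof -
  have "((\<lambda>s. x powr -s) has_real_derivative (- ln x)) (at 0)"
    using assms by (auto intro!: derivative_eq_intros)
  hence "((\<lambda>s. (x powr -(0 + s) - x powr -0) / s) \<longlongrightarrow> - ln x) (at 0)" by (simp add: DERIV_def)
  hence "((\<lambda>s. (x powr -(0 + s) - x powr -0) / s) \<longlongrightarrow> - ln x) (at_right 0)"
    by (rule filterlim_mono[OF _ order.refl at_le]) simp
  from tendsto_minus[OF this] show ?thesis using assms by (simp add: diff_divide_distrib)
qed

context nonprincipal_dchar
begin

lemma L_by_parts:
  assumes s: "s > 0"
  shows "(\<lambda>n. (real (Suc n) powr -s - real (Suc (Suc n)) powr -s) *\<^sub>R (\<Sum>k<Suc n. chi (int (Suc k)))) sums L s"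
  unfolding L_def
proof (rule suminf_by_parts[OF _ summable_L[OF s]])
  show "(\<lambda>N. real (Suc N) powr -s *\<^sub>R (\<Sum>k<N. chi (int (Suc k)))) \<longlonglongrightarrow> 0"
  proof (rule Lim_null_comparison)
    show "(\<lambda>N. real (Suc N) powr -s * real q) \<longlonglongrightarrow> 0"
      by (rule tendsto_mult_left_zero[OF tendsto_powr_minus_Suc[OF s]])
    show "\<forall>\<^sub>F N in sequentially. norm (real (Suc N) powr -s *\<^sub>R (\<Sum>k<N. chi (int (Suc k)))) \<le> real (Suc N) powr -s * real q"
      using norm_sum_chi_le by (intro always_eventually allI) (auto intro!: mult_left_mono)
  qed
qed

lemma sum_chi_Suc_periodic: "(\<Sum>k<n + q. chi (int (Suc k))) = (\<Sum>k<n. chi (int (Suc k)))"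
proof (induction n)
  case (Suc n)
  have "int (Suc (n + q)) = int (Suc n) + int q" by simp
  hence "chi (int (Suc (n + q))) = chi (int (Suc n))" using chi_add_q by metis
  thus ?case using Suc by simp
qed (use sum_chi_Suc_eq_0 in simp)

end

context primitive_nonprincipal_dchar
begin

lemma sum_chi_Suc_times: "(\<Sum>k<q. chi (int (Suc k)) * F (Suc k)) = (\<Sum>a<q. chi (int a) * F a)"
proof -
  have "chi (int q) = 0" using chi_add_q[of 0] by simp
  thus ?thesis using sum.lessThan_Suc_shift[of "\<lambda>a. chi (int a) * F a" q] by simp
qed

text \<open>Divided by \<open>q\<close>, this is the mean of the character sums over a period, which
  becomes the limit of \<open>L\<close> at 0.\<close>

lemma sum_sum_chi: "(\<Sum>n<q. \<Sum>k<Suc n. chi (int (Suc k))) = - (\<Sum>a<q. chi (int a) * of_nat a)"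
proof -
  have "(\<Sum>n<N. \<Sum>k<Suc n. chi (int (Suc k))) = (\<Sum>k<N. chi (int (Suc k)) * (of_nat N - of_nat k))" for N
    by (induction N) (simp_all add: algebra_simps sum.distrib sum_subtractf)
  hence "(\<Sum>n<q. \<Sum>k<Suc n. chi (int (Suc k))) = (\<Sum>k<q. chi (int (Suc k)) * (of_nat q + 1 - of_nat (Suc k)))"
    by simp
  also have "\<dots> = (\<Sum>a<q. chi (int a) * (of_nat q + 1 - of_nat a))" by (rule sum_chi_Suc_times)
  also have "\<dots> = (of_nat q + 1) * (\<Sum>a<q. chi (int a)) - (\<Sum>a<q. chi (int a) * of_nat a)"
    by (simp add: algebra_simps sum_subtractf sum.distrib sum_distrib_left)
  finally show ?thesis by (simp add: sum_chi_real)
qed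

text \<open>After subtraction of their mean, the character sums themselves have bounded partial
  sums, so that the estimates for decreasing weights apply a second time.\<close>

lemma norm_sum_centered_le:
  assumes m: "m = (\<Sum>n<q. \<Sum>k<Suc n. chi (int (Suc k))) / of_nat q"
  shows "norm (\<Sum>n<N. (\<Sum>k<Suc n. chi (int (Suc k))) - m) \<le> real q * (real q + norm m)"
proof (rule sum_periodic_bound[OF q_pos])
  show "(\<Sum>k<Suc (n + q). chi (int (Suc k))) - m = (\<Sum>k<Suc n. chi (int (Suc k))) - m" for n
    using sum_chi_Suc_periodic[of "Suc n"] by simp
  show "(\<Sum>n<q. (\<Sum>k<Suc n. chi (int (Suc k))) - m) = 0"
    using q_pos by (simp add: sum_subtractf m del: sum.lessThan_Suc)
  show "norm ((\<Sum>k<Suc n. chi (int (Suc k))) - m) \<le> real q + norm m" for n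
    by (rule order.trans[OF norm_triangle_ineq4 add_right_mono[OF norm_sum_chi_le]])
qed

text \<open>The weights \<open>v s\<close> sum to 1, so \<open>L s\<close> is the mean
  \<open>m\<close> plus the weighted sum of the centered character sums. Each weight tends to 0, and
  with it that sum.\<close>

lemma tendsto_L_0: "(L \<longlongrightarrow> - (\<Sum>a<q. chi (int a) * of_nat a) / of_nat q) (at_right 0)"
proof -
  define m where "m = (\<Sum>n<q. \<Sum>k<Suc n. chi (int (Suc k))) / of_nat q"
  define Y where "Y n = (\<Sum>k<Suc n. chi (int (Suc k))) - m" for n
  define v where "v s n = real (Suc n) powr -s - real (Suc (Suc n)) powr -s" for s and n :: nat
  have Y: "norm (\<Sum>n<N. Y n) \<le> real q * (real q + norm m)" for N
    unfolding Y_def by (rule norm_sum_centered_le) (rule m_def)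
  have pos: "\<forall>\<^sub>F s in at_right (0::real). s > 0" by (simp add: eventually_at_right_less)
  have "((\<lambda>s. \<Sum>n. v s n *\<^sub>R Y n) \<longlongrightarrow> (\<Sum>n. 0 *\<^sub>R Y n)) (at_right 0)"
  proof (rule tendsto_suminf_decreasing_weights[OF Y])
    show "\<forall>\<^sub>F s in at_right 0. (\<forall>n. v s (Suc n) \<le> v s n) \<and> v s \<longlonglongrightarrow> 0"
      using pos by eventually_elim (use powr_minus_diff_decreasing tendsto_powr_minus_diff in \<open>auto simp: v_def[abs_def]\<close>)
    show "((\<lambda>s. v s n) \<longlongrightarrow> 0) (at_right 0)" for n
      using tendsto_diff[OF tendsto_powr_minus_0 tendsto_powr_minus_0, of "real (Suc n)" "real (Suc (Suc n))"]
      by (simp add: v_def)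
  qed auto
  hence "((\<lambda>s. m + (\<Sum>n. v s n *\<^sub>R Y n)) \<longlongrightarrow> m + 0) (at_right 0)" by (intro tendsto_intros) simp
  moreover have "\<forall>\<^sub>F s in at_right 0. m + (\<Sum>n. v s n *\<^sub>R Y n) = L s"
    using pos
  proof eventually_elim
    case (elim s)
    have "(\<lambda>n. v s n *\<^sub>R m) sums (1 *\<^sub>R m)"
      unfolding v_def using sums_powr_minus_diff[OF elim] by (rule sums_scaleR_left)
    from sums_diff[OF L_by_parts[OF elim] this[unfolded v_def]]
    have "(\<lambda>n. v s n *\<^sub>R Y n) sums (L s - m)" by (simp add: v_def Y_def scaleR_diff_right del: sum.lessThan_Suc)
    thus ?case by (simp add: sums_iff)
  qed
  ultimately have "(L \<longlongrightarrow> m) (at_right 0)" by (simp add: Lim_transform_eventually)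
  thus ?thesis unfolding m_def sum_sum_chi .
qed

text \<open>
  Along multiples of \<open>q\<close> the boundary terms vanish, so partial summation turns the series into
  \<open>- \<Sum>\<chi>(n) log n\<close>; grouped by residue classes this is Gauss's limit formula for \<open>log \<Gamma>(a/q)\<close>.
\<close>
lemma suminf_log_weights:
  assumes even: "chi (- 1) = 1"
  shows "(\<Sum>n. (ln (real (Suc (Suc n))) - ln (real (Suc n))) *\<^sub>R (\<Sum>k<Suc n. chi (int (Suc k)))) =
    (\<Sum>a<q. chi (int a) * of_real (ln_Gamma (a / q)))"
proof -
  define X where "X n = (\<Sum>k<n. chi (int (Suc k)))" for n
  define u where "u n = ln (real (Suc (Suc n))) - ln (real (Suc n))" for n :: nat
  have bnd: "norm (\<Sum>n<N. X (Suc n)) \<le> real q * (real q + 0)" for N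
    using norm_sum_centered_le[of 0 N] even_sum_eq_0[OF even] sum_sum_chi unfolding X_def by simp
  have u: "u (Suc n) \<le> u n" for n
  proof -
    have "u k = ln (1 + 1 / real (Suc k))" for k
    proof -
      have "u k = ln (real (Suc (Suc k)) / real (Suc k))" by (simp add: u_def ln_div)
      also have "real (Suc (Suc k)) / real (Suc k) = 1 + 1 / real (Suc k)" by (simp add: field_simps)
      finally show ?thesis .
    qed
    moreover have "ln (1 + 1 / real (Suc (Suc n))) \<le> ln (1 + 1 / real (Suc n))"
      by (subst ln_le_cancel_iff) (auto simp: frac_le add_pos_pos)
    ultimately show ?thesis by simp
  qed
  have u0: "u \<longlonglongrightarrow> 0" unfolding u_def by real_asymp
  have "summable (\<lambda>n. u n *\<^sub>R X (Suc n))" by (rule summable_decreasing_weights[OF bnd u u0])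
  hence "(\<lambda>N. \<Sum>n<N. u n *\<^sub>R X (Suc n)) \<longlonglongrightarrow> (\<Sum>n. u n *\<^sub>R X (Suc n))" by (rule summable_LIMSEQ)
  \<comment> \<open>\<open>ln_Gamma_series z K\<close> involves the \<open>K + 1\<close> logarithms
    of \<open>z + k\<close> for \<open>k <= K\<close>, hence \<open>K + 1\<close> periods.\<close>
  moreover have "filterlim (\<lambda>K. Suc K * q) sequentially sequentially"
    using q_pos by (intro filterlim_subseq strict_monoI) simp
  ultimately have lim1: "(\<lambda>K. \<Sum>n<Suc K * q. u n *\<^sub>R X (Suc n)) \<longlonglongrightarrow> (\<Sum>n. u n *\<^sub>R X (Suc n))"
    by (rule filterlim_compose)
  have "(\<lambda>K. \<Sum>a\<in>{1..<q}. chi (int a) * of_real (ln_Gamma_series (a / q) K)) \<longlonglongrightarrow> 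
        (\<Sum>a\<in>{1..<q}. chi (int a) * of_real (ln_Gamma (a / q)))"
    using q_pos by (intro tendsto_intros ln_Gamma_real_LIMSEQ) auto
  also have "(\<Sum>a\<in>{1..<q}. chi (int a) * of_real (ln_Gamma (a / q))) = (\<Sum>a<q. chi (int a) * of_real (ln_Gamma (a / q)))"
    using q_pos by (simp add: lessThan_atLeast0 sum.atLeast_Suc_lessThan)
  finally have lim2: "(\<lambda>K. \<Sum>a\<in>{1..<q}. chi (int a) * of_real (ln_Gamma_series (a / q) K)) \<longlonglongrightarrow> 
        (\<Sum>a<q. chi (int a) * of_real (ln_Gamma (a / q)))" .
  have "(\<Sum>a\<in>{1..<q}. chi (int a) * of_real (ln_Gamma_series (a / q) K)) = (\<Sum>n<Suc K * q. u n *\<^sub>R X (Suc n))" for K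
  proof -
    have per: "(\<Sum>k<n*q. G k) = (\<Sum>a<q. \<Sum>j<n. G (j * q + a))" for n and G :: "nat \<Rightarrow> complex"
    proof (induction n)
      case (Suc n)
      have "(\<Sum>k<Suc n*q. G k) = (\<Sum>k<n*q. G k) + (\<Sum>a<q. G (n*q + a))"
        using sum_lessThan_add[of G "n*q" q] by (simp add: add.commute)
      thus ?case by (simp add: Suc sum.distrib)
    qed simp
    define F where "F b = (\<Sum>j<Suc K. complex_of_real (ln (real (j * q + b))))" for b
    define c where "c = (\<Sum>k=1..K. ln (real k)) + real (Suc K) * ln (real q)"
    have "X (n * q) = 0" for n
    proof (induction n)
      case (Suc n)
      have "X (Suc n * q) = X (n * q + q)" by (simp add: add.commute)
      thus ?case using Suc sum_chi_Suc_periodic[of "n * q"] by (simp only: X_def)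
    qed (simp add: X_def)
    hence "(\<Sum>n<Suc K * q. u n *\<^sub>R X (Suc n)) = - (\<Sum>n<Suc K * q. ln (real (Suc n)) *\<^sub>R chi (int (Suc n)))"
      using sum_by_parts[of "\<lambda>n. ln (real (Suc n))" "\<lambda>n. chi (int (Suc n))" "Suc K * q"]
      by (simp add: u_def X_def[symmetric] scaleR_diff_left sum_subtractf del: mult_Suc sum.lessThan_Suc of_nat_Suc)
    also have "(\<Sum>n<Suc K * q. ln (real (Suc n)) *\<^sub>R chi (int (Suc n))) = (\<Sum>a<q. chi (int (Suc a)) * F (Suc a))"
      unfolding per F_def sum_distrib_left
    proof (intro sum.cong refl)
      fix a j
      have "int (Suc (j * q + a)) = int (Suc a) + int j * int q" by simp
      hence "chi (int (Suc (j * q + a))) = chi (int (Suc a))" using chi_add_mult_nat by metis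
      thus "ln (real (Suc (j * q + a))) *\<^sub>R chi (int (Suc (j * q + a))) = chi (int (Suc a)) * complex_of_real (ln (real (j * q + Suc a)))"
        by (simp add: scaleR_conv_of_real mult.commute)
    qed
    also have "\<dots> = (\<Sum>a<q. chi (int a) * F a)" by (rule sum_chi_Suc_times)
    finally have 1: "(\<Sum>n<Suc K * q. u n *\<^sub>R X (Suc n)) = - (\<Sum>a<q. chi (int a) * F a)" .
    \<comment> \<open>The part \<open>c\<close> does not depend on \<open>a\<close> and the next
      part is linear in \<open>a\<close>; both vanish against an even nonprincipal character, and
      only \<open>F\<close> survives.\<close>
    have lnG: "of_real (ln_Gamma_series (a / q) K) = of_real c + of_real (ln K / q) * of_nat a - F a" if a: "a \<in> {1..<q}" for a
    proof -
      define z where "z = real a / real q"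
      have z: "z > 0" using a by (simp add: z_def)
      have "ln_Gamma_series z K = z * ln K - ln z - (\<Sum>k=1..K. ln (real k + z) - ln (real k))"
        unfolding ln_Gamma_series_def
      proof (intro arg_cong2[of _ _ _ _ "(-)"] sum.cong refl)
        fix k assume k: "k \<in> {1..K}"
        have "z / real k + 1 = (real k + z) / real k" using k by (simp add: field_simps)
        thus "ln (z / real k + 1) = ln (real k + z) - ln (real k)" using k z by (simp add: ln_div)
      qed
      also have "\<dots> = z * ln K + (\<Sum>k=1..K. ln (real k)) - (\<Sum>k<Suc K. ln (real k + z))"
        unfolding sum.lessThan_Suc_shift by (simp add: sum_subtractf sum.atLeast1_atMost_eq)
      also have "(\<Sum>k<Suc K. ln (real k + z)) = (\<Sum>k<Suc K. ln (real (k * q + a)) - ln q)"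
      proof (intro sum.cong refl)
        fix k
        have "real k + z = real (k * q + a) / q" using q_pos by (simp add: z_def field_simps)
        moreover have "real (k * q + a) > 0" unfolding of_nat_0_less_iff using a by simp
        ultimately show "ln (real k + z) = ln (real (k * q + a)) - ln q" using q_pos by (simp add: ln_div)
      qed
      also have "\<dots> = (\<Sum>k<Suc K. ln (real (k * q + a))) - real (Suc K) * ln q"
        by (simp only: sum_subtractf sum_constant card_lessThan)
      finally have "ln_Gamma_series z K = c + ln K / q * a - (\<Sum>k<Suc K. ln (real (k * q + a)))"
        by (simp add: c_def z_def)
      thus ?thesis unfolding F_def z_def[symmetric] by (simp del: sum.lessThan_Suc)
    qed
    have "(\<Sum>a\<in>{1..<q}. chi (int a) * of_real (ln_Gamma_series (a / q) K)) = 
        (\<Sum>a\<in>{1..<q}. chi (int a) * (of_real c + of_real (ln K / q) * of_nat a - F a))"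
      by (intro sum.cong refl) (simp only: lnG)
    also have "\<dots> = (\<Sum>a<q. chi (int a) * (of_real c + of_real (ln K / q) * of_nat a - F a))"
      using q_pos by (simp add: lessThan_atLeast0 sum.atLeast_Suc_lessThan)
    also have "\<dots> = of_real c * (\<Sum>a<q. chi (int a)) + of_real (ln K / q) * (\<Sum>a<q. chi (int a) * of_nat a) - (\<Sum>a<q. chi (int a) * F a)"
      by (simp add: sum_distrib_left sum.distrib[symmetric] sum_subtractf[symmetric] algebra_simps)
    also have "\<dots> = (\<Sum>n<Suc K * q. u n *\<^sub>R X (Suc n))"
      by (simp only: 1 sum_chi_real even_sum_eq_0[OF even]) simp
    finally show ?thesis .
  qed
  hence "(\<lambda>K. \<Sum>n<Suc K * q. u n *\<^sub>R X (Suc n)) \<longlonglongrightarrow> (\<Sum>a<q. chi (int a) * of_real (ln_Gamma (a / q)))"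
    using lim2 by simp
  from LIMSEQ_unique[OF lim1 this] show ?thesis by (simp add: u_def X_def del: sum.lessThan_Suc)
qed

text \<open>For even \<open>chi\<close> the character sums have mean 0, so dividing the weights by
  \<open>s\<close> is harmless; the weights then tend to differences of logarithms.\<close>

lemma tendsto_L_over_s_0:
  assumes even: "chi (- 1) = 1"
  shows "((\<lambda>s. L s / of_real s) \<longlongrightarrow> (\<Sum>a<q. chi (int a) * of_real (ln_Gamma (a / q)))) (at_right 0)"
proof -
  define X where "X n = (\<Sum>k<n. chi (int (Suc k)))" for n
  define v where "v s n = (real (Suc n) powr -s - real (Suc (Suc n)) powr -s) / s" for s and n :: nat
  define u where "u n = ln (real (Suc (Suc n))) - ln (real (Suc n))" for n :: nat
  have bnd: "norm (\<Sum>n<N. X (Suc n)) \<le> real q * (real q + 0)" for N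
    using norm_sum_centered_le[of 0 N] even_sum_eq_0[OF even] sum_sum_chi unfolding X_def by simp
  have pos: "\<forall>\<^sub>F s in at_right (0::real). s > 0" by (simp add: eventually_at_right_less)
  have vu: "((\<lambda>s. v s n) \<longlongrightarrow> u n) (at_right 0)" for n
    using tendsto_diff[OF tendsto_powr_minus_1_over tendsto_powr_minus_1_over, of "real (Suc (Suc n))" "real (Suc n)"]
    by (simp add: v_def u_def diff_divide_distrib)
  have v: "v s (Suc n) \<le> v s n" "v s \<longlonglongrightarrow> 0" if "s > 0" for s n
    using powr_minus_diff_decreasing[OF that, of n] tendsto_divide[OF tendsto_powr_minus_diff[OF that] tendsto_const[of s]] that
    by (auto simp: v_def[abs_def] divide_right_mono)
  have "((\<lambda>s. \<Sum>n. v s n *\<^sub>R X (Suc n)) \<longlongrightarrow> (\<Sum>n. u n *\<^sub>R X (Suc n))) (at_right 0)"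
  proof (rule tendsto_suminf_decreasing_weights[OF bnd _ _ _ vu])
    show "\<forall>\<^sub>F s in at_right 0. (\<forall>n. v s (Suc n) \<le> v s n) \<and> v s \<longlonglongrightarrow> 0"
      using pos by eventually_elim (use v in auto)
    show "u (Suc n) \<le> u n" for n
      using pos by (intro tendsto_le[OF _ vu vu]) (auto elim!: eventually_mono intro: v)
    show "u \<longlonglongrightarrow> 0" unfolding u_def by real_asymp
  qed
  moreover have "\<forall>\<^sub>F s in at_right 0. (\<Sum>n. v s n *\<^sub>R X (Suc n)) = L s / of_real s"
    using pos
  proof eventually_elim
    case (elim s)
    from sums_scaleR_right[OF L_by_parts[OF elim], of "1 / s"]
    have "(\<lambda>n. v s n *\<^sub>R X (Suc n)) sums ((1 / s) *\<^sub>R L s)" by (simp add: v_def X_def del: sum.lessThan_Suc)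
    thus ?case by (simp add: sums_iff scaleR_conv_of_real divide_inverse)
  qed
  ultimately have "((\<lambda>s. L s / of_real s) \<longlongrightarrow> (\<Sum>n. u n *\<^sub>R X (Suc n))) (at_right 0)"
    by (rule Lim_transform_eventually)
  thus ?thesis using suminf_log_weights[OF even] by (simp add: u_def X_def del: sum.lessThan_Suc)
qed

lemma L_vanishing_order:
  obtains l where "l \<noteq> 0" "((\<lambda>s. L s / of_real (s ^ (if chi (- 1) = - 1 then 0 else 1))) \<longlongrightarrow> l) (at_right 0)"
proof (cases "chi (- 1) = - 1")
  case True
  have nz: "- (\<Sum>a<q. chi (int a) * of_nat a) / of_nat q \<noteq> 0" using odd_sum_nonzero[OF True] q_pos by simp
  show ?thesis by (rule that[OF nz]) (use tendsto_L_0 True in simp)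
next
  case False
  hence "chi (- 1) = 1" using chi_minus_1_cases by blast
  show ?thesis by (rule that[OF even_sum_nonzero]) (use tendsto_L_over_s_0 \<open>chi (- 1) = 1\<close> in simp_all)
qed

end

section \<open>The pole at 0\<close>

text \<open>The power of the logarithm is traded for half of the decay \<open>y^-s\<close>. The
  price \<open>(2D/s)^D\<close> is what limits the pole at 0 to order \<open>D\<close>.\<close>

lemma ln_powr_le:
  fixes D s y :: real
  assumes "D > 0" "s > 0" "y \<ge> 1"
  shows "ln y powr D \<le> (2 * D / s) powr D * y powr (s / 2)"
proof -
  have "ln y = 2 * D / s * ln (y powr (s / (2 * D)))" using assms by (simp add: ln_powr)
  also have "\<dots> \<le> 2 * D / s * y powr (s / (2 * D))"
    using assms ln_bound[of "y powr (s / (2 * D))"] by (intro mult_left_mono) auto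
  finally have "ln y powr D \<le> (2 * D / s * y powr (s / (2 * D))) powr D"
    using assms by (intro powr_mono2) auto
  also have "\<dots> = (2 * D / s) powr D * y powr (s / 2)"
    using assms by (subst powr_mult) (auto simp: powr_powr)
  finally show ?thesis .
qed

text \<open>With \<open>a\<close> and \<open>b\<close> the powers with exponent \<open>-s/2\<close>,
  this is \<open>(a^2 - b^2) / a <= 2 * (a - b)\<close>; the right side telescopes.\<close>

lemma powr_half_times_diff_le:
  assumes "s > 0"
  shows "real (Suc n) powr (s / 2) * (real (Suc n) powr -s - real (Suc (Suc n)) powr -s)
     \<le> 2 * (real (Suc n) powr -(s / 2) - real (Suc (Suc n)) powr -(s / 2))"
proof -
  define a where "a = real (Suc n) powr -(s / 2)"
  define b where "b = real (Suc (Suc n)) powr -(s / 2)"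
  have ab: "0 < b" "b \<le> a" "0 < a" using powr_minus_diff_le(1)[of "s / 2" n] assms by (simp_all add: a_def b_def)
  have "real (Suc n) powr -s = a * a" "real (Suc (Suc n)) powr -s = b * b" "real (Suc n) powr (s / 2) = 1 / a"
    unfolding a_def b_def by (simp_all add: powr_add[symmetric] powr_minus_divide)
  hence "real (Suc n) powr (s / 2) * (real (Suc n) powr -s - real (Suc (Suc n)) powr -s) = (a - b) * ((a + b) / a)"
    by (simp add: algebra_simps diff_divide_distrib add_divide_distrib)
  also have "\<dots> \<le> (a - b) * 2" using ab by (intro mult_left_mono) (auto simp: field_simps)
  finally show ?thesis unfolding a_def b_def by linarith
qed

text \<open>The pole part carries the factor \<open>\<epsilon>\<close>, while \<open>K\<close>,
  which absorbs finitely many exceptional sums, enters without a power of \<open>1/s\<close>: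
  multiplied by \<open>s^D\<close> it disappears as \<open>s -> 0\<close>.\<close>

lemma dirichlet_series_of_small_sums:
  fixes f :: "nat \<Rightarrow> complex"
  assumes D: "D > 0" and K: "K \<ge> 0" "\<epsilon> \<ge> 0" and s: "s > 0"
    and M: "\<And>n. n \<ge> 1 \<Longrightarrow> norm (\<Sum>k=1..n. f k) \<le> K + \<epsilon> * ln (real n) powr D"
  obtains F where "(\<lambda>x. \<Sum>n=1..x. of_real (real n powr -s) * f n) \<longlonglongrightarrow> F" "norm F \<le> K + 2 * \<epsilon> * (2 * D / s) powr D"
proof -
  define C where "C = \<epsilon> * (2 * D / s) powr D"
  have C: "C \<ge> 0" using K by (simp add: C_def)
  define w where "w n = real (Suc n) powr -s" for n
  define h where "h n = real (Suc n) powr -(s / 2)" for n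
  define m where "m n = (\<Sum>k<n. f (Suc k))" for n
  have mb: "norm (m n) \<le> K + C * real n powr (s / 2)" for n
  proof (cases "n = 0")
    case False
    have "norm (m n) \<le> K + \<epsilon> * ln (real n) powr D" using M[of n] False by (simp add: m_def sum.atLeast1_atMost_eq)
    also have "\<dots> \<le> K + \<epsilon> * ((2 * D / s) powr D * real n powr (s / 2))"
      using False D s K by (intro add_left_mono mult_left_mono ln_powr_le) auto
    finally show ?thesis by (simp add: C_def mult.assoc)
  qed (use K in \<open>simp add: m_def\<close>)
  have le: "norm ((w n - w (Suc n)) *\<^sub>R m (Suc n)) \<le> K * (w n - w (Suc n)) + 2 * C * (h n - h (Suc n))" for n
  proof -
    have w0: "w n - w (Suc n) \<ge> 0" unfolding w_def by (rule powr_minus_diff_le(1)[OF s])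
    have "norm ((w n - w (Suc n)) *\<^sub>R m (Suc n)) \<le> (w n - w (Suc n)) * (K + C * real (Suc n) powr (s / 2))"
      using w0 mb[of "Suc n"] by (simp add: mult_left_mono)
    also have "\<dots> = K * (w n - w (Suc n)) + C * (real (Suc n) powr (s / 2) * (w n - w (Suc n)))" by (simp add: algebra_simps)
    also have "\<dots> \<le> K * (w n - w (Suc n)) + C * (2 * (h n - h (Suc n)))"
      unfolding w_def h_def by (intro add_left_mono mult_left_mono powr_half_times_diff_le s C)
    finally show ?thesis by (simp only: mult.assoc mult.left_commute[of C])
  qed
  have "(\<lambda>n. K * (w n - w (Suc n)) + 2 * C * (h n - h (Suc n))) sums (K * 1 + 2 * C * 1)"
    unfolding w_def h_def using s by (intro sums_add sums_mult sums_powr_minus_diff) auto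
  hence sm: "summable (\<lambda>n. K * (w n - w (Suc n)) + 2 * C * (h n - h (Suc n)))"
    and val: "(\<Sum>n. K * (w n - w (Suc n)) + 2 * C * (h n - h (Suc n))) = K + 2 * C" by (simp_all add: sums_iff)
  define F where "F = (\<Sum>n. (w n - w (Suc n)) *\<^sub>R m (Suc n))"
  have "summable (\<lambda>n. (w n - w (Suc n)) *\<^sub>R m (Suc n))"
    by (rule summable_comparison_test'[OF sm]) (rule le)
  hence "(\<lambda>N. \<Sum>n<N. (w n - w (Suc n)) *\<^sub>R m (Suc n)) \<longlonglongrightarrow> F"
    unfolding F_def by (rule summable_LIMSEQ)
  moreover have "(\<lambda>N. w N *\<^sub>R m N) \<longlonglongrightarrow> 0"
  proof (rule Lim_null_comparison)
    have "(\<lambda>N. K * w N + C * h N) \<longlonglongrightarrow> K * 0 + C * 0"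
      unfolding w_def h_def using s by (intro tendsto_intros tendsto_powr_minus_Suc) auto
    thus "(\<lambda>N. K * w N + C * h N) \<longlonglongrightarrow> 0" by simp
    show "\<forall>\<^sub>F N in sequentially. norm (w N *\<^sub>R m N) \<le> K * w N + C * h N"
    proof (intro always_eventually allI)
      fix N
      have "norm (m N) \<le> K + C * real (Suc N) powr (s / 2)"
        by (rule order.trans[OF mb]) (use s C in \<open>intro add_left_mono mult_left_mono powr_mono2, auto\<close>)
      hence "norm (w N *\<^sub>R m N) \<le> w N * (K + C * real (Suc N) powr (s / 2))"
        by (simp add: w_def mult_left_mono)
      also have "\<dots> = K * w N + C * (real (Suc N) powr (s / 2) * w N)" by (simp add: algebra_simps)
      also have "real (Suc N) powr (s / 2) * w N = h N" unfolding w_def h_def powr_add[symmetric] by simp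
      finally show "norm (w N *\<^sub>R m N) \<le> K * w N + C * h N" .
    qed
  qed
  ultimately have "(\<lambda>N. w N *\<^sub>R m N + (\<Sum>n<N. (w n - w (Suc n)) *\<^sub>R m (Suc n))) \<longlonglongrightarrow> 0 + F" by (intro tendsto_add)
  hence "(\<lambda>N. \<Sum>n<N. w n *\<^sub>R f (Suc n)) \<longlonglongrightarrow> F"
    unfolding m_def by (subst sum_by_parts) simp
  hence "(\<lambda>x. \<Sum>n=1..x. of_real (real n powr -s) * f n) \<longlonglongrightarrow> F"
    by (simp add: sum.atLeast1_atMost_eq w_def scaleR_conv_of_real)
  moreover have "norm F \<le> K + 2 * C"
    unfolding F_def val[symmetric] by (rule norm_suminf_le[OF le sm])
  hence "norm F \<le> K + 2 * \<epsilon> * (2 * D / s) powr D" by (simp add: C_def mult.assoc)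
  ultimately show ?thesis by (rule that)
qed

lemma completely_multiplicative_powr:
  "completely_multiplicative f \<Longrightarrow> completely_multiplicative (\<lambda>n. of_real (real n powr -s) * f n)"
  by (auto simp: completely_multiplicative_def powr_mult)

text \<open>The factor has a simple zero with slope \<open>ln p\<close> if \<open>z = 1\<close>, and
  the value \<open>1 - z\<close> otherwise.\<close>

lemma tendsto_local_factor_at_0:
  assumes p: "prime (p::nat)"
  shows "\<exists>l. l \<noteq> 0 \<and> ((\<lambda>s. (1 - of_real (real p powr -s) * z) / of_real (if z = 1 then s else 1)) \<longlongrightarrow> (l::complex)) (at_right (0::real))"
proof (cases "z = 1")
  case True
  have p1: "real p > 1" using prime_gt_1_nat[OF p] by simp
  have "((\<lambda>s. complex_of_real ((1 - real p powr -s) / s)) \<longlongrightarrow> of_real (ln p)) (at_right 0)"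
    using p1 by (intro tendsto_of_real tendsto_powr_minus_1_over) auto
  thus ?thesis using True p1 by (intro exI[of _ "of_real (ln p)"]) auto
next
  case False
  have p1: "real p > 0" using prime_gt_0_nat[OF p] by simp
  have "((\<lambda>s. 1 - of_real (real p powr -s) * z) \<longlongrightarrow> 1 - of_real 1 * z) (at_right 0)"
    by (intro tendsto_intros tendsto_powr_minus_0 p1)
  thus ?thesis using False by (intro exI[of _ "1 - z"]) auto
qed

lemma tendsto_local_factors_at_0:
  fixes z :: "nat \<Rightarrow> complex"
  assumes S: "finite S" "\<forall>p\<in>S. prime p"
  shows "\<exists>l. l \<noteq> 0 \<and> ((\<lambda>s. (\<Prod>p\<in>S. 1 - of_real (real p powr -s) * z p) / of_real (s ^ card {p\<in>S. z p = 1})) \<longlongrightarrow> l) (at_right (0::real))"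
proof -
  have "\<forall>p\<in>S. \<exists>l. l \<noteq> 0 \<and> ((\<lambda>s. (1 - of_real (real p powr -s) * z p) / of_real (if z p = 1 then s else 1)) \<longlongrightarrow> (l::complex)) (at_right (0::real))"
    using tendsto_local_factor_at_0 S by blast
  from bchoice[OF this] obtain l where l: "\<forall>p\<in>S. l p \<noteq> 0 \<and> 
    ((\<lambda>s. (1 - of_real (real p powr -s) * z p) / of_real (if z p = 1 then s else 1)) \<longlongrightarrow> (l p::complex)) (at_right (0::real))" ..
  have "((\<lambda>s. \<Prod>p\<in>S. (1 - of_real (real p powr -s) * z p) / of_real (if z p = 1 then s else 1)) \<longlongrightarrow> (\<Prod>p\<in>S. l p)) (at_right 0)"
    using l by (intro tendsto_prod) auto
  moreover have "(\<Prod>p\<in>S. complex_of_real (if z p = 1 then s else 1)) = of_real (s ^ card {p\<in>S. z p = 1})" for s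
    using S(1) by (simp add: prod.If_cases if_distrib[of complex_of_real] Int_def cong: if_cong)
  ultimately have "((\<lambda>s. (\<Prod>p\<in>S. 1 - of_real (real p powr -s) * z p) / of_real (s ^ card {p\<in>S. z p = 1})) \<longlongrightarrow> (\<Prod>p\<in>S. l p)) (at_right (0::real))"
    by (simp add: prod_dividef)
  moreover have "(\<Prod>p\<in>S. l p) \<noteq> 0" using l S by simp
  ultimately show ?thesis by blast
qed

lemma eventually_le_imp_bound:
  fixes g :: "nat \<Rightarrow> complex" and h :: "nat \<Rightarrow> real"
  assumes ev: "\<forall>\<^sub>F n in sequentially. norm (g n) \<le> h n" and h: "\<And>n. h n \<ge> 0"
  obtains K where "K \<ge> 0" "\<And>n. norm (g n) \<le> K + h n"
proof -
  obtain n0 where n0: "\<And>n. n \<ge> n0 \<Longrightarrow> norm (g n) \<le> h n" using ev by (auto simp: eventually_sequentially)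
  show ?thesis
  proof (rule that[of "\<Sum>n<n0. norm (g n)"])
    show "norm (g n) \<le> (\<Sum>n<n0. norm (g n)) + h n" for n
    proof (cases "n < n0")
      case True
      hence "norm (g n) \<le> (\<Sum>n<n0. norm (g n))" by (intro member_le_sum) auto
      thus ?thesis using h[of n] by simp
    next
      case False
      thus ?thesis using n0[of n] sum_nonneg[of "{..<n0}" "\<lambda>n. norm (g n)"] by simp
    qed
  qed (simp add: sum_nonneg)
qed

context primitive_nonprincipal_dchar
begin

text \<open>Sieving both series by \<open>S\<close> leaves the same terms, so
  \<open>Pf * F = Pc * L\<close> for every \<open>s > 0\<close>. Here \<open>Pf\<close> vanishes to
  order \<open>a\<close> and \<open>Pc * L\<close> to order \<open>b + j = a - N\<close>, so
  \<open>s^N * F\<close> has a nonzero limit; smallness bounds it by any multiple of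
  \<open>\<epsilon>\<close>-size, as \<open>K * s^N\<close> tends to 0.\<close>

lemma partial_sums_omega_order:
  fixes f :: "nat \<Rightarrow> complex"
  assumes S: "finite S" "\<forall>p\<in>S. prime p"
    and f: "completely_multiplicative f"
    and f_out: "\<forall>p. prime p \<and> p \<notin> S \<longrightarrow> f p = chi (int p)"
    and N: "N \<ge> 1" "card {p\<in>S. f p = 1} = card {p\<in>S. chi (int p) = 1} + (if chi (- 1) = - 1 then 0 else 1) + N"
    and small: "\<And>\<epsilon>. \<epsilon> > 0 \<Longrightarrow> \<forall>\<^sub>F n in sequentially. norm (\<Sum>k=1..n. f k) \<le> \<epsilon> * ln (real n) powr real N"
  shows False
proof -
  define j :: nat where "j = (if chi (- 1) = - 1 then 0 else 1)"
  define a where "a = card {p\<in>S. f p = 1}"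
  define b where "b = card {p\<in>S. chi (int p) = 1}"
  define Pf where "Pf s = (\<Prod>p\<in>S. 1 - of_real (real p powr -s) * f p)" for s
  define Pc where "Pc s = (\<Prod>p\<in>S. 1 - of_real (real p powr -s) * chi (int p))" for s
  obtain lf where lf: "lf \<noteq> 0" "((\<lambda>s. Pf s / of_real (s ^ a)) \<longlongrightarrow> lf) (at_right (0::real))"
    using tendsto_local_factors_at_0[OF S, of f] unfolding Pf_def a_def by blast
  obtain lc where lc: "lc \<noteq> 0" "((\<lambda>s. Pc s / of_real (s ^ b)) \<longlongrightarrow> lc) (at_right (0::real))"
    using tendsto_local_factors_at_0[OF S, of "\<lambda>p. chi (int p)"] unfolding Pc_def b_def by blast
  obtain l where l: "l \<noteq> 0" "((\<lambda>s. L s / of_real (s ^ j)) \<longlongrightarrow> l) (at_right 0)"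
    using L_vanishing_order unfolding j_def by blast
  have pos: "\<forall>\<^sub>F s in at_right (0::real). s > 0" by (simp add: eventually_at_right_less)
  have key: "norm (L s / of_real (s ^ j)) * norm (Pc s / of_real (s ^ b)) \<le> (K * s ^ N + 2 * \<epsilon> * (2 * real N) ^ N) * norm (Pf s / of_real (s ^ a))"
    if s: "s > 0" and K: "K \<ge> 0" "\<epsilon> \<ge> 0" "\<And>n. n \<ge> 1 \<Longrightarrow> norm (\<Sum>k=1..n. f k) \<le> K + \<epsilon> * ln (real n) powr real N" for s K \<epsilon>
  proof -
    have "real N > 0" using N by simp
    from dirichlet_series_of_small_sums[OF this K(1,2) s K(3)]
    obtain F where F: "(\<lambda>x. \<Sum>n=1..x. of_real (real n powr -s) * f n) \<longlonglongrightarrow> F" "norm F \<le> K + 2 * \<epsilon> * (2 * real N / s) powr real N"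
      by blast
    have "(\<lambda>x. \<Sum>n=1..x. of_real (real n powr -s) * chi (int n)) \<longlonglongrightarrow> L s"
      using summable_LIMSEQ[OF summable_L[OF s]] by (simp add: L_def sum.atLeast1_atMost_eq scaleR_conv_of_real)
    from tendsto_sum_not_dvd_primes[OF completely_multiplicative_powr[OF completely_multiplicative_chi] this S]
    have lim1: "(\<lambda>x. \<Sum>n=1..x. if \<exists>p\<in>S. p dvd n then 0 else of_real (real n powr -s) * chi (int n)) \<longlonglongrightarrow> Pc s * L s"
      by (simp add: Pc_def)
    from tendsto_sum_not_dvd_primes[OF completely_multiplicative_powr[OF f] F(1) S]
    have lim2: "(\<lambda>x. \<Sum>n=1..x. if \<exists>p\<in>S. p dvd n then 0 else of_real (real n powr -s) * f n) \<longlonglongrightarrow> Pf s * F"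
      by (simp add: Pf_def)
    have same: "(\<Sum>n=1..x. if \<exists>p\<in>S. p dvd n then 0 else of_real (real n powr -s) * f n) = 
       (\<Sum>n=1..x. if \<exists>p\<in>S. p dvd n then 0 else of_real (real n powr -s) * chi (int n))" for x
    proof (rule sum.cong[OF refl])
      fix n assume n: "n \<in> {1..x}"
      show "(if \<exists>p\<in>S. p dvd n then 0 else of_real (real n powr -s) * f n) = 
        (if \<exists>p\<in>S. p dvd n then 0 else of_real (real n powr -s) * chi (int n))"
      proof (cases "\<exists>p\<in>S. p dvd n")
        case False
        from completely_multiplicative_eqI[OF f completely_multiplicative_chi] have "f n = chi (int n)"
          using False f_out n by (metis atLeastAtMost_iff less_eq_Suc_le One_nat_def)
        thus ?thesis by simp
      qed simp
    qed
    have eq: "Pf s * F = Pc s * L s" by (rule LIMSEQ_unique[OF lim2[unfolded same] lim1])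
    have "norm F * s ^ N \<le> (K + 2 * \<epsilon> * (2 * real N / s) powr real N) * s ^ N"
      using F(2) s by (intro mult_right_mono) auto
    also have "(2 * real N / s) powr real N = (2 * real N) ^ N / s ^ N"
      using s N by (simp add: powr_realpow power_divide)
    also have "(K + 2 * \<epsilon> * ((2 * real N) ^ N / s ^ N)) * s ^ N = K * s ^ N + 2 * \<epsilon> * (2 * real N) ^ N"
      using s by (simp add: field_simps)
    finally have Fb: "norm F * s ^ N \<le> K * s ^ N + 2 * \<epsilon> * (2 * real N) ^ N" .
    have "a = b + j + N" using N by (simp add: a_def b_def j_def)
    hence sa: "s ^ a = s ^ b * s ^ j * s ^ N" by (simp add: power_add)
    have "norm (L s / of_real (s ^ j)) * norm (Pc s / of_real (s ^ b)) = norm (Pc s * L s) / (s ^ b * s ^ j)"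
      using s by (simp add: norm_mult norm_divide norm_power mult.commute)
    also have "\<dots> = norm F * s ^ N * norm (Pf s / of_real (s ^ a))"
      unfolding eq[symmetric] sa using s by (simp add: norm_mult norm_divide norm_power)
    also have "\<dots> \<le> (K * s ^ N + 2 * \<epsilon> * (2 * real N) ^ N) * norm (Pf s / of_real (s ^ a))"
      by (rule mult_right_mono[OF Fb]) simp
    finally show ?thesis .
  qed
  have lim_le: "norm l * norm lc \<le> 2 * \<epsilon> * (2 * real N) ^ N * norm lf" if eps: "\<epsilon> > 0" for \<epsilon>
  proof -
    have "\<epsilon> * ln (real n) powr real N \<ge> 0" for n using eps by simp
    from eventually_le_imp_bound[OF small[OF eps] this]
    obtain K where K: "K \<ge> 0" "\<And>n. norm (\<Sum>k=1..n. f k) \<le> K + \<epsilon> * ln (real n) powr real N" by blast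
    show ?thesis
    proof (rule tendsto_le)
      show "((\<lambda>s. norm (L s / of_real (s ^ j)) * norm (Pc s / of_real (s ^ b))) \<longlongrightarrow> norm l * norm lc) (at_right 0)"
        by (intro tendsto_intros l lc)
      have "((\<lambda>s. (K * s ^ N + 2 * \<epsilon> * (2 * real N) ^ N) * norm (Pf s / of_real (s ^ a))) \<longlongrightarrow> 
         (K * 0 ^ N + 2 * \<epsilon> * (2 * real N) ^ N) * norm lf) (at_right 0)"
        by (intro tendsto_intros lf)
      thus "((\<lambda>s. (K * s ^ N + 2 * \<epsilon> * (2 * real N) ^ N) * norm (Pf s / of_real (s ^ a))) \<longlongrightarrow> 
         2 * \<epsilon> * (2 * real N) ^ N * norm lf) (at_right 0)" using N by (simp add: power_0_left)
      show "\<forall>\<^sub>F s in at_right 0. norm (L s / of_real (s ^ j)) * norm (Pc s / of_real (s ^ b)) \<le> 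
          (K * s ^ N + 2 * \<epsilon> * (2 * real N) ^ N) * norm (Pf s / of_real (s ^ a))"
        using pos by eventually_elim (use key K eps in auto)
    qed simp
  qed
  have "((\<lambda>\<epsilon>. 2 * \<epsilon> * (2 * real N) ^ N * norm lf) \<longlongrightarrow> 2 * 0 * (2 * real N) ^ N * norm lf) (at_right 0)"
    by (intro tendsto_intros)
  moreover have "\<forall>\<^sub>F \<epsilon> in at_right 0. norm l * norm lc \<le> 2 * \<epsilon> * (2 * real N) ^ N * norm lf"
    using pos by eventually_elim (rule lim_le)
  ultimately have "norm l * norm lc \<le> 2 * 0 * (2 * real N) ^ N * norm lf"
    by (rule tendsto_lowerbound) simp
  hence "norm l * norm lc \<le> 0" by simp
  thus False using l lc by (simp add: mult_le_0_iff)
qed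

end

lemma partial_sums_omega_principal:
  fixes f :: "nat \<Rightarrow> complex"
  assumes S: "finite S" "\<forall>p\<in>S. prime p"
    and f: "completely_multiplicative f"
    and f_out: "\<forall>p. prime p \<and> p \<notin> S \<longrightarrow> f p = 1"
    and D: "D > 0"
    and small: "\<forall>\<^sub>F n in sequentially. norm (\<Sum>k=1..n. f k) \<le> ln (real n) powr D"
  shows False
proof -
  obtain K where K: "K \<ge> 0" "\<And>n. norm (\<Sum>k=1..n. f k) \<le> K + 1 * ln (real n) powr D"
    using eventually_le_imp_bound[OF small] by auto
  obtain F where F: "(\<lambda>x. \<Sum>n=1..x. of_real (real n powr -1) * f n) \<longlonglongrightarrow> F"
    using dirichlet_series_of_small_sums[OF D K(1) _ _ K(2), of 1] by auto
  define g where "g n = (if \<exists>p\<in>S. p dvd n then 0 else 1 / real n)" for n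
  have one_cm: "completely_multiplicative (\<lambda>_. 1)" by (simp add: completely_multiplicative_def)
  have g: "complex_of_real (g n) = (if \<exists>p\<in>S. p dvd n then 0 else of_real (real n powr -1) * f n)" if "n > 0" for n
  proof (cases "\<exists>p\<in>S. p dvd n")
    case False
    have "f n = 1" by (rule completely_multiplicative_eqI[OF f one_cm]) (use False f_out that in auto)
    thus ?thesis using False that by (simp add: g_def powr_minus divide_inverse)
  qed (simp add: g_def)
  have "(\<lambda>x. \<Sum>n=1..x. if \<exists>p\<in>S. p dvd n then 0 else of_real (real n powr -1) * f n) \<longlonglongrightarrow> (\<Prod>p\<in>S. 1 - of_real (real p powr -1) * f p) * F"
    by (rule tendsto_sum_not_dvd_primes[OF completely_multiplicative_powr[OF f] F S])
  also have "(\<lambda>x. \<Sum>n=1..x. if \<exists>p\<in>S. p dvd n then 0 else of_real (real n powr -1) * f n) = (\<lambda>x. complex_of_real (\<Sum>n=1..x. g n))"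
    unfolding of_real_sum by (intro ext sum.cong refl) (simp add: g)
  finally have "convergent (\<lambda>x. complex_of_real (\<Sum>n=1..x. g n))" by (auto simp: convergent_def)
  hence "Bseq (\<lambda>x. complex_of_real (\<Sum>n=1..x. g n))" by (rule convergent_imp_Bseq)
  then obtain B where B: "\<And>x. norm (complex_of_real (\<Sum>n=1..x. g n)) \<le> B" by (auto simp: Bseq_def)
  \<comment> \<open>The numbers \<open>j * P + 1\<close> have no prime factor in \<open>S\<close>,
    and \<open>j * P + 1 <= P * (j + 1)\<close> lets their reciprocals dominate the harmonic series
    up to the factor \<open>P\<close>.\<close>
  define P where "P = (\<Prod>p\<in>S. p)"
  have P: "P > 0" using S by (auto simp: P_def prime_gt_0_nat intro!: prod_pos)
  have "(\<Sum>j<J. 1 / real (Suc j)) \<le> real P * B" for J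
  proof -
    have inj: "inj_on (\<lambda>j. Suc (j * P)) {..<J}" using P by (auto intro: inj_onI)
    have "(\<Sum>j<J. 1 / real (Suc j)) \<le> (\<Sum>j<J. real P * g (Suc (j * P)))"
    proof (rule sum_mono)
      fix j
      have "\<not> p dvd Suc (j * P)" if p: "p \<in> S" for p
      proof
        assume "p dvd Suc (j * P)"
        moreover have "p dvd j * P" unfolding P_def using p S by (intro dvd_mult dvd_prodI) auto
        ultimately have "p dvd 1" by (metis One_nat_def Suc_eq_plus1 dvd_add_right_iff)
        thus False using p S by (auto dest: prime_gt_1_nat)
      qed
      hence "g (Suc (j * P)) = 1 / real (Suc (j * P))" by (auto simp: g_def)
      moreover have "real (Suc (j * P)) \<le> real (P * Suc j)" using P by (intro of_nat_mono) simp
      hence "real (Suc (j * P)) \<le> real P * real (Suc j)" by (simp only: of_nat_mult)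
      hence "1 / real (Suc j) \<le> real P * (1 / real (Suc (j * P)))"
        using P by (simp add: divide_simps del: of_nat_Suc)
      ultimately show "1 / real (Suc j) \<le> real P * g (Suc (j * P))" by simp
    qed
    also have "\<dots> = real P * (\<Sum>n\<in>(\<lambda>j. Suc (j * P)) ` {..<J}. g n)"
      by (simp add: sum.reindex[OF inj] sum_distrib_left)
    also have "\<dots> \<le> real P * (\<Sum>n=1..Suc (J * P). g n)"
      by (intro mult_left_mono sum_mono2) (auto simp: g_def)
    also have "\<dots> \<le> real P * B" using B[of "Suc (J * P)"] unfolding norm_of_real by (intro mult_left_mono) auto
    finally show ?thesis .
  qed
  moreover have "(\<Sum>j<J. 1 / real (Suc j)) = (\<Sum>j<J. norm (1 / real (Suc j)))" for J by simp
  ultimately have "summable (\<lambda>j. 1 / real (Suc j))" by (intro summableI_nonneg_bounded) auto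
  thus False using not_summable_harmonic[where 'a = real] summable_Suc_iff[of "\<lambda>n. inverse (real n)"]
    by (simp add: inverse_eq_divide del: of_nat_Suc)
qed

section \<open>A single modified prime\<close>

text \<open>By compactness the balls around finitely many powers \<open>z^j\<close> with
  \<open>j <= W\<close> cover all powers. If \<open>z^(n+W)\<close> is near \<open>z^j\<close>, then
  \<open>z^(n+W-j)\<close> is near 1.\<close>

lemma power_near_1_recurrent:
  fixes z :: complex
  assumes z: "norm z = 1"
  obtains W where "\<And>n. \<exists>e. n \<le> e \<and> e \<le> n + W \<and> norm (z ^ e - 1) < 1 / 2"
proof -
  define T where "T = range (\<lambda>n. z ^ n)"
  have "bounded T" unfolding T_def bounded_iff using z by (intro exI[of _ 1]) (auto simp: norm_power)
  hence "compact (closure T)" by (simp add: compact_closure)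
  moreover have "closure T \<subseteq> (\<Union>n. ball (z ^ n) (1 / 2))"
  proof
    fix x assume "x \<in> closure T"
    then obtain y where "y \<in> T" "dist y x < 1 / 2" using closure_approachable[of x T] by (metis half_gt_zero zero_less_one)
    thus "x \<in> (\<Union>n. ball (z ^ n) (1 / 2))" by (auto simp: T_def)
  qed
  ultimately obtain I where I: "finite I" "closure T \<subseteq> (\<Union>n\<in>I. ball (z ^ n) (1 / 2))"
    using compactE_image[of "closure T" UNIV "\<lambda>n. ball (z ^ n) (1 / 2)"] by (metis open_ball subset_UNIV)
  define W where "W = Max (insert 0 I)"
  show ?thesis
  proof (rule that[of W])
    fix n
    have "z ^ (n + W) \<in> T" by (simp add: T_def)
    hence "z ^ (n + W) \<in> closure T" by (rule closure_subset[THEN subsetD])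
    then obtain j where j: "j \<in> I" "dist (z ^ j) (z ^ (n + W)) < 1 / 2" using I by auto
    have "j \<le> W" unfolding W_def using I j by (intro Max_ge) auto
    have "z ^ (n + W) - z ^ j = z ^ j * (z ^ (n + W - j) - 1)"
      using \<open>j \<le> W\<close> by (simp add: right_diff_distrib flip: power_add)
    hence "norm (z ^ (n + W) - z ^ j) = norm (z ^ (n + W - j) - 1)" using z by (simp add: norm_mult norm_power)
    hence "norm (z ^ (n + W - j) - 1) < 1 / 2" using j(2) by (simp add: dist_norm norm_minus_commute)
    thus "\<exists>e. n \<le> e \<and> e \<le> n + W \<and> norm (z ^ e - 1) < 1 / 2"
      using \<open>j \<le> W\<close> by (intro exI[of _ "n + W - j"]) auto
  qed
qed

context primitive_nonprincipal_dchar
begin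

lemma sum_chi_multiple: "(\<Sum>n=1..k * q. chi (int n)) = 0"
proof (induction k)
  case (Suc k)
  thus ?case using sum_chi_Suc_periodic[of "k * q"] by (simp add: sum.atLeast1_atMost_eq add.commute)
qed simp

context
  fixes f :: "nat \<Rightarrow> complex" and p :: nat
  assumes f: "completely_multiplicative f" and p: "prime p"
    and f_out: "\<forall>r. prime r \<and> r \<noteq> p \<longrightarrow> f r = chi (int r)"
    and f_in: "f p \<noteq> chi (int p)" "norm (f p) = 1"
begin

lemma f_coprime: "n > 0 \<Longrightarrow> \<not> p dvd n \<Longrightarrow> f n = chi (int n)"
proof -
  assume n: "n > 0" "\<not> p dvd n"
  from completely_multiplicative_eqI[OF f completely_multiplicative_chi] show ?thesis using n f_out by blast
qed

text \<open>The difference of the two sides is the sum over the \<open>n\<close> prime to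
  \<open>p\<close>, where \<open>f = chi\<close>; its two parts run over whole periods of
  \<open>chi\<close> and vanish.\<close>

lemma sum_mult_prime:
  assumes "q dvd y"
  shows "(\<Sum>n=1..p * y. f n) = f p * (\<Sum>n=1..y. f n)"
proof -
  have p0: "p > 0" using p by (simp add: prime_gt_0_nat)
  obtain k where k: "y = k * q" using assms by (metis dvd_def mult.commute)
  have zero: "(\<Sum>n=1..y. chi (int n)) = 0" "(\<Sum>n=1..p * y. chi (int n)) = 0"
    using sum_chi_multiple[of k] sum_chi_multiple[of "p * k"] by (simp_all only: k mult.assoc)
  have "(\<Sum>n=1..p * y. f n) - f p * (\<Sum>n=1..y. f n) = (\<Sum>n=1..p * y. if p dvd n then 0 else f n)"
    using sum_not_dvd_prime_powers_insert[OF f p, of "{}" 1 "p * y"] p0 by simp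
  also have "\<dots> = (\<Sum>n=1..p * y. if p dvd n then 0 else chi (int n))"
    by (intro sum.cong) (auto simp: f_coprime)
  also have "\<dots> = (\<Sum>n=1..p * y. chi (int n)) - chi (int p) * (\<Sum>n=1..y. chi (int n))"
    using sum_not_dvd_prime_powers_insert[OF completely_multiplicative_chi p, of "{}" 1 "p * y"] p0 by simp
  finally show ?thesis using zero by simp
qed

lemma sum_mult_prime_power:
  assumes "q dvd y"
  shows "(\<Sum>n=1..p ^ e * y. f n) = f p ^ e * (\<Sum>n=1..y. f n)"
proof (induction e)
  case (Suc e)
  have "q dvd p ^ e * y" using assms by simp
  from sum_mult_prime[OF this] show ?case using Suc by (simp add: mult.assoc)
qed simp

text \<open>As \<open>n < p^A\<close>, its \<open>p\<close>-adic valuation \<open>v\<close> is below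
  \<open>A\<close>. So adding \<open>x\<close> keeps \<open>v\<close> and changes the cofactor
  \<open>n / p^v\<close> by a multiple of both \<open>q\<close> and \<open>p\<close>, which
  \<open>chi\<close> does not notice.\<close>

lemma f_shift:
  assumes x: "q * p ^ A dvd x" and n: "0 < n" "n < p ^ A"
  shows "f (x + n) = f n"
proof -
  have "n \<noteq> 0" "\<not> is_unit p" using n p by auto
  define v where "v = multiplicity p n"
  obtain m where m: "n = p ^ v * m" "\<not> p dvd m"
    using multiplicity_decompose'[OF \<open>n \<noteq> 0\<close> \<open>\<not> is_unit p\<close>] unfolding v_def by metis
  have m0: "m > 0" using m n by (cases m) auto
  have p0: "p > 1" using p by (rule prime_gt_1_nat)
  have "p ^ v \<le> n" using m m0 by simp
  hence "p ^ v < p ^ A" using n by simp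
  hence vA: "v < A" using p0 by (simp add: power_strict_increasing_iff)
  obtain x' where x': "x = q * p ^ A * x'" using x by (auto elim: dvdE)
  define u where "u = p ^ (A - v) * x'"
  have xu: "x = p ^ v * (q * u)" using vA by (simp add: x' u_def mult_ac flip: power_add)
  have "p dvd u" using vA by (simp add: u_def)
  hence nd: "\<not> p dvd q * u + m" using m(2) by (simp add: dvd_add_right_iff)
  have "f (x + n) = f p ^ v * f (q * u + m)"
    using m0 p0 f by (simp add: xu m(1) completely_multiplicative_mult completely_multiplicative_power flip: distrib_left)
  also have "f (q * u + m) = chi (int m)"
    using f_coprime[OF _ nd] chi_add_mult_nat[of "int m" u] m0 by (simp add: algebra_simps)
  also have "\<dots> = f m" using f_coprime[OF m0 m(2)] by simp
  also have "f p ^ v * f m = f n"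
    using m0 p0 f by (simp add: m(1) completely_multiplicative_mult completely_multiplicative_power)
  finally show ?thesis .
qed

lemma sum_add_block:
  assumes x: "q * p ^ A dvd x" and y: "y < p ^ A"
  shows "(\<Sum>n=1..x + y. f n) = (\<Sum>n=1..x. f n) + (\<Sum>n=1..y. f n)"
proof -
  have "(\<Sum>n=1..x + y. f n) = (\<Sum>n=1..x. f n) + (\<Sum>n=x + 1..x + y. f n)"
    by (rule sum.ub_add_nat) simp
  also have "(\<Sum>n=x + 1..x + y. f n) = (\<Sum>n=1..y. f (x + n))"
    using sum.shift_bounds_cl_nat_ivl[of f 1 x y] by (simp add: add.commute)
  also have "\<dots> = (\<Sum>n=1..y. f n)"
    using y by (intro sum.cong refl f_shift[OF x]) auto
  finally show ?thesis .
qed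

text \<open>If all sums over multiples of \<open>q\<close> vanished, every partial sum would be at
  most \<open>q\<close>, against the unbounded growth found for \<open>S = {p}\<close>.\<close>

lemma exists_sum_multiple_nonzero: "\<exists>t. (\<Sum>n=1..q * t. f n) \<noteq> 0"
proof (rule ccontr)
  assume neg: "\<not> ?thesis"
  have le1: "norm (f n) \<le> 1" if "n > 0" for n
  proof (rule completely_multiplicative_le_1[OF f _ that])
    fix r :: nat assume "prime r"
    thus "norm (f r) \<le> 1" using f_out f_in norm_chi_le by (cases "r = p") auto
  qed
  have bounded: "norm (\<Sum>n=1..y. f n) \<le> real q" for y
  proof -
    have "(\<Sum>n=1..y. f n) = (\<Sum>n=1..q * (y div q). f n) + (\<Sum>n=q * (y div q) + 1..y. f n)"
      using sum.ub_add_nat[of 1 "q * (y div q)" f "y mod q"] by simp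
    also have "(\<Sum>n=1..q * (y div q). f n) = 0" using neg by blast
    finally have "norm (\<Sum>n=1..y. f n) \<le> (\<Sum>n=q * (y div q) + 1..y. norm (f n))" by (simp add: norm_sum)
    also have "\<dots> \<le> (\<Sum>n=q * (y div q) + 1..y. 1)" using le1 by (intro sum_mono) auto
    also have "\<dots> = real (y - q * (y div q))" by simp
    also have "y - q * (y div q) = y mod q" by (simp add: minus_mult_div_eq_mod)
    also have "real (y mod q) \<le> real q" using q_pos by (simp add: less_imp_le)
    finally show ?thesis .
  qed
  obtain c A where c: "c > 0" and ev: "\<forall>\<^sub>F H in sequentially. \<exists>y\<ge>1. ln (real y) \<le> A * real H \<and> 
      c * real H powr (real (card {p}) / 2) \<le> norm (\<Sum>n=1..y. f n)"
  proof -
    have "\<forall>r\<in>{p}. prime r" "\<forall>r. prime r \<and> r \<notin> {p} \<longrightarrow> f r = chi (int r)"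
      "\<forall>r\<in>{p}. f r \<noteq> chi (int r) \<and> norm (f r) = 1" using p f_out f_in by auto
    from partial_sums_lower_bound[OF q_gt_1 _ this(1) f this(2,3)] show ?thesis using that by blast
  qed
  have "filterlim (\<lambda>H. c * real H powr (1 / 2)) at_top sequentially" using c by real_asymp
  hence "\<forall>\<^sub>F H in sequentially. c * real H powr (1 / 2) > real q" by (simp add: filterlim_at_top_dense)
  with ev have "\<forall>\<^sub>F H :: nat in sequentially. False"
  proof eventually_elim
    case (elim H)
    then obtain y where "c * real H powr (real (card {p}) / 2) \<le> norm (\<Sum>n=1..y. f n)" by blast
    hence "c * real H powr (1 / 2) \<le> norm (\<Sum>n=1..y. f n)" by simp
    thus False using bounded[of y] elim(2) by linarith
  qed
  thus False by simp
qed

lemma partial_sums_omega_one_prime: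
  assumes small: "\<And>\<epsilon>. \<epsilon> > 0 \<Longrightarrow> \<forall>\<^sub>F n in sequentially. norm (\<Sum>k=1..n. f k) \<le> \<epsilon> * ln (real n)"
  shows False
proof -
  define M where "M y = (\<Sum>n=1..y. f n)" for y
  have p1: "p > 1" using p by (rule prime_gt_1_nat)
  hence lnp: "ln (real p) > 0" by simp
  obtain t where t: "M (q * t) \<noteq> 0" using exists_sum_multiple_nonzero unfolding M_def by blast
  define y where "y = q * t"
  have y0: "M y \<noteq> 0" "y > 0" "q dvd y" using t by (auto simp: y_def M_def intro: gr0I)
  obtain W where W: "\<And>n. \<exists>e. n \<le> e \<and> e \<le> n + W \<and> norm (f p ^ e - 1) < 1 / 2"
    using power_near_1_recurrent[OF f_in(2)] by blast
  \<comment> \<open>\<open>p^C >= y + 1\<close> is the room one block needs: with exponents at least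
    \<open>C\<close> apart, the smaller blocks add up to less than the next \<open>p^e\<close>. The
    window \<open>W\<close> accounts for the freedom in choosing \<open>e\<close>.\<close>
  define C where "C = Suc y"
  have C: "Suc y \<le> p ^ C" using p1 less_exp[of C] power_mono[of 2 p C] by (simp add: C_def)
  define R where "R = W + C"
  obtain e where e: "\<And>i. i * R \<le> e i" "\<And>i. e i \<le> i * R + W" "\<And>i. norm (f p ^ e i - 1) < 1 / 2"
  proof -
    have "\<forall>i. \<exists>e. i * R \<le> e \<and> e \<le> i * R + W \<and> norm (f p ^ e - 1) < 1 / 2" using W by blast
    from choice[OF this] show ?thesis using that by blast
  qed
  define x where "x I = (\<Sum>i<I. p ^ e i * y)" for I
  have x_less: "x I < p ^ (I * R)" for I
  proof (induction I)
    case (Suc I)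
    have "x (Suc I) = x I + p ^ e I * y" by (simp add: x_def)
    also have "\<dots> < p ^ (I * R) + p ^ e I * y" using Suc by simp
    also have "p ^ (I * R) \<le> p ^ e I" using e(1) p1 by (intro power_increasing) auto
    also have "p ^ e I + p ^ e I * y = p ^ e I * Suc y" by simp
    also have "\<dots> \<le> p ^ e I * p ^ C" by (rule mult_le_mono2[OF C])
    also have "\<dots> \<le> p ^ (Suc I * R)"
      unfolding power_add[symmetric] using e(2)[of I] p1 by (intro power_increasing) (auto simp: R_def)
    finally show ?case by simp
  qed (use p1 in \<open>simp add: x_def\<close>)
  have Mx: "M (x I) = (\<Sum>i<I. f p ^ e i) * M y" for I
  proof (induction I)
    case (Suc I)
    have "q * p ^ e I dvd p ^ e I * y" using y0(3) by (simp add: mult.commute[of q] mult_dvd_mono)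
    moreover have "p ^ (I * R) \<le> p ^ e I" using e(1) p1 by (intro power_increasing) auto
    hence "x I < p ^ e I" by (rule order.strict_trans2[OF x_less])
    ultimately have "M (p ^ e I * y + x I) = M (p ^ e I * y) + M (x I)"
      unfolding M_def by (rule sum_add_block)
    moreover have "M (p ^ e I * y) = f p ^ e I * M y" unfolding M_def by (rule sum_mult_prime_power[OF y0(3)])
    moreover have "x (Suc I) = p ^ e I * y + x I" by (simp add: x_def)
    ultimately show ?case using Suc by (simp add: algebra_simps)
  qed (simp add: x_def M_def)
  have lower: "real I / 2 * norm (M y) \<le> norm (M (x I))" for I
  proof -
    have "real I / 2 = (\<Sum>i<I. 1 / 2)" by simp
    \<comment> \<open>Powers within \<open>1/2\<close> of 1 have real part at least
      \<open>1/2\<close>, so they cannot cancel.\<close>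
    also have "\<dots> \<le> (\<Sum>i<I. Re (f p ^ e i))"
    proof (rule sum_mono)
      fix i
      have "\<bar>Re (f p ^ e i - 1)\<bar> < 1 / 2" using e(3)[of i] abs_Re_le_cmod[of "f p ^ e i - 1"] by linarith
      hence "\<bar>Re (f p ^ e i) - 1\<bar> < 1 / 2" by (simp only: minus_complex.sel one_complex.sel)
      thus "1 / 2 \<le> Re (f p ^ e i)" by linarith
    qed
    also have "\<dots> = Re (\<Sum>i<I. f p ^ e i)" by simp
    also have "\<dots> \<le> norm (\<Sum>i<I. f p ^ e i)" by (rule complex_Re_le_cmod)
    finally show ?thesis unfolding Mx norm_mult by (rule mult_right_mono) simp
  qed
  \<comment> \<open>As \<open>ln (x I) <= I * R * ln p\<close>, this makes
    \<open>\<epsilon> * ln (x I)\<close> at most half of the lower bound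
    \<open>I / 2 * norm (M y)\<close>.\<close>
  define \<epsilon> where "\<epsilon> = norm (M y) / (4 * (R * ln (real p)))"
  have R0: "R > 0" by (simp add: R_def C_def)
  have eps: "\<epsilon> > 0" using y0 R0 lnp by (simp add: \<epsilon>_def)
  have nn: "\<epsilon> * ln (real n) \<ge> 0" for n using eps by (cases "n = 0") auto
  from eventually_le_imp_bound[OF small[OF eps] nn]
  obtain K where K: "\<And>n. norm (M n) \<le> K + \<epsilon> * ln (real n)" unfolding M_def by blast
  have upper: "real I / 4 * norm (M y) \<le> K" if I: "I > 0" for I
  proof -
    have "x I > 0" unfolding x_def using I y0 p1 by (intro sum_pos) auto
    moreover have "real (x I) \<le> real (p ^ (I * R))" using x_less[of I] by (simp only: of_nat_le_iff less_imp_le)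
    ultimately have "ln (real (x I)) \<le> ln (real (p ^ (I * R)))"
      by (intro ln_mono) auto
    also have "\<dots> = real I * (R * ln (real p))" using p1 by (simp add: ln_realpow)
    finally have "\<epsilon> * ln (real (x I)) \<le> \<epsilon> * (real I * (R * ln (real p)))" using eps by (intro mult_left_mono) auto
    also have "\<dots> = real I / 4 * norm (M y)" using R0 lnp by (simp add: \<epsilon>_def field_simps)
    finally have "norm (M (x I)) \<le> K + real I / 4 * norm (M y)" using K[of "x I"] by linarith
    thus ?thesis using lower[of I] by (simp add: algebra_simps)
  qed
  obtain I :: nat where I: "real I > \<bar>K\<bar> / (norm (M y) / 4)" using reals_Archimedean2 by blast
  have "real I * (norm (M y) / 4) > \<bar>K\<bar>" using I y0 by (simp add: pos_divide_less_eq)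
  moreover have "I > 0" using I y0 by (metis abs_ge_zero divide_nonneg_nonneg gr0I less_le_not_le norm_ge_zero of_nat_0 zero_le_numeral)
  ultimately show False using upper[of I] by simp
qed

end

section \<open>Combining the lower bounds\<close>

lemma partial_sums_omega_half_card:
  fixes f :: "nat \<Rightarrow> complex"
  assumes S: "finite S" "S \<noteq> {}" "\<forall>p\<in>S. prime p"
    and f: "completely_multiplicative f"
    and f_out: "\<forall>p. prime p \<and> p \<notin> S \<longrightarrow> f p = chi (int p)"
    and f_in: "\<forall>p\<in>S. f p \<noteq> chi (int p) \<and> norm (f p) = 1"
    and D: "D > 0" "D \<le> real (card S) / 2"
    and small: "\<And>\<epsilon>. \<epsilon> > 0 \<Longrightarrow> \<forall>\<^sub>F n in sequentially. norm (\<Sum>k=1..n. f k) \<le> \<epsilon> * ln (real n) powr D"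
  shows False
proof -
  define d where "d = real (card S) / 2"
  have d: "d > 0" "D \<le> d" using S D by (auto simp: d_def card_gt_0_iff)
  obtain c A where c: "c > 0" and A: "A > 0" and ev: "\<forall>\<^sub>F H in sequentially. \<exists>y\<ge>1. ln (real y) \<le> A * real H \<and> 
      c * real H powr d \<le> norm (\<Sum>n=1..y. f n)"
    using partial_sums_lower_bound[OF q_gt_1 S(1,3) f f_out f_in] unfolding d_def by blast
  \<comment> \<open>From \<open>ln y <= A * H\<close> this gives
    \<open>\<epsilon> * (ln y)^D <= c / 2 * H^d\<close>, half of the lower bound; the other half
    outgrows \<open>K\<close>.\<close>
  define \<epsilon> where "\<epsilon> = c / (2 * A powr D)"
  have eps: "\<epsilon> > 0" using c A by (simp add: \<epsilon>_def)
  have nn: "\<epsilon> * ln (real n) powr D \<ge> 0" for n using eps by simp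
  from eventually_le_imp_bound[OF small[OF eps] nn]
  obtain K where K: "\<And>n. norm (\<Sum>k=1..n. f k) \<le> K + \<epsilon> * ln (real n) powr D" by blast
  have "filterlim (\<lambda>H. c / 2 * real H powr d) at_top sequentially" using c d by real_asymp
  hence "\<forall>\<^sub>F H in sequentially. c / 2 * real H powr d > K" by (simp add: filterlim_at_top_dense)
  with ev eventually_ge_at_top[of 1] have "\<forall>\<^sub>F H :: nat in sequentially. False"
  proof eventually_elim
    case (elim H)
    then obtain y where y: "y \<ge> 1" "ln (real y) \<le> A * real H" "c * real H powr d \<le> norm (\<Sum>n=1..y. f n)" by blast
    have "ln (real y) powr D \<le> (A * real H) powr D" using y D by (intro powr_mono2) auto
    also have "\<dots> = A powr D * real H powr D" using A by (simp add: powr_mult)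
    also have "\<dots> \<le> A powr D * real H powr d" using elim d by (intro mult_left_mono powr_mono) auto
    finally have "\<epsilon> * ln (real y) powr D \<le> \<epsilon> * (A powr D * real H powr d)" using eps by (intro mult_left_mono) auto
    also have "\<dots> = c / 2 * real H powr d" using A by (simp add: \<epsilon>_def)
    finally show False using K[of y] y(3) elim by simp
  qed
  thus False by simp
qed

end

theorem theorem1p2:
  fixes chi :: "int \<Rightarrow> complex" and S :: "nat set" and f :: "nat \<Rightarrow> complex"
  assumes chi: "is_primitive_dirichlet_character chi"
    and S: "finite S" "S \<noteq> {}" "\<forall>p\<in>S. prime p"
    and f: "completely_multiplicative f"
    and f_out: "\<forall>p. prime p \<and> p \<notin> S \<longrightarrow> f p = chi (int p)"
    and f_in: "\<forall>p\<in>S. f p \<noteq> chi (int p) \<and> norm (f p) = 1"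
  defines "T \<equiv> int (card {p\<in>S. f p = 1}) - int (card {p\<in>S. chi (int p) = 1})"
  defines "N \<equiv> (if chi (-1) = -1 then max 0 T else max 0 (T - 1))"
  defines "D \<equiv> max 1 (max (real_of_int N) ((real (card S) - 3) / 2))"
  shows "Limsup at_top (\<lambda>x::real. ereal (norm (\<Sum>n\<in>{1..nat \<lfloor>x\<rfloor>}. f n) / (ln x) powr D)) > 0"
proof (rule ccontr)
  assume "\<not> ?thesis"
  hence limsup: "Limsup at_top (\<lambda>x::real. ereal (norm (\<Sum>n\<in>{1..nat \<lfloor>x\<rfloor>}. f n) / (ln x) powr D)) \<le> 0" by simp
  have small: "\<forall>\<^sub>F n in sequentially. norm (\<Sum>k=1..n. f k) \<le> \<epsilon> * ln (real n) powr D" if "\<epsilon> > 0" for \<epsilon>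
  proof -
    have "\<forall>\<^sub>F x::real in at_top. ereal (norm (\<Sum>n\<in>{1..nat \<lfloor>x\<rfloor>}. f n) / (ln x) powr D) < ereal \<epsilon>"
      using limsup that by (intro Limsup_lessD) (simp add: order.strict_trans1)
    \<comment> \<open>For \<open>n >= 2\<close> the logarithm is positive, so the quotient can be
      cleared.\<close>
    from eventually_compose_filterlim[OF this filterlim_real_sequentially] eventually_ge_at_top[of 2]
    show ?thesis
    proof eventually_elim
      case (elim n)
      hence "ln (real n) powr D > 0" by simp
      thus ?case using elim by (simp add: divide_less_eq less_imp_le mult.commute)
    qed
  qed
  have D1: "D \<ge> 1" by (simp add: D_def)
  obtain q where q: "primitive_character q chi" using chi by (auto simp: is_primitive_dirichlet_character_def)
  interpret primitive_dchar q chi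
    by unfold_locales (use q in \<open>simp_all add: primitive_character_def\<close>)
  show False
  proof (cases "q > 1")
    case False
    hence "q = 1" using q_pos by simp
    hence "chi a = 1" for a using chi_cong[of a 1] by (simp add: cong_def)
    thus False using partial_sums_omega_principal[OF S(1,3) f _ _ , of D] f_out small[of 1] D1 by simp
  next
    case True
    interpret primitive_nonprincipal_dchar q chi
      by unfold_locales (rule nonprincipal[OF True])
    \<comment> \<open>\<open>D\<close> is one of 1, \<open>N\<close> and \<open>(|S|-3)/2\<close>.
      The last is below \<open>|S|/2\<close>, as is 1 up to equality once \<open>|S| >= 2\<close>;
      \<open>D >= 1\<close> turns \<open>D = N\<close> into \<open>N >= 1\<close>.\<close>
    consider "D \<le> real (card S) / 2" | "card S = 1" "D = 1" | "N \<ge> 1" "D = real_of_int N"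
    proof -
      have "card S \<ge> 1" using S by (simp add: Suc_le_eq card_gt_0_iff)
      moreover have "D = 1 \<or> D = (real (card S) - 3) / 2 \<or> D = real_of_int N"
        unfolding D_def by (auto simp: max_def)
      ultimately consider "D = 1" "card S = 1" | "D = 1" "card S \<ge> 2" | "D = (real (card S) - 3) / 2" | "D = real_of_int N"
        by linarith
      thus ?thesis using that D1 by cases auto
    qed
    thus False
    proof cases
      case 1
      thus ?thesis using partial_sums_omega_half_card[OF S f f_out f_in _ _ small] D1 by simp
    next
      case 2
      then obtain p where p: "S = {p}" by (auto simp: card_1_singleton_iff)
      have "\<forall>\<^sub>F n in sequentially. norm (\<Sum>k=1..n. f k) \<le> \<epsilon> * ln (real n)" if "\<epsilon> > 0" for \<epsilon>
        using small[OF that] eventually_ge_at_top[of 1] by eventually_elim (simp add: 2)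
      moreover have "prime p" "\<forall>r. prime r \<and> r \<noteq> p \<longrightarrow> f r = chi (int r)" "f p \<noteq> chi (int p)" "norm (f p) = 1"
        using S(3) f_out f_in unfolding p by blast+
      ultimately show ?thesis using partial_sums_omega_one_prime[OF f] by blast
    next
      case 3
      define m where "m = nat N"
      have m: "N = int m" "m \<ge> 1" using 3 by (auto simp: m_def)
      \<comment> \<open>\<open>N >= 1\<close> removes the maximum with 0; the 1 subtracted from
        \<open>T\<close> for even \<open>chi\<close> is the zero of \<open>L\<close> at 0.\<close>
      have "card {p\<in>S. f p = 1} = card {p\<in>S. chi (int p) = 1} + (if chi (- 1) = - 1 then 0 else 1) + m"
        using m 3(1) unfolding N_def T_def by (auto simp: max_def split: if_splits)
      moreover have "D = real m" using 3(2) m(1) by simp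
      ultimately show ?thesis using partial_sums_omega_order[OF S(1,3) f f_out m(2)] small by blast
    qed
  qed
qed

end
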